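(* Let $K$ be a non-archimedean local field. Let $\Gamma\le \mathrm{SL}_2(K)$ be discrete and non-elementary, and let $\phi_n:\Gamma\to G_n$ ($n\ge1$) be isomorphisms onto subgroups $G_n$ of $\mathrm{SL}_2(K)$ such that $G_n$ is discrete for all sufficiently large $n$. Suppose that $\{G_n\}$ converges algebraically to $G$, i.e. for every $\gamma\in\Gamma$ the limit $\lim_{n\to\infty}\phi_n(\gamma)$ exists in $\mathrm{SL}_2(K)$, and $G=\{\lim_n\phi_n(\gamma):\gamma\in\Gamma\}$. Then $G$ is discrete and non-elementary, and the map $\phi:\Gamma\to G$, $\phi(\gamma)=\lim_{n\to\infty}\phi_n(\gamma)$, is an isomorphism. ($\Gamma$ need not be finitely generated.)
   Context: A non-archimedean local field is a finite extension of $\mathbb{Q}_p$ or $\mathbb{F}_q((t))$. $\mathrm{SL}_2(K)$ has the subspace topology from $K^4$ and acts by isometries on its Bruhat–Tits tree $T_K$. A subgroup is elementary if it stabilises a vertex, an end, or a pair of ends of $T_K$, and non-elementary otherwise. *)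

theory Defs
  imports "HOL-Analysis.Analysis"
begin

text \<open>A non-archimedean local field is given by a field type 'k together with a
normalized discrete valuation v (values on nonzero elements; v 0 is irrelevant)
such that 'k is complete for the associated absolute value and the residue field
is finite. (This is the standard intrinsic characterization of the finite
extensions of Q_p and of F_q((t)).)\<close>

definition vabs :: "('k::field \<Rightarrow> int) \<Rightarrow> 'k \<Rightarrow> real" where
  "vabs v x = (if x = 0 then 0 else (2::real) powr (- real_of_int (v x)))"

definition vdist :: "('k::field \<Rightarrow> int) \<Rightarrow> 'k \<Rightarrow> 'k \<Rightarrow> real" where
  "vdist v x y = vabs v (x - y)"

definition OK :: "('k::field \<Rightarrow> int) \<Rightarrow> 'k set" where
  "OK v = {x. x = 0 \<or> 0 \<le> v x}"

definition nonarch_local_field :: "('k::field \<Rightarrow> int) \<Rightarrow> bool" where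
  "nonarch_local_field v \<longleftrightarrow>
     (\<forall>x y. x \<noteq> 0 \<and> y \<noteq> 0 \<longrightarrow> v (x * y) = v x + v y)
   \<and> (\<forall>x y. x \<noteq> 0 \<and> y \<noteq> 0 \<and> x + y \<noteq> 0 \<longrightarrow> min (v x) (v y) \<le> v (x + y))
   \<and> (\<exists>p. p \<noteq> 0 \<and> v p = 1)
   \<and> (\<forall>s::nat \<Rightarrow> 'k. (\<forall>e>0. \<exists>N. \<forall>m\<ge>N. \<forall>n\<ge>N. vdist v (s m) (s n) < e)
          \<longrightarrow> (\<exists>l. \<forall>e>0. \<exists>N. \<forall>n\<ge>N. vdist v (s n) l < e))
   \<and> (\<exists>S. finite S \<and> S \<subseteq> OK v \<and> (\<forall>x\<in>OK v. \<exists>s\<in>S. x - s = 0 \<or> 1 \<le> v (x - s)))"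

definition SL2 :: "('k::field ^2^2) set" where
  "SL2 = {A. det A = 1}"

definition mconv :: "('k::field \<Rightarrow> int) \<Rightarrow> (nat \<Rightarrow> 'k^2^2) \<Rightarrow> 'k^2^2 \<Rightarrow> bool" where
  "mconv v s L \<longleftrightarrow> (\<forall>i j. \<forall>e>0. \<exists>N. \<forall>n\<ge>N. vdist v (s n $ i $ j) (L $ i $ j) < e)"

definition discrete_set :: "('k::field \<Rightarrow> int) \<Rightarrow> ('k^2^2) set \<Rightarrow> bool" where
  "discrete_set v G \<longleftrightarrow>
     (\<forall>g\<in>G. \<exists>e>0. \<forall>h\<in>G. (\<forall>i j. vdist v (h $ i $ j) (g $ i $ j) < e) \<longrightarrow> h = g)"

definition SL2_subgroup :: "('k::field ^2^2) set \<Rightarrow> bool" where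
  "SL2_subgroup G \<longleftrightarrow> G \<subseteq> SL2 \<and> mat 1 \<in> G \<and> (\<forall>a\<in>G. \<forall>b\<in>G. a ** b \<in> G)
     \<and> (\<forall>a\<in>G. \<exists>b\<in>G. a ** b = mat 1)"

definition group_iso :: "('k::field ^2^2 \<Rightarrow> 'k^2^2) \<Rightarrow> ('k^2^2) set \<Rightarrow> ('k^2^2) set \<Rightarrow> bool" where
  "group_iso f A B \<longleftrightarrow> bij_betw f A B \<and> (\<forall>a\<in>A. \<forall>b\<in>A. f (a ** b) = f a ** f b)"

definition lattice :: "('k::field \<Rightarrow> int) \<Rightarrow> ('k^2) set \<Rightarrow> bool" where
  "lattice v L \<longleftrightarrow> (\<exists>B::'k^2^2. det B \<noteq> 0 \<and> L = {B *v a | a. \<forall>i. a $ i \<in> OK v})"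

definition lattice_class :: "('k^2) set \<Rightarrow> ('k::field^2) set set" where
  "lattice_class L = {(\<lambda>z. c *s z) ` L | c. c \<noteq> 0}"

definition BT_vertices :: "('k::field \<Rightarrow> int) \<Rightarrow> ('k^2) set set set" where
  "BT_vertices v = {lattice_class L | L. lattice v L}"

definition BT_adj :: "('k::field \<Rightarrow> int) \<Rightarrow> ('k^2) set set \<Rightarrow> ('k^2) set set \<Rightarrow> bool" where
  "BT_adj v x y \<longleftrightarrow> x \<in> BT_vertices v \<and> y \<in> BT_vertices v \<and>
     (\<exists>L\<in>x. \<exists>L'\<in>y. \<exists>p. p \<noteq> 0 \<and> v p = 1 \<and> (\<lambda>z. p *s z) ` L \<subset> L' \<and> L' \<subset> L)"

definition BT_act :: "'k::field^2^2 \<Rightarrow> ('k^2) set set \<Rightarrow> ('k^2) set set" where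
  "BT_act g x = (\<lambda>L. (\<lambda>z. g *v z) ` L) ` x"

definition BT_ray :: "('k::field \<Rightarrow> int) \<Rightarrow> (nat \<Rightarrow> ('k^2) set set) \<Rightarrow> bool" where
  "BT_ray v r \<longleftrightarrow> (\<forall>i. BT_adj v (r i) (r (Suc i))) \<and> (\<forall>i. r i \<noteq> r (Suc (Suc i)))"

definition same_end :: "(nat \<Rightarrow> 'a) \<Rightarrow> (nat \<Rightarrow> 'a) \<Rightarrow> bool" where
  "same_end r r' \<longleftrightarrow> (\<exists>k m. \<forall>i. r (i + k) = r' (i + m))"

definition stab_vertex :: "('k::field \<Rightarrow> int) \<Rightarrow> ('k^2^2) set \<Rightarrow> bool" where
  "stab_vertex v G \<longleftrightarrow> (\<exists>x\<in>BT_vertices v. \<forall>g\<in>G. BT_act g x = x)"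

definition stab_end :: "('k::field \<Rightarrow> int) \<Rightarrow> ('k^2^2) set \<Rightarrow> bool" where
  "stab_end v G \<longleftrightarrow> (\<exists>r. BT_ray v r \<and> (\<forall>g\<in>G. same_end (\<lambda>i. BT_act g (r i)) r))"

definition stab_end_pair :: "('k::field \<Rightarrow> int) \<Rightarrow> ('k^2^2) set \<Rightarrow> bool" where
  "stab_end_pair v G \<longleftrightarrow> (\<exists>r1 r2. BT_ray v r1 \<and> BT_ray v r2 \<and> \<not> same_end r1 r2 \<and>
     (\<forall>g\<in>G. (same_end (\<lambda>i. BT_act g (r1 i)) r1 \<and> same_end (\<lambda>i. BT_act g (r2 i)) r2)
          \<or> (same_end (\<lambda>i. BT_act g (r1 i)) r2 \<and> same_end (\<lambda>i. BT_act g (r2 i)) r1)))"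

definition elementary :: "('k::field \<Rightarrow> int) \<Rightarrow> ('k^2^2) set \<Rightarrow> bool" where
  "elementary v G \<longleftrightarrow> stab_vertex v G \<or> stab_end v G \<or> stab_end_pair v G"

end

theory Submission
  imports Defs
begin

text \<open>
  Near the identity, elements of a discrete group are torsion of order a power of the residue
  characteristic. In characteristic \<open>0\<close> a whole neighbourhood of \<open>1\<close> is torsion free, so an element
  of \<open>\<Gamma>\<close> whose limit is close to \<open>1\<close> is trivial. In characteristic \<open>p\<close> such elements are unipotent,
  and if \<open>a\<close>, \<open>b\<close> and \<open>ab\<close> are unipotent then \<open>a\<close> and \<open>b\<close> commute. Hence if the limit of \<open>c \<noteq> 1\<close> is
  close enough to \<open>1\<close>, then \<open>c\<close> commutes with its conjugates by a finite set \<open>S\<close> chosen in advance,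
  so \<open>S\<close> preserves the line fixed by \<open>c\<close>; taking \<open>S \<subseteq> \<Gamma>\<close> without a common eigenvector is
  a contradiction. This gives injectivity and discreteness at once.

  Ends of the tree correspond to lines in \<open>K\<^sup>2\<close>. If the limit group stabilises an end or a pair of
  ends, its commutators commute, hence so do those of \<open>\<Gamma>\<close>. Then \<open>\<Gamma>\<close> normalises a two-dimensional
  subalgebra \<open>K[g]\<close>: if \<open>g\<close> has an eigenvector, \<open>\<Gamma>\<close> preserves a line or a pair of lines, and otherwise
  all traces in the centraliser of \<open>g\<close> are integral and \<open>\<Gamma>\<close> is bounded. If the limit group
  stabilises a vertex it is finite, so \<open>\<Gamma>\<close> is finite. Bounded groups stabilise a vertex.
\<close>

section \<open>The absolute value of a local field\<close>

text \<open>No finite generating set is at hand, and in positive characteristic discrete groups may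
  contain torsion arbitrarily close to \<open>1\<close>, so no single neighbourhood of
  \<open>1\<close> works for all of them. The one found depends on \<Gamma>: a bound for \<phi>lim
  on \<open>S\<close> controls, uniformly in \<open>c\<close>, the conjugations that are used.
  Torsion of p-power order is unipotent because A^p - 1 = (A - 1)^p in characteristic p.

  The maps \<open>\<phi> n\<close> respect words, not traces or lines. Facts about small elements
  are therefore proved in one discrete image and brought back as torsion or commutation; and for the
  same reason the limit group is compared with \<Gamma> through the relation that commutators
  commute.

  If \<open>g\<close> has no eigenvector, K[g] is a quadratic field. Its equation X^2 - tX + 1 could
  be inseparable only in characteristic 2 with t = 0, where it is (X + 1)^2 and has a root; so the
  discriminant t^2 - 4 is nonzero, and an element of K[g] is bounded by its trace and its trace
  against \<open>g\<close>. Traces are integral because X^2 - tX + 1 has a root in K once |t| >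
  1.\<close>

locale nonarch_field =
  fixes v :: "'k::field \<Rightarrow> int"
  assumes local_field: "nonarch_local_field v"
begin

lemma val_mult: "x \<noteq> 0 \<Longrightarrow> y \<noteq> 0 \<Longrightarrow> v (x * y) = v x + v y"
  using local_field unfolding nonarch_local_field_def by blast

lemma val_one [simp]: "v 1 = 0"
  using val_mult[of 1 1] by simp

lemma val_uminus [simp]: "v (- x) = v x"
proof (cases "x = 0")
  case False
  have "v (-1) = 0" using val_mult[of "-1" "-1"] by simp
  then show ?thesis using val_mult[of "-1" x] False by simp
qed simp

lemma vabs_zero [simp]: "vabs v 0 = 0"
  by (simp add: vabs_def)

lemma vabs_one [simp]: "vabs v 1 = 1"
  by (simp add: vabs_def)

lemma vabs_nonneg [simp]: "0 \<le> vabs v x"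
  by (simp add: vabs_def)

lemma vabs_eq_0_iff [simp]: "vabs v x = 0 \<longleftrightarrow> x = 0"
  by (simp add: vabs_def)

lemma vabs_pos_iff [simp]: "0 < vabs v x \<longleftrightarrow> x \<noteq> 0"
  by (simp add: vabs_def)

lemma vabs_uminus [simp]: "vabs v (- x) = vabs v x"
  by (simp add: vabs_def)

lemma vabs_mult: "vabs v (x * y) = vabs v x * vabs v y"
  by (simp add: vabs_def val_mult powr_add[symmetric])

lemma vabs_power: "vabs v (x ^ n) = vabs v x ^ n"
  by (induction n) (simp_all add: vabs_mult)

lemma vabs_inverse: "vabs v (inverse x) = inverse (vabs v x)"
proof (cases "x = 0")
  case False
  then have "vabs v (inverse x) * vabs v x = 1" by (simp flip: vabs_mult)
  then show ?thesis by (metis inverse_unique mult.commute)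
qed simp

lemma vabs_divide: "vabs v (x / y) = vabs v x / vabs v y"
  by (simp add: divide_inverse vabs_mult vabs_inverse)

lemma vabs_add: "vabs v (x + y) \<le> max (vabs v x) (vabs v y)"
proof (cases "x = 0 \<or> y = 0 \<or> x + y = 0")
  case True
  then show ?thesis by (auto simp: max_def)
next
  case False
  then have "min (v x) (v y) \<le> v (x + y)"
    using local_field unfolding nonarch_local_field_def by blast
  then show ?thesis using False by (auto simp: vabs_def max_def min_def split: if_splits)
qed

lemma vabs_add_le: "vabs v x \<le> r \<Longrightarrow> vabs v y \<le> r \<Longrightarrow> vabs v (x + y) \<le> r"
  using vabs_add[of x y] by linarith

lemma vabs_diff_le: "vabs v x \<le> r \<Longrightarrow> vabs v y \<le> r \<Longrightarrow> vabs v (x - y) \<le> r"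
  using vabs_add_le[of x r "- y"] by simp

lemma vabs_add_less: "vabs v x < r \<Longrightarrow> vabs v y < r \<Longrightarrow> vabs v (x + y) < r"
  using vabs_add[of x y] by linarith

lemma vabs_diff_less: "vabs v x < r \<Longrightarrow> vabs v y < r \<Longrightarrow> vabs v (x - y) < r"
  using vabs_add_less[of x r "- y"] by simp

lemma vabs_minus_commute: "vabs v (x - y) = vabs v (y - x)"
  by (metis minus_diff_eq vabs_uminus)

lemma vabs_add_eq_left:
  assumes "vabs v y < vabs v x"
  shows "vabs v (x + y) = vabs v x"
proof (rule antisym)
  show "vabs v (x + y) \<le> vabs v x" using vabs_add[of x y] assms by simp
  show "vabs v x \<le> vabs v (x + y)"
    using vabs_add[of "x + y" "- y"] assms by (simp add: max_def split: if_splits)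
qed

lemma vabs_mult_le:
  "vabs v x \<le> r \<Longrightarrow> vabs v y \<le> s \<Longrightarrow> 0 \<le> r \<Longrightarrow> vabs v (x * y) \<le> r * s"
  unfolding vabs_mult by (intro mult_mono) auto

lemma vabs_of_nat_le_1: "vabs v (of_nat n) \<le> 1"
  by (induction n) (simp_all add: vabs_add_le)

lemma OK_iff: "x \<in> OK v \<longleftrightarrow> vabs v x \<le> 1"
proof (cases "x = 0")
  case False
  have "(2::real) powr (- real_of_int (v x)) \<le> 2 powr 0 \<longleftrightarrow> 0 \<le> v x"
    by (subst powr_le_cancel_iff) simp_all
  with False show ?thesis by (simp add: OK_def vabs_def)
qed (simp add: OK_def)

lemma vabs_eq_powr: "x \<noteq> 0 \<Longrightarrow> vabs v x = 2 powr (- real_of_int (v x))"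
  by (simp add: vabs_def)

lemma vabs_le_iff: "x \<noteq> 0 \<Longrightarrow> y \<noteq> 0 \<Longrightarrow> vabs v x \<le> vabs v y \<longleftrightarrow> v y \<le> v x"
  by (simp add: vabs_def)

lemma ex_uniformizer: "\<exists>p. p \<noteq> 0 \<and> v p = 1"
  using local_field unfolding nonarch_local_field_def by blast

lemma vabs_val_one: "p \<noteq> 0 \<Longrightarrow> v p = 1 \<Longrightarrow> vabs v p = 1 / 2"
  by (simp add: vabs_def powr_minus_divide)

lemma ex_vabs_half: "\<exists>p. p \<noteq> 0 \<and> vabs v p = 1 / 2"
  using ex_uniformizer vabs_val_one by blast

lemma vabs_less_1_imp_le_half:
  assumes "vabs v x < 1"
  shows "vabs v x \<le> 1 / 2"
proof (cases "x = 0")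
  case False
  have "\<not> v x \<le> 0"
  proof
    assume "v x \<le> 0"
    then have "(2::real) powr 0 \<le> 2 powr (- real_of_int (v x))"
      by (intro powr_mono) auto
    then show False using assms False by (simp add: vabs_def)
  qed
  then have "1 \<le> v x" by simp
  then have "(2::real) powr (- real_of_int (v x)) \<le> 2 powr (-1)"
    by (intro powr_mono) auto
  then show ?thesis using False by (simp add: vabs_def powr_minus_divide)
qed simp

text \<open>In an ultrametric a tail is no larger than its largest step, so the limit is within the
  size of the next step of each term, with no constant lost.\<close>

lemma complete_geometric:
  assumes "\<And>n. vabs v (s (Suc n) - s n) \<le> (1/2) ^ n"
  shows "\<exists>l. \<forall>n. vabs v (s n - l) \<le> (1/2) ^ n"
proof -
  have le: "vabs v (s (n + k) - s n) \<le> (1/2) ^ n" for n k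
  proof (induction k)
    case (Suc k)
    have "vabs v (s (Suc (n + k)) - s (n + k)) \<le> (1/2) ^ n"
      using assms[of "n + k"] power_decreasing[of n "n + k" "1/2::real"] by linarith
    from vabs_add_le[OF this Suc] show ?case by simp
  qed simp
  have le2: "vabs v (s m - s n) \<le> (1/2) ^ N" if "N \<le> m" "N \<le> n" for m n N
  proof -
    have "vabs v (s m - s N) \<le> (1/2) ^ N" "vabs v (s n - s N) \<le> (1/2) ^ N"
      using le[of N "m - N"] le[of N "n - N"] that by simp_all
    from vabs_diff_le[OF this] show ?thesis by simp
  qed
  have "\<forall>e>0. \<exists>N. \<forall>m\<ge>N. \<forall>n\<ge>N. vdist v (s m) (s n) < e"
  proof (intro allI impI)
    fix e :: real assume "e > 0"
    then obtain N where "(1/2::real) ^ N < e"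
      using real_arch_pow_inv[of e "1/2"] by auto
    then show "\<exists>N. \<forall>m\<ge>N. \<forall>n\<ge>N. vdist v (s m) (s n) < e"
      using le2 unfolding vdist_def by (meson le_less_trans)
  qed
  then obtain l where l: "\<And>e. e > 0 \<Longrightarrow> \<exists>N. \<forall>n\<ge>N. vdist v (s n) l < e"
    using local_field unfolding nonarch_local_field_def by blast
  have "vabs v (s n - l) \<le> (1/2) ^ n" for n
  proof -
    obtain N where N: "\<forall>m\<ge>N. vdist v (s m) l < (1/2) ^ n" using l[of "(1/2)^n"] by auto
    define m where "m = max N n"
    have "vabs v (s m - l) \<le> (1/2) ^ n" using N unfolding vdist_def m_def by (simp add: less_imp_le)
    from vabs_diff_le[OF this le2[of n m n]] show ?thesis
      by (simp add: m_def vabs_minus_commute[of l])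
  qed
  then show ?thesis by blast
qed

lemma finite_residue_cover:
  "\<exists>S. finite S \<and> (\<forall>x. vabs v x \<le> 1 \<longrightarrow> (\<exists>s\<in>S. vabs v s \<le> 1 \<and> vabs v (x - s) \<le> 1/2))"
proof -
  obtain S where S: "finite S" "S \<subseteq> OK v" "\<forall>x\<in>OK v. \<exists>s\<in>S. x - s = 0 \<or> 1 \<le> v (x - s)"
    using local_field unfolding nonarch_local_field_def by blast
  have "vabs v y \<le> 1/2" if "y = 0 \<or> 1 \<le> v y" for y
  proof (cases "y = 0")
    case False
    then have "(2::real) powr (- real_of_int (v y)) \<le> 2 powr (-1)"
      using that by (intro powr_mono) auto
    then show ?thesis using False by (simp add: vabs_def powr_minus_divide)
  qed simp
  with S show ?thesis by (meson OK_iff subsetD)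
qed

text \<open>One more digit per step: x is s + p y with s from a finite set of residue
  representatives, and y is approximated to the previous precision.\<close>

lemma finite_cover_unit_ball:
  "\<exists>F. finite F \<and> (\<forall>x. vabs v x \<le> 1 \<longrightarrow> (\<exists>f\<in>F. vabs v (x - f) \<le> (1/2) ^ k))"
proof (induction k)
  case 0
  show ?case by (intro exI[of _ "{0}"]) auto
next
  case (Suc k)
  then obtain F where F: "finite F" "\<forall>x. vabs v x \<le> 1 \<longrightarrow> (\<exists>f\<in>F. vabs v (x - f) \<le> (1/2) ^ k)"
    by blast
  obtain S where S: "finite S" "\<forall>x. vabs v x \<le> 1 \<longrightarrow> (\<exists>s\<in>S. vabs v s \<le> 1 \<and> vabs v (x - s) \<le> 1/2)"
    using finite_residue_cover by blast
  obtain p where p: "p \<noteq> 0" "vabs v p = 1/2" using ex_vabs_half by blast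
  define F' where "F' = (\<lambda>(s, f). s + p * f) ` (S \<times> F)"
  have "\<exists>f\<in>F'. vabs v (x - f) \<le> (1/2) ^ Suc k" if x: "vabs v x \<le> 1" for x
  proof -
    obtain s where s: "s \<in> S" "vabs v (x - s) \<le> 1/2" using S x by blast
    then have "vabs v ((x - s) / p) \<le> 1" using p by (simp add: vabs_divide)
    then obtain f where f: "f \<in> F" "vabs v ((x - s) / p - f) \<le> (1/2) ^ k" using F by blast
    have "x - (s + p * f) = p * ((x - s) / p - f)" using p by (simp add: field_simps)
    then have "vabs v (x - (s + p * f)) \<le> (1/2) ^ Suc k" using f by (simp add: vabs_mult p(2))
    with s f show ?thesis unfolding F'_def by force
  qed
  moreover have "finite F'" unfolding F'_def using S F by simp
  ultimately show ?case by blast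
qed

lemma finite_cover_ball:
  assumes "e > 0"
  shows "\<exists>F. finite F \<and> (\<forall>x. vabs v x \<le> C \<longrightarrow> (\<exists>f\<in>F. vabs v (x - f) < e))"
proof -
  obtain p where p: "p \<noteq> 0" "vabs v p = 1/2" using ex_vabs_half by blast
  obtain j where "C < 2 ^ j" using real_arch_pow[of 2 C] by auto
  then have j: "C * (1/2) ^ j \<le> 1" by (simp add: power_divide)
  obtain k where k: "(1/2::real) ^ k < e * (1/2) ^ j"
    using real_arch_pow_inv[of "e * (1/2)^j" "1/2"] assms by auto
  obtain F where F: "finite F" "\<forall>x. vabs v x \<le> 1 \<longrightarrow> (\<exists>f\<in>F. vabs v (x - f) \<le> (1/2) ^ k)"
    using finite_cover_unit_ball by blast
  have "\<exists>f\<in>(\<lambda>f. f / p ^ j) ` F. vabs v (x - f) < e" if "vabs v x \<le> C" for x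
  proof -
    have "vabs v (x * p ^ j) \<le> 1"
      using order_trans[OF mult_right_mono[OF that, of "(1/2)^j"] j] unfolding vabs_mult vabs_power p(2) by simp
    then obtain f where f: "f \<in> F" "vabs v (x * p ^ j - f) \<le> (1/2) ^ k" using F by blast
    have "(x - f / p ^ j) * p ^ j = x * p ^ j - f" using p by (simp add: field_simps)
    then have "vabs v (x - f / p ^ j) * (1/2) ^ j < e * (1/2) ^ j"
      using f k p by (metis vabs_mult vabs_power le_less_trans)
    then have "vabs v (x - f / p ^ j) < e" by simp
    with f show ?thesis by blast
  qed
  then show ?thesis using F(1) by blast
qed

text \<open>Pigeonhole: two naturals share a residue representative, and their difference is small.
  In characteristic 0 this number serves as the exponent, in place of the residue
  characteristic.\<close>

lemma ex_nat_vabs_less_1: "\<exists>m>0. vabs v (of_nat m) < 1"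
proof -
  obtain S where S: "finite S" "\<forall>x. vabs v x \<le> 1 \<longrightarrow> (\<exists>s\<in>S. vabs v s \<le> 1 \<and> vabs v (x - s) \<le> 1/2)"
    using finite_residue_cover by blast
  have "\<forall>n. \<exists>s. s \<in> S \<and> vabs v (of_nat n - s) \<le> 1/2"
    using S vabs_of_nat_le_1 by blast
  then obtain c where c: "\<And>n. c n \<in> S" "\<And>n. vabs v (of_nat n - c n) \<le> 1/2" by metis
  have "\<not> inj c"
    using c(1) S(1) by (meson finite_imageD finite_subset image_subsetI infinite_UNIV_nat)
  then obtain i j where ij: "i < j" "c i = c j" by (metis inj_def linorder_neqE_nat)
  have "vabs v (of_nat (j - i)) \<le> 1/2"
    using vabs_diff_le[OF c(2)[of j] c(2)[of i]] ij by (simp add: of_nat_diff)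
  with ij show ?thesis by (intro exI[of _ "j - i"]) auto
qed

text \<open>The roots of this characteristic polynomial have product 1 and sum \<open>t\<close>, so
  for large \<open>t\<close> one of them is small. It is found as the fixed point of x -> 1/(t - x),
  which contracts the open unit ball.\<close>

lemma ex_root_of_large_trace:
  assumes t: "vabs v t > 1"
  shows "\<exists>l. l * l - t * l + 1 = 0"
proof -
  define s where "s = rec_nat 0 (\<lambda>_ x. 1 / (t - x))"
  have s0: "s 0 = 0" and sS: "\<And>n. s (Suc n) = 1 / (t - s n)" by (simp_all add: s_def)
  have big: "vabs v (t - x) = vabs v t" if "vabs v x < 1" for x
    using vabs_add_eq_left[of "- x" t] that t by simp
  have small: "vabs v (s n) < 1" for n
  proof (induction n)
    case (Suc n)
    have "1 / vabs v t < 1" using t by (simp add: divide_less_eq)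
    then show ?case using big[OF Suc] by (simp add: sS vabs_divide)
  qed (simp add: s0)
  have "vabs v (1 / t) < 1" using t by (simp add: vabs_divide divide_less_eq)
  then have it: "vabs v (1 / t) \<le> 1/2" by (rule vabs_less_1_imp_le_half)
  have contr: "vabs v (1 / (t - x) - 1 / (t - y)) \<le> vabs v (x - y) * (1/2)"
    if "vabs v x < 1" "vabs v y < 1" for x y
  proof -
    have nz: "t - x \<noteq> 0" "t - y \<noteq> 0"
      using big[OF that(1)] big[OF that(2)] t by force+
    have "1 / (t - x) - 1 / (t - y) = (x - y) / ((t - x) * (t - y))"
      using nz by (simp add: field_simps)
    then have "vabs v (1 / (t - x) - 1 / (t - y)) = vabs v (x - y) * (1 / vabs v t * (1 / vabs v t))"
      using big that by (simp add: vabs_divide vabs_mult)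
    also have "\<dots> \<le> vabs v (x - y) * (1/2)"
    proof (intro mult_left_mono)
      have "1 / vabs v t \<le> 1/2" using it by (simp add: vabs_divide)
      then have "1 / vabs v t * (1 / vabs v t) \<le> 1/2 * (1/2)" by (intro mult_mono) auto
      then show "1 / vabs v t * (1 / vabs v t) \<le> 1/2" by simp
    qed simp
    finally show ?thesis .
  qed
  have "vabs v (s (Suc n) - s n) \<le> (1/2) ^ n" for n
  proof (induction n)
    case 0
    then show ?case using small[of 1] by (simp add: s0)
  next
    case (Suc n)
    have "vabs v (s (Suc (Suc n)) - s (Suc n)) \<le> vabs v (s (Suc n) - s n) * (1/2)"
      unfolding sS[of "Suc n"] sS[of n] using contr[of "1 / (t - s n)" "s n"] small[of n] small[of "Suc n"]
      by (simp add: sS)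
    with Suc show ?case by simp
  qed
  then obtain l where l: "\<And>n. vabs v (s n - l) \<le> (1/2) ^ n" using complete_geometric by blast
  have "vabs v l < 1"
    using vabs_diff_less[of "s 1" 1 "s 1 - l"] l[of 1] small[of 1] by simp
  have "vabs v (l - 1 / (t - l)) \<le> (1/2) ^ n" for n
  proof -
    have "vabs v (s (Suc n) - 1 / (t - l)) \<le> (1/2) ^ n"
      using contr[OF small[of n] \<open>vabs v l < 1\<close>] l[of n] vabs_nonneg[of "s n - l"] unfolding sS
      by linarith
    moreover have "vabs v (s (Suc n) - l) \<le> (1/2) ^ n"
      using l[of "Suc n"] vabs_nonneg[of "s (Suc n) - l"] unfolding power_Suc by linarith
    ultimately show ?thesis using vabs_diff_le by fastforce
  qed
  moreover have "\<exists>n. (1/2::real) ^ n < vabs v (l - 1 / (t - l))" if "vabs v (l - 1 / (t - l)) > 0"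
    using real_arch_pow_inv[OF that, of "1/2"] by simp
  ultimately have "\<not> vabs v (l - 1 / (t - l)) > 0" using not_less by blast
  then have "l = 1 / (t - l)" by simp
  moreover have "t - l \<noteq> 0" using big[OF \<open>vabs v l < 1\<close>] t by force
  ultimately have "l * (t - l) = 1" by (simp add: field_simps)
  then have "l * l - t * l + 1 = 0" by (simp add: algebra_simps)
  then show ?thesis by blast
qed

end

section \<open>Two-by-two matrices\<close>

lemma mat2_eq_iff:
  fixes A B :: "'a^2^2"
  shows "A = B \<longleftrightarrow> A$1$1 = B$1$1 \<and> A$1$2 = B$1$2 \<and> A$2$1 = B$2$1 \<and> A$2$2 = B$2$2"
  by (auto simp: vec_eq_iff forall_2)

lemma vec2_eq_iff:
  fixes x y :: "'a^2"
  shows "x = y \<longleftrightarrow> x$1 = y$1 \<and> x$2 = y$2"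
  by (auto simp: vec_eq_iff forall_2)

lemma mat2_mult_nth:
  fixes A B :: "'a::semiring_1^2^2"
  shows "(A ** B)$i$j = A$i$1 * B$1$j + A$i$2 * B$2$j"
  by (simp add: matrix_matrix_mult_def sum_2)

lemma mat2_vec_nth:
  fixes A :: "'a::semiring_1^2^2"
  shows "(A *v x)$i = A$i$1 * x$1 + A$i$2 * x$2"
  by (simp add: matrix_vector_mult_def sum_2)

lemma mat2_mat_nth:
  "(mat k :: 'a::semiring_1^2^2)$1$1 = k" "(mat k :: 'a::semiring_1^2^2)$1$2 = 0"
  "(mat k :: 'a::semiring_1^2^2)$2$1 = 0" "(mat k :: 'a::semiring_1^2^2)$2$2 = k"
  by (simp_all add: mat_def)

lemmas mat2_simps = mat2_eq_iff vec2_eq_iff mat2_mult_nth mat2_vec_nth mat2_mat_nth det_2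

text \<open>On determinant 1 this is the inverse, free of division and with the same bound on its
  entries.\<close>

definition adj2 :: "'a::comm_ring_1^2^2 \<Rightarrow> 'a^2^2" where
  "adj2 A = vector [vector [A$2$2, - A$1$2], vector [- A$2$1, A$1$1]]"

lemma adj2_nth [simp]:
  "adj2 A $1$1 = A$2$2" "adj2 A $1$2 = - A$1$2" "adj2 A $2$1 = - A$2$1" "adj2 A $2$2 = A$1$1"
  by (simp_all add: adj2_def)

lemma det_adj2 [simp]: "det (adj2 A) = det A"
  by (simp add: det_2)

lemma mult_adj2:
  assumes "det A = 1"
  shows "A ** adj2 A = mat 1" "adj2 A ** A = mat 1"
  using assms by (simp_all add: mat2_simps algebra_simps)

lemma conj_minus_one: "h ** (c - mat 1) ** k = h ** c ** k - h ** k"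
  for h c k :: "'a::comm_ring_1^2^2"
  by (simp add: mat2_simps algebra_simps)

lemma adj2_unique:
  assumes "det A = 1" "A ** B = mat 1"
  shows "B = adj2 A"
  by (metis assms matrix_mul_assoc matrix_mul_lid matrix_mul_rid mult_adj2(2))

lemma adj2_adj2 [simp]: "adj2 (adj2 A) = A"
  by (simp add: mat2_simps)

lemma adj2_mult: "adj2 (A ** B) = adj2 B ** adj2 A"
  by (simp add: mat2_simps algebra_simps)

lemma SL2_subgroup_det: "SL2_subgroup G \<Longrightarrow> a \<in> G \<Longrightarrow> det a = 1"
  by (auto simp: SL2_subgroup_def SL2_def)

lemma SL2_subgroup_one: "SL2_subgroup G \<Longrightarrow> mat 1 \<in> G"
  by (auto simp: SL2_subgroup_def)

lemma SL2_subgroup_mult: "SL2_subgroup G \<Longrightarrow> a \<in> G \<Longrightarrow> b \<in> G \<Longrightarrow> a ** b \<in> G"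
  by (auto simp: SL2_subgroup_def)

lemma SL2_subgroup_adj2: "SL2_subgroup G \<Longrightarrow> a \<in> G \<Longrightarrow> adj2 a \<in> G"
  by (metis SL2_subgroup_def SL2_subgroup_det adj2_unique)

section \<open>Powers of matrices, and unipotence in characteristic p\<close>

primrec mpow :: "'a::comm_ring_1^2^2 \<Rightarrow> nat \<Rightarrow> 'a^2^2" where
  "mpow A 0 = mat 1"
| "mpow A (Suc n) = A ** mpow A n"

lemma det_mpow: "det (mpow A n) = det A ^ n"
  by (induction n) (simp_all add: det_mul)

lemma mpow_closed: "SL2_subgroup G \<Longrightarrow> g \<in> G \<Longrightarrow> mpow g n \<in> G"
  by (induction n) (simp_all add: SL2_subgroup_one SL2_subgroup_mult)

lemma mpow_closed_iter: "SL2_subgroup G \<Longrightarrow> g \<in> G \<Longrightarrow> ((\<lambda>h. mpow h m) ^^ k) g \<in> G"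
  by (induction k) (simp_all add: mpow_closed)

lemma mpow_binomial:
  "mpow (mat 1 + X) n $i$j = (\<Sum>k\<le>n. of_nat (n choose k) * mpow X k $i$j)"
proof (induction n arbitrary: i j)
  case (Suc n)
  have "mpow (mat 1 + X) (Suc n) $i$j
      = mpow (mat 1 + X) n $i$j + (X ** mpow (mat 1 + X) n)$i$j"
    by (simp add: mat2_mult_nth mat_def algebra_simps) (smt (verit) exhaust_2)
  also have "(X ** mpow (mat 1 + X) n)$i$j = (\<Sum>k\<le>n. of_nat (n choose k) * mpow X (Suc k) $i$j)"
    unfolding mat2_mult_nth Suc.IH
    by (simp add: mat2_mult_nth sum_distrib_left sum.distrib[symmetric] algebra_simps)
  also have "mpow (mat 1 + X) n $i$j
      = mpow X 0 $i$j + (\<Sum>k\<le>n. of_nat (n choose Suc k) * mpow X (Suc k) $i$j)"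
  proof -
    have "(\<Sum>k\<le>n. of_nat (n choose k) * mpow X k $i$j) = (\<Sum>k\<le>Suc n. of_nat (n choose k) * mpow X k $i$j)"
      by (simp add: binomial_eq_0)
    also have "\<dots> = mpow X 0 $i$j + (\<Sum>k\<le>n. of_nat (n choose Suc k) * mpow X (Suc k) $i$j)"
      by (subst sum.atMost_Suc_shift) simp
    finally show ?thesis by (simp add: Suc)
  qed
  finally have "mpow (mat 1 + X) (Suc n) $i$j
      = mpow X 0 $i$j + (\<Sum>k\<le>n. of_nat (Suc n choose Suc k) * mpow X (Suc k) $i$j)"
    by (simp add: sum.distrib[symmetric] algebra_simps)
  also have "\<dots> = (\<Sum>k\<le>Suc n. of_nat (Suc n choose k) * mpow X k $i$j)"
    unfolding sum.atMost_Suc_shift[of _ n] by simp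
  finally show ?case .
qed simp

text \<open>The inner binomial coefficients are multiples of \<open>p\<close>.\<close>

lemma mpow_freshmans_dream:
  fixes A :: "'a::comm_ring_1^2^2"
  assumes p: "prime p" "of_nat p = (0::'a)"
  shows "mpow A p - mat 1 = mpow (A - mat 1) p"
proof -
  have "mpow A p $i$j = mat 1 $i$j + mpow (A - mat 1) p $i$j" for i j
  proof -
    let ?f = "\<lambda>k. of_nat (p choose k) * mpow (A - mat 1) k $i$j"
    have p0: "p > 0" using p(1) prime_gt_0_nat by blast
    have "mpow A p $i$j = (\<Sum>k\<le>p. ?f k)"
      using mpow_binomial[of "A - mat 1" p i j] by simp
    also have "\<dots> = (\<Sum>k\<in>{0,p}. ?f k)"
    proof (rule sum.mono_neutral_right)
      show "\<forall>k\<in>{..p} - {0, p}. ?f k = 0"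
      proof
        fix k assume "k \<in> {..p} - {0, p}"
        then have "p dvd (p choose k)" using p(1) by (intro dvd_choose_prime) auto
        then have "of_nat (p choose k) = (0::'a)" using p(2) by (auto elim!: dvdE)
        then show "?f k = 0" by simp
      qed
    qed auto
    finally show ?thesis using p0 by simp
  qed
  then show ?thesis by (simp add: vec_eq_iff)
qed

lemma det_mpow_minus_one:
  fixes A :: "'a::comm_ring_1^2^2"
  assumes "prime p" "of_nat p = (0::'a)"
  shows "det (mpow A p - mat 1) = det (A - mat 1) ^ p"
  by (simp add: mpow_freshmans_dream[OF assms] det_mpow)

text \<open>Each p-th power raises det(A - 1) to the p-th power, so in a domain it vanishes after
  \<open>k\<close> rounds only if it vanished before. For determinant 1 the conclusion says that
  \<open>A\<close> is unipotent.\<close>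

lemma det_minus_one_of_torsion:
  fixes A :: "'a::idom^2^2"
  assumes "prime p" "of_nat p = (0::'a)" "((\<lambda>h. mpow h p) ^^ k) A = mat 1"
  shows "det (A - mat 1) = 0"
proof -
  have "det (((\<lambda>h. mpow h p) ^^ k) A - mat 1) = 0 \<longrightarrow> det (A - mat 1) = 0"
    by (induction k) (auto simp: det_mpow_minus_one[OF assms(1,2)])
  then show ?thesis using assms(3) by (simp add: det_2)
qed

section \<open>Lines in the plane and eigenlines\<close>

text \<open>For nonzero vectors, \<open>par u w\<close> means that \<open>u\<close> and \<open>w\<close> span the same line.\<close>

definition par :: "'a::comm_ring_1^2 \<Rightarrow> 'a^2 \<Rightarrow> bool" where
  "par u w \<longleftrightarrow> u$1 * w$2 = u$2 * w$1"

lemma par_refl [simp]: "par u u"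
  by (simp add: par_def)

lemma par_sym: "par u w \<Longrightarrow> par w u"
  by (simp add: par_def mult.commute)

lemma par_scale [simp]: "par (c *s u) u" "par u (c *s u)"
  by (simp_all add: par_def)

lemma vec2_nonzero_iff: "u \<noteq> 0 \<longleftrightarrow> u$1 \<noteq> 0 \<or> u$2 \<noteq> 0"
  for u :: "'a::zero^2"
  by (simp add: vec2_eq_iff)

lemma par_imp_multiple:
  fixes u w :: "'a::field^2"
  assumes "par u w" "u \<noteq> 0"
  obtains c where "w = c *s u"
proof (cases "u$1 = 0")
  case True
  then have "w = (w$2 / u$2) *s u" using assms by (auto simp: vec2_eq_iff par_def)
  then show ?thesis by (rule that)
next
  case False
  then have "w = (w$1 / u$1) *s u" using assms by (auto simp: vec2_eq_iff par_def field_simps)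
  then show ?thesis by (rule that)
qed

lemma par_trans:
  fixes u w z :: "'a::field^2"
  assumes "par u w" "par w z" "w \<noteq> 0"
  shows "par u z"
proof -
  obtain c d where "u = c *s w" "z = d *s w"
    using assms by (metis par_imp_multiple par_sym)
  then show ?thesis by (simp add: par_def)
qed

lemma not_par_nonzero: "\<not> par u w \<Longrightarrow> u \<noteq> 0 \<and> w \<noteq> 0"
  by (auto simp: par_def)

lemma vec2_decompose:
  fixes u w z :: "'a::field^2"
  assumes "\<not> par u w"
  obtains x y where "z = x *s u + y *s w"
proof -
  define d where "d = u$1 * w$2 - u$2 * w$1"
  have d: "d \<noteq> 0" using assms by (simp add: d_def par_def)
  have "d * z$1 = (z$1 * w$2 - z$2 * w$1) * u$1 + (u$1 * z$2 - u$2 * z$1) * w$1"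
    "d * z$2 = (z$1 * w$2 - z$2 * w$1) * u$2 + (u$1 * z$2 - u$2 * z$1) * w$2"
    unfolding d_def by algebra+
  then have "z = ((z$1 * w$2 - z$2 * w$1) / d) *s u + ((u$1 * z$2 - u$2 * z$1) / d) *s w"
    using d by (simp add: vec2_eq_iff divide_simps) (simp add: mult.commute)
  then show ?thesis by (rule that)
qed

lemma vec2_combination_unique:
  fixes u w :: "'a::field^2"
  assumes "\<not> par u w" "x *s u + y *s w = x' *s u + y' *s w"
  shows "x = x'" "y = y'"
proof -
  have e: "(x - x') * u$1 + (y - y') * w$1 = 0" "(x - x') * u$2 + (y - y') * w$2 = 0"
    using assms(2) by (simp_all add: vec2_eq_iff algebra_simps)
  have "(x - x') * (u$1 * w$2 - u$2 * w$1) = 0" "(y - y') * (u$1 * w$2 - u$2 * w$1) = 0"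
    using e by algebra+
  then show "x = x'" "y = y'" using assms(1) by (simp_all add: par_def)
qed

lemma par_mult_iff:
  assumes "det A = 1"
  shows "par (A *v u) (A *v w) \<longleftrightarrow> par u w"
proof -
  have "(A *v u)$1 * (A *v w)$2 - (A *v u)$2 * (A *v w)$1 = det A * (u$1 * w$2 - u$2 * w$1)"
    by (simp add: mat2_simps algebra_simps)
  then have "(A *v u)$1 * (A *v w)$2 - (A *v u)$2 * (A *v w)$1 = u$1 * w$2 - u$2 * w$1"
    using assms by simp
  then show ?thesis unfolding par_def by (metis eq_iff_diff_eq_0)
qed

lemma mult_vec_nonzero:
  fixes A :: "'a::comm_ring_1^2^2"
  assumes "det A = 1" "u \<noteq> 0"
  shows "A *v u \<noteq> 0"
  by (metis assms matrix_vector_mul_assoc matrix_vector_mul_lid matrix_vector_mult_0_right mult_adj2(2))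

lemma det_zero_kernel:
  fixes A :: "'a::field^2^2"
  assumes "det A = 0"
  obtains u where "u \<noteq> 0" "A *v u = 0"
proof -
  consider "A$1$1 \<noteq> 0 \<or> A$1$2 \<noteq> 0" | "A$2$1 \<noteq> 0 \<or> A$2$2 \<noteq> 0"
    | "A$1$1 = 0" "A$1$2 = 0" "A$2$1 = 0" "A$2$2 = 0" by blast
  then show ?thesis
  proof cases
    case 1
    show ?thesis
      by (rule that[of "vector [A$1$2, - A$1$1]"]) (use 1 assms in \<open>auto simp: mat2_simps algebra_simps\<close>)
  next
    case 2
    show ?thesis
      by (rule that[of "vector [A$2$2, - A$2$1]"]) (use 2 assms in \<open>auto simp: mat2_simps algebra_simps\<close>)
  next
    case 3
    show ?thesis
      by (rule that[of "vector [1, 0]"]) (use 3 in \<open>auto simp: mat2_simps\<close>)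
  qed
qed

lemma mat2_eq_on_basis:
  fixes A B :: "'a::field^2^2"
  assumes "\<not> par u w" "A *v u = B *v u" "A *v w = B *v w"
  shows "A = B"
proof -
  have "A *v z = B *v z" for z
  proof -
    obtain x y where "z = x *s u + y *s w" using vec2_decompose[OF assms(1)] .
    then show ?thesis using assms by (simp add: matrix_vector_right_distrib vector_scalar_commute)
  qed
  then show ?thesis by (simp add: matrix_eq)
qed

lemma fixed_vectors_par:
  fixes d :: "'a::field^2^2"
  assumes "d \<noteq> mat 1" "d *v x = x" "d *v y = y"
  shows "par x y"
  using mat2_eq_on_basis[of x y d "mat 1"] assms by auto

text \<open>Write a = 1 + X and b = 1 + Y. The hypotheses make X and Y nilpotent of trace zero, and
  unipotence of ab adds tr(XY) = 0. This forces X and Y to be proportional.\<close>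

lemma unipotents_commute:
  fixes a b :: "'a::field^2^2"
  assumes "det a = 1" "det b = 1" "det (a - mat 1) = 0" "det (b - mat 1) = 0"
    "det (a ** b - mat 1) = 0"
  shows "a ** b = b ** a"
proof -
  define a1 a2 a3 b1 b2 b3 where
    "a1 = a$1$1 - 1" "a2 = a$1$2" "a3 = a$2$1" "b1 = b$1$1 - 1" "b2 = b$1$2" "b3 = b$2$1"
  have a: "a$1$1 = 1 + a1" "a$1$2 = a2" "a$2$1 = a3" and b: "b$1$1 = 1 + b1" "b$1$2 = b2" "b$2$1 = b3"
    by (simp_all add: a1_a2_a3_b1_b2_b3_def)
  have a4: "a$2$2 = 1 - a1" and b4: "b$2$2 = 1 - b1"
    using assms(1-4) unfolding det_2 a b by (simp_all add: mat2_mat_nth a b) algebra+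
  have ea: "a1 * a1 + a2 * a3 = 0" using assms(1) unfolding det_2 a a4 by algebra
  have eb: "b1 * b1 + b2 * b3 = 0" using assms(2) unfolding det_2 b b4 by algebra
  have "det (a ** b) = 1" using assms by (simp add: det_mul)
  then have "(a ** b)$1$1 + (a ** b)$2$2 = 1 + 1"
    using assms(5) unfolding det_2 by (simp add: mat2_mat_nth) algebra
  then have eab: "a1 * b1 + a1 * b1 + a2 * b3 + a3 * b2 = 0"
    unfolding mat2_mult_nth a b a4 b4 by algebra
  \<comment> \<open>Proportionality of (a1, a2, a3) and (b1, b2, b3): only the squares of the minors
    lie in the ideal of the three relations. No division by 2 occurs, so characteristic 2 is
    covered.\<close>
  have "(a2 * b3 - a3 * b2) * (a2 * b3 - a3 * b2) = 0"
    using ea eb eab by algebra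
  then have 1: "a2 * b3 = a3 * b2" by simp
  have "(a1 * b2 - a2 * b1) * (a1 * b2 - a2 * b1) = 0"
    using ea eb eab by algebra
  then have 2: "a1 * b2 = a2 * b1" by simp
  have "(a1 * b3 - a3 * b1) * (a1 * b3 - a3 * b1) = 0"
    using ea eb eab by algebra
  then have 3: "a1 * b3 = a3 * b1" by simp
  show ?thesis unfolding mat2_eq_iff mat2_mult_nth a b a4 b4
    using 1 2 3 by (auto simp: algebra_simps)
qed

text \<open>The conjugate of \<open>c\<close> by \<open>h\<close> has the line of
  \<open>h *v u\<close> as its fixed line. Since \<open>c\<close> commutes with it, \<open>c\<close>
  preserves that line, and acts trivially there because its only eigenvalue is 1; but the only line
  that \<open>c\<close> fixes pointwise is that of \<open>u\<close>.\<close>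

lemma commuting_unipotent_conjugate_fixes_line:
  fixes c h :: "'a::field^2^2"
  assumes c: "det c = 1" "det (c - mat 1) = 0" "c \<noteq> mat 1"
    and h: "det h = 1"
    and comm: "c ** (h ** c ** adj2 h) = (h ** c ** adj2 h) ** c"
    and u: "c *v u = u" "u \<noteq> 0"
  shows "par (h *v u) u"
proof -
  define d where "d = h ** c ** adj2 h"
  have dh: "d ** h = h ** c"
    unfolding d_def by (metis h matrix_mul_assoc matrix_mul_rid mult_adj2(2))
  have d1: "d \<noteq> mat 1"
  proof
    assume "d = mat 1"
    then have "h ** c = h" using dh by simp
    then have "adj2 h ** (h ** c) = mat 1" using mult_adj2(2)[OF h] by simp
    then show False using c(3) by (simp add: matrix_mul_assoc mult_adj2(2)[OF h])
  qed
  define w where "w = h *v u"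
  have w0: "w \<noteq> 0" unfolding w_def using mult_vec_nonzero[OF h u(2)] .
  have dw: "d *v w = w"
    unfolding w_def by (simp add: matrix_vector_mul_assoc dh) (simp add: u(1) flip: matrix_vector_mul_assoc)
  have "d *v (c *v w) = c *v w"
    using comm dw unfolding d_def[symmetric] by (metis matrix_vector_mul_assoc)
  with dw d1 have "par w (c *v w)" using fixed_vectors_par by blast
  then obtain m where m: "c *v w = m *s w" using w0 par_imp_multiple by blast
  have tr: "c$1$1 + c$2$2 = 2" using c(1,2) unfolding det_2 by (simp add: mat2_mat_nth) algebra
  \<comment> \<open>The eigenvalue \<open>m\<close> is a root of the characteristic polynomial,
    which is (X - 1)^2.\<close>
  have "(m - 1) * (m - 1) * w$1 = 0" "(m - 1) * (m - 1) * w$2 = 0"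
  proof -
    have e: "c$1$1 * w$1 + c$1$2 * w$2 = m * w$1" "c$2$1 * w$1 + c$2$2 * w$2 = m * w$2"
      using m by (simp_all add: mat2_simps)
    have d: "c$1$1 * c$2$2 - c$1$2 * c$2$1 = 1" using c(1) by (simp add: det_2)
    show "(m - 1) * (m - 1) * w$1 = 0" "(m - 1) * (m - 1) * w$2 = 0" using e d tr by algebra+
  qed
  then have "m = 1" using w0 by (auto simp: vec2_nonzero_iff)
  then have "c *v w = w" using m by simp
  then show ?thesis using fixed_vectors_par[OF c(3)] u(1) unfolding w_def by blast
qed

text \<open>A vector on the third line has two nonzero coordinates in the basis \<open>u\<close>,
  \<open>w\<close>, which equates all three eigenvalues. So a nonscalar matrix has at most two
  eigenlines.\<close>

lemma three_eigenlines_scalar: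
  fixes g :: "'a::field^2^2"
  assumes np: "\<not> par u w" "\<not> par u z" "\<not> par w z"
    and e: "par (g *v u) u" "par (g *v w) w" "par (g *v z) z"
  shows "par (g *v x) x"
proof -
  have nz: "u \<noteq> 0" "w \<noteq> 0" "z \<noteq> 0" using np not_par_nonzero by blast+
  obtain l m n where lmn: "g *v u = l *s u" "g *v w = m *s w" "g *v z = n *s z"
    using e nz by (meson par_imp_multiple par_sym)
  obtain a b where ab: "z = a *s u + b *s w" using vec2_decompose[OF np(1)] .
  have "(a * l) *s u + (b * m) *s w = (n * a) *s u + (n * b) *s w"
    using lmn(3) unfolding ab
    by (simp add: matrix_vector_right_distrib vector_scalar_commute lmn(1,2) vector_smult_assoc
        vector_add_ldistrib)
  from vec2_combination_unique[OF np(1) this] have "a * l = n * a" "b * m = n * b" .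
  moreover have "a \<noteq> 0" using np(3) ab by (auto simp: par_def)
  moreover have "b \<noteq> 0" using np(2) ab by (auto simp: par_def)
  ultimately have "l = n" "m = n" by simp_all
  obtain c d where "x = c *s u + d *s w" using vec2_decompose[OF np(1)] .
  then have "g *v x = n *s x"
    using \<open>l = n\<close> \<open>m = n\<close> by (simp add: matrix_vector_right_distrib vector_scalar_commute lmn
        vector_smult_assoc vector_add_ldistrib mult.commute)
  then show ?thesis by simp
qed

lemma par_eigen_transfer:
  fixes g :: "'a::field^2^2"
  assumes "par u w" "u \<noteq> 0" "par (g *v u) u"
  shows "par (g *v w) w"
proof -
  obtain c where "w = c *s u" using par_imp_multiple[OF assms(1,2)] .
  then show ?thesis using assms(3) by (simp add: par_def vector_scalar_commute)
qed

text \<open>One nonscalar element leaves at most two candidate lines, and one further element for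
  each of them removes it. Three elements suffice, even if the group is not finitely
  generated.\<close>

lemma finite_subset_without_eigenvector:
  fixes G :: "('a::field^2^2) set"
  assumes G: "\<And>u. u \<noteq> 0 \<Longrightarrow> \<exists>g\<in>G. \<not> par (g *v u) u"
  shows "\<exists>S. finite S \<and> S \<subseteq> G \<and> (\<forall>u. u \<noteq> 0 \<longrightarrow> (\<exists>g\<in>S. \<not> par (g *v u) u))"
proof -
  \<comment> \<open>Any nonzero vector would do: an element that moves the line of \<open>e\<close>
    is not scalar.\<close>
  define e :: "'a^2" where "e = vector [1, 0]"
  have "e \<noteq> 0" by (simp add: e_def vec2_nonzero_iff)
  then obtain g0 where g0: "g0 \<in> G" "\<not> par (g0 *v e) e" using G by blast
  obtain f where f: "\<And>u. u \<noteq> 0 \<Longrightarrow> f u \<in> G \<and> \<not> par (f u *v u) u" using G by metis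
  let ?P = "\<lambda>u. u \<noteq> 0 \<and> par (g0 *v u) u"
  show ?thesis
  proof (cases "\<exists>u w. ?P u \<and> ?P w \<and> \<not> par u w")
    case True
    then obtain u w where uw: "?P u" "?P w" "\<not> par u w" by blast
    have "\<exists>g\<in>{g0, f u, f w}. \<not> par (g *v z) z" if z: "z \<noteq> 0" for z
    proof (cases "par (g0 *v z) z")
      case True
      then have "par u z \<or> par w z"
        using three_eigenlines_scalar[OF uw(3), of z g0 e] uw g0(2) by blast
      then show ?thesis using f uw z par_eigen_transfer par_sym by (metis insertCI)
    qed simp
    then show ?thesis using g0 f uw by (intro exI[of _ "{g0, f u, f w}"]) auto
  next
    case False
    show ?thesis
    proof (cases "\<exists>u. ?P u")
      case True
      then obtain u where u: "?P u" by blast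
      have "\<exists>g\<in>{g0, f u}. \<not> par (g *v z) z" if z: "z \<noteq> 0" for z
      proof (cases "par (g0 *v z) z")
        case True
        then have "par u z" using False u z by blast
        then show ?thesis using f u z par_eigen_transfer par_sym by (metis insertCI)
      qed simp
      then show ?thesis using g0 f u by (intro exI[of _ "{g0, f u}"]) auto
    next
      case False
      then show ?thesis using g0 by (intro exI[of _ "{g0}"]) auto
    qed
  qed
qed

section \<open>Discrete groups near the identity\<close>

context nonarch_field
begin

section \<open>The maximum norm of matrices, and powers near the identity\<close>

definition mle :: "real \<Rightarrow> 'k^2^2 \<Rightarrow> bool" where
  "mle r A \<longleftrightarrow> (\<forall>i j. vabs v (A$i$j) \<le> r)"

lemma mle_nth: "mle r A \<Longrightarrow> vabs v (A$i$j) \<le> r"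
  by (simp add: mle_def)

lemma mle_mono: "mle r A \<Longrightarrow> r \<le> s \<Longrightarrow> mle s A"
  unfolding mle_def by (meson order_trans)

lemma mle_nonneg: "mle r A \<Longrightarrow> 0 \<le> r"
  by (meson mle_nth order_trans vabs_nonneg)

lemma mle_add: "mle r A \<Longrightarrow> mle r B \<Longrightarrow> mle r (A + B)"
  by (simp add: mle_def vabs_add_le)

lemma mle_minus: "mle r A \<Longrightarrow> mle r B \<Longrightarrow> mle r (A - B)"
  by (simp add: mle_def vabs_diff_le)

lemma mle_mult: "mle r A \<Longrightarrow> mle s B \<Longrightarrow> mle (r * s) (A ** B)"
  unfolding mle_def mat2_mult_nth
  by (auto intro!: vabs_add_le vabs_mult_le intro: order_trans[OF vabs_nonneg])

lemma mle_adj2: "mle r A \<Longrightarrow> mle r (adj2 A)"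
  by (simp add: mle_def forall_2)

lemma mle_zero_imp: "mle r A \<Longrightarrow> r \<le> 0 \<Longrightarrow> A = 0"
  unfolding mle_def vec_eq_iff by (metis order_trans vabs_eq_0_iff vabs_nonneg order_antisym zero_index)

lemma ex_mle: "\<exists>r\<ge>1. mle r A"
proof -
  let ?r = "Max (insert 1 ((\<lambda>(i, j). vabs v (A$i$j)) ` UNIV))"
  have "vabs v (A$i$j) \<le> ?r" for i j by (rule Max_ge) (auto intro: rev_image_eqI[of "(i, j)"])
  then have "mle ?r A" unfolding mle_def by blast
  moreover have "1 \<le> ?r" by (intro Max_ge) auto
  ultimately show ?thesis by blast
qed

lemma ex_mle_finite:
  assumes "finite S"
  shows "\<exists>r\<ge>1. \<forall>A\<in>S. mle r A"
  using assms
proof induction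
  case empty
  show ?case by (intro exI[of _ 1]) simp
next
  case (insert A S)
  then obtain r where r: "r \<ge> 1" "\<forall>A\<in>S. mle r A" by blast
  obtain s where s: "s \<ge> 1" "mle s A" using ex_mle by blast
  show ?case using r s by (intro exI[of _ "max r s"]) (auto intro: mle_mono)
qed

text \<open>Balls around \<open>1\<close> of radius at most 1 are closed under products, which puts
  \<open>ab\<close> next to \<open>1\<close> together with \<open>a\<close> and
  \<open>b\<close>.\<close>

lemma mle_mult_minus_one:
  assumes "r \<le> 1" "mle r (a - mat 1)" "mle r (b - mat 1)"
  shows "mle r (a ** b - mat 1)"
proof -
  have "a ** b - mat 1 = (a - mat 1) ** (b - mat 1) + ((a - mat 1) + (b - mat 1))"
    by (simp add: mat2_simps algebra_simps)
  moreover have "mle r ((a - mat 1) ** (b - mat 1))"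
    using mle_mult[OF assms(2,3)] assms(1) mle_nonneg[OF assms(2)]
    by (elim mle_mono) (simp add: mult_left_le)
  ultimately show ?thesis using assms by (metis mle_add)
qed

text \<open>The coefficients in the expansion of (1 + X)^n are integers, of absolute value at most
  1, so everything from the quadratic term on is bounded by \<open>r * r\<close>.\<close>

lemma mpow_second_order:
  assumes "mle r X" "r \<le> 1"
  shows "vabs v (mpow (mat 1 + X) n $i$j - mat 1 $i$j - of_nat n * X$i$j) \<le> r * r"
proof (induction n arbitrary: i j)
  case (Suc n)
  have r0: "0 \<le> r" using mle_nonneg assms(1) .
  define E where "E = (\<lambda>i j. mpow (mat 1 + X) n $i$j - mat 1 $i$j - of_nat n * X$i$j)"
  have E: "vabs v (E i j) \<le> r * r" for i j unfolding E_def by (rule Suc)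
  have P: "mpow (mat 1 + X) n $i$j = mat 1 $i$j + of_nat n * X$i$j + E i j" for i j
    by (simp add: E_def)
  have one: "((mat 1 + X) ** A) $i$j = A$i$j + (X$i$1 * A$1$j + X$i$2 * A$2$j)" for A :: "'k^2^2" and i j
    using exhaust_2[of i] unfolding mat2_mult_nth by (auto simp: mat2_mat_nth algebra_simps)
  have X1: "X$i$1 * mat 1 $1$j + X$i$2 * mat 1 $2$j = X$i$j"
    using exhaust_2[of j] by (auto simp: mat2_mat_nth)
  have "mpow (mat 1 + X) (Suc n) $i$j - mat 1 $i$j - of_nat (Suc n) * X$i$j
      = E i j + of_nat n * (X$i$1 * X$1$j + X$i$2 * X$2$j) + (X$i$1 * E 1 j + X$i$2 * E 2 j)
        + (X$i$1 * mat 1 $1$j + X$i$2 * mat 1 $2$j - X$i$j)"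
    unfolding mpow.simps one P by (simp add: algebra_simps)
  also have "\<dots> = E i j + of_nat n * (X$i$1 * X$1$j + X$i$2 * X$2$j) + (X$i$1 * E 1 j + X$i$2 * E 2 j)"
    unfolding X1 by simp
  also have "vabs v \<dots> \<le> r * r"
  proof -
    have "vabs v (X$i$1 * X$1$j + X$i$2 * X$2$j) \<le> r * r"
      using mle_nth[OF mle_mult[OF assms(1,1)], of i j] by (simp add: mat2_mult_nth)
    then have 1: "vabs v (of_nat n * (X$i$1 * X$1$j + X$i$2 * X$2$j)) \<le> r * r"
      using vabs_mult_le[OF vabs_of_nat_le_1] by fastforce
    have "vabs v (X$i$l * E l j) \<le> 1 * (r * r)" for l
      using mle_nth[OF assms(1), of i l] assms(2) E by (intro vabs_mult_le) auto
    then have 2: "vabs v (X$i$1 * E 1 j + X$i$2 * E 2 j) \<le> r * r" by (simp add: vabs_add_le)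
    show ?thesis by (intro vabs_add_le E 1 2)
  qed
  finally show ?case .
qed simp

text \<open>The linear term gains the factor 1/2 from \<open>m\<close>, the quadratic remainder
  gains it from \<open>r\<close>. Hence m-th powers contract a ball around \<open>1\<close> towards
  \<open>1\<close>.\<close>

lemma mpow_shrink:
  assumes m: "vabs v (of_nat m) \<le> 1/2" and "r \<le> 1/2" "mle r (g - mat 1)"
  shows "mle (r * (1/2)) (mpow g m - mat 1)"
proof -
  have r0: "0 \<le> r" using mle_nonneg assms(3) .
  have "vabs v (mpow g m $i$j - mat 1 $i$j) \<le> r * (1/2)" for i j
  proof -
    have "vabs v (mpow g m $i$j - mat 1 $i$j - of_nat m * (g - mat 1)$i$j) \<le> r * r"
      using mpow_second_order[of r "g - mat 1" m i j] assms by simp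
    also have "\<dots> \<le> r * (1/2)" using assms r0 by (intro mult_left_mono) auto
    finally have 1: "vabs v (mpow g m $i$j - mat 1 $i$j - of_nat m * (g - mat 1)$i$j) \<le> r * (1/2)" .
    have "vabs v (of_nat m * (g - mat 1)$i$j) \<le> 1/2 * r"
      using m mle_nth[OF assms(3)] by (intro vabs_mult_le) auto
    then have 2: "vabs v (of_nat m * (g - mat 1)$i$j) \<le> r * (1/2)" by simp
    from vabs_add_le[OF 1 2] show ?thesis by simp
  qed
  then show ?thesis by (simp add: mle_def)
qed

lemma mpow_iter_shrink:
  assumes m: "vabs v (of_nat m) \<le> 1/2" and "r \<le> 1/2" "mle r (g - mat 1)"
  shows "mle (r * (1/2) ^ k) (((\<lambda>h. mpow h m) ^^ k) g - mat 1)"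
proof (induction k)
  case (Suc k)
  have "r * (1/2) ^ k \<le> r * 1"
    using mle_nonneg[OF assms(3)] by (intro mult_left_mono power_le_one) auto
  then have "mle (r * (1/2) ^ k * (1/2)) (mpow (((\<lambda>h. mpow h m) ^^ k) g) m - mat 1)"
    using assms(2) by (intro mpow_shrink[OF m _ Suc]) simp
  then show ?case by (simp add: mult_ac)
qed (use assms in simp)

lemma discrete_near_one:
  assumes "discrete_set v H" "SL2_subgroup H"
  obtains e where "e > 0" "\<And>h. h \<in> H \<Longrightarrow> mle e (h - mat 1) \<Longrightarrow> h = mat 1"
proof -
  obtain e where e: "e > 0" "\<And>h. h \<in> H \<Longrightarrow> (\<forall>i j. vdist v (h$i$j) (mat 1 $i$j) < e) \<Longrightarrow> h = mat 1"
    using assms SL2_subgroup_one unfolding discrete_set_def by metis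
  show ?thesis
  \<comment> \<open>Halved because \<open>mle\<close> is a non-strict bound and
    \<open>discrete_set\<close> uses a strict one.\<close>
  proof (rule that[of "e / 2"])
    fix h assume "h \<in> H" "mle (e / 2) (h - mat 1)"
    moreover have "e / 2 < e" using e(1) by simp
    ultimately show "h = mat 1"
      using e(2)[of h] unfolding mle_def vdist_def vector_minus_component by (meson le_less_trans)
  qed (use e in simp)
qed

text \<open>Iterated m-th powers converge to \<open>1\<close> inside the group, and in a discrete
  group such a sequence reaches \<open>1\<close>.\<close>

lemma torsion_near_one:
  assumes "discrete_set v H" "SL2_subgroup H" "g \<in> H" "mle (1/2) (g - mat 1)"
    and m: "vabs v (of_nat m) \<le> 1/2"
  shows "\<exists>k. ((\<lambda>h. mpow h m) ^^ k) g = mat 1"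
proof -
  obtain e where e: "e > 0" "\<And>h. h \<in> H \<Longrightarrow> mle e (h - mat 1) \<Longrightarrow> h = mat 1"
    using discrete_near_one[OF assms(1,2)] by blast
  obtain k where "(1/2::real) ^ k < e" using real_arch_pow_inv[OF e(1), of "1/2"] by auto
  then have "1/2 * (1/2) ^ k \<le> e" using zero_less_power[of "1/2::real" k] by linarith
  then have "mle e (((\<lambda>h. mpow h m) ^^ k) g - mat 1)"
    using mpow_iter_shrink[OF m order_refl assms(4)] mle_mono by blast
  then show ?thesis using e(2) mpow_closed_iter[OF assms(2,3)] by blast
qed

text \<open>The linear term of g^m - 1 dominates the quadratic remainder as long as g - 1 is smaller
  than \<open>m\<close>.\<close>

lemma mpow_near_one_nontrivial:
  assumes "r < vabs v (of_nat m)" "mle r (g - mat 1)" "g \<noteq> mat 1"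
  shows "mpow g m \<noteq> mat 1"
proof
  assume one: "mpow g m = mat 1"
  \<comment> \<open>The exact norm of g - 1 is needed, not the bound \<open>r\<close>: the linear
    term has size |m| s, to be compared with s^2.\<close>
  define s where "s = Max ((\<lambda>(i, j). vabs v ((g - mat 1)$i$j)) ` UNIV)"
  have "mle s (g - mat 1)" unfolding mle_def s_def by (auto intro!: Max_ge)
  have "s \<in> (\<lambda>(i, j). vabs v ((g - mat 1)$i$j)) ` UNIV" unfolding s_def by (intro Max_in) auto
  then obtain i j where ij: "s = vabs v ((g - mat 1)$i$j)" by auto
  have "s \<noteq> 0" using mle_zero_imp[OF \<open>mle s (g - mat 1)\<close>] assms(3) by force
  then have s0: "s > 0" using ij by (simp add: less_le)
  have "s < vabs v (of_nat m)" using ij mle_nth[OF assms(2), of i j] assms(1) by simp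
  moreover from this have "s \<le> 1" using vabs_of_nat_le_1[of m] by simp
  then have "vabs v (mpow g m $i$j - mat 1 $i$j - of_nat m * (g - mat 1)$i$j) \<le> s * s"
    using mpow_second_order[of s "g - mat 1" m i j] \<open>mle s (g - mat 1)\<close> by simp
  then have "vabs v (of_nat m) * s \<le> s * s" by (simp add: one vabs_mult ij)
  ultimately show False using s0 by simp
qed

text \<open>Iterated m-th powers of \<open>g\<close> must reach \<open>1\<close> by discreteness,
  yet none of them does if \<open>g\<close> is nontrivial. The radius depends on the field alone, so
  it serves the images of \<Gamma> under all \<open>\<phi> n\<close> at once.\<close>

lemma char_zero_near_one:
  assumes "CHAR('k) = 0"
  obtains d where "d > 0"
    "\<And>H g. discrete_set v H \<Longrightarrow> SL2_subgroup H \<Longrightarrow> g \<in> H \<Longrightarrow> mle d (g - mat 1) \<Longrightarrow> g = mat 1"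
proof -
  obtain m where m: "m > 0" "vabs v (of_nat m) < 1" using ex_nat_vabs_less_1 by blast
  then have m2: "vabs v (of_nat m) \<le> 1/2" by (intro vabs_less_1_imp_le_half)
  define c where "c = vabs v (of_nat m)"
  have "of_nat m \<noteq> (0::'k)" using m assms by (simp add: of_nat_eq_0_iff_char_dvd)
  then have c0: "c > 0" by (simp add: c_def)
  show ?thesis
  \<comment> \<open>The radius has to be strictly smaller than \<open>c\<close> for
    \<open>mpow_near_one_nontrivial\<close>.\<close>
  proof (rule that[of "c / 2"])
    fix H g assume H: "discrete_set v H" "SL2_subgroup H" "g \<in> H" and g: "mle (c / 2) (g - mat 1)"
    have "c / 2 \<le> 1/2" using m2 c_def by simp
    then obtain k where k: "((\<lambda>h. mpow h m) ^^ k) g = mat 1"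
      using torsion_near_one[OF H mle_mono[OF g] m2] by blast
    show "g = mat 1"
    proof (rule ccontr)
      assume ne: "g \<noteq> mat 1"
      have "((\<lambda>h. mpow h m) ^^ k) g \<noteq> mat 1" for k
      proof (induction k)
        case (Suc k)
        have "c / 2 * (1/2) ^ k \<le> c / 2 * 1" using c0 by (intro mult_left_mono power_le_one) auto
        then have "mle (c / 2) (((\<lambda>h. mpow h m) ^^ k) g - mat 1)"
          using mle_mono[OF mpow_iter_shrink[OF m2 \<open>c / 2 \<le> 1/2\<close> g, of k]] by simp
        moreover have "c / 2 < vabs v (of_nat m)" using c0 by (simp add: c_def)
        ultimately show ?case using mpow_near_one_nontrivial[OF _ _ Suc] by fastforce
      qed (use ne in simp)
      with k show False by blast
    qed
  qed (use c0 in simp)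
qed

section \<open>Convergence of matrices\<close>

lemma mconv_eventually:
  assumes "mconv v s L" "e > 0"
  shows "\<forall>\<^sub>F n in sequentially. mle e (s n - L)"
proof -
  have "\<forall>\<^sub>F n in sequentially. vabs v ((s n - L)$i$j) \<le> e" for i j
    using assms unfolding mconv_def vdist_def eventually_sequentially vector_minus_component
    by (meson less_imp_le)
  then show ?thesis unfolding mle_def by (intro eventually_all_finite)
qed

lemma mconv_if_eventually:
  assumes "\<And>e. e > 0 \<Longrightarrow> \<forall>\<^sub>F n in sequentially. mle e (s n - L)"
  shows "mconv v s L"
  unfolding mconv_def
proof (intro allI impI)
  fix i j and e :: real assume "e > 0"
  then have "\<forall>\<^sub>F n in sequentially. mle (e / 2) (s n - L)" using assms by simp
  then obtain N where "\<And>n. n \<ge> N \<Longrightarrow> vabs v ((s n - L)$i$j) \<le> e / 2"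
    unfolding eventually_sequentially mle_def by blast
  then show "\<exists>N. \<forall>n\<ge>N. vdist v (s n $i$j) (L$i$j) < e"
    using \<open>e > 0\<close> unfolding vdist_def by (intro exI[of _ N]) (force simp: field_simps intro: le_less_trans)
qed

lemma mconv_unique:
  assumes "mconv v s L" "mconv v s M"
  shows "L = M"
proof -
  have "mle e (L - M)" if "e > 0" for e
  proof -
    have "\<forall>\<^sub>F n in sequentially. mle e (s n - L) \<and> mle e (s n - M)"
      using assms that by (intro eventually_conj mconv_eventually)
    then obtain n where "mle e (s n - M)" "mle e (s n - L)"
      using eventually_happens trivial_limit_sequentially by blast
    from mle_minus[OF this] show ?thesis by simp
  qed
  then have "vabs v ((L - M)$i$j) \<le> 0" for i j
    unfolding mle_def by (meson dense_ge)
  then have "mle 0 (L - M)" by (simp add: mle_def)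
  from mle_zero_imp[OF this] show ?thesis by simp
qed

lemma mconv_mult:
  assumes s: "mconv v s L" and t: "mconv v t M"
  shows "mconv v (\<lambda>n. s n ** t n) (L ** M)"
proof (rule mconv_if_eventually)
  fix e :: real assume "e > 0"
  obtain C where C: "C \<ge> 1" "\<forall>A\<in>{L, M}. mle C A" using ex_mle_finite[of "{L, M}"] by auto
  define d where "d = min 1 (e / C)"
  have d: "d > 0" "d \<le> 1" "C * d \<le> e" using \<open>e > 0\<close> C(1) by (auto simp: d_def min_def field_simps)
  have "\<forall>\<^sub>F n in sequentially. mle d (s n - L) \<and> mle d (t n - M)"
    using d by (intro eventually_conj mconv_eventually s t)
  then show "\<forall>\<^sub>F n in sequentially. mle e (s n ** t n - L ** M)"
  proof (rule eventually_mono)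
    fix n assume n: "mle d (s n - L) \<and> mle d (t n - M)"
    have "mle C (t n - M)" using n d C(1) by (meson mle_mono order_trans)
    then have "mle C (t n)" using C(2) mle_add[of C "t n - M" M] by simp
    then have "mle (d * C) ((s n - L) ** t n)" "mle (C * d) (L ** (t n - M))"
      using n C(2) by (auto intro: mle_mult)
    then have "mle (C * d) ((s n - L) ** t n + L ** (t n - M))" by (simp add: mle_add mult.commute)
    moreover have "s n ** t n - L ** M = (s n - L) ** t n + L ** (t n - M)"
      by (simp add: mat2_simps algebra_simps)
    ultimately show "mle e (s n ** t n - L ** M)" using d(3) mle_mono by simp
  qed
qed

end

section \<open>The limit homomorphism and its small values\<close>

locale algebraic_limit = nonarch_field v for v :: "'k::field \<Rightarrow> int" +
  fixes \<Gamma> :: "('k^2^2) set" and \<phi> :: "nat \<Rightarrow> 'k^2^2 \<Rightarrow> 'k^2^2" and \<phi>lim :: "'k^2^2 \<Rightarrow> 'k^2^2"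
  assumes \<Gamma>_sub: "SL2_subgroup \<Gamma>"
    and Gn_sub: "\<forall>n\<ge>1. SL2_subgroup (\<phi> n ` \<Gamma>)"
    and \<phi>n_iso: "\<forall>n\<ge>1. group_iso (\<phi> n) \<Gamma> (\<phi> n ` \<Gamma>)"
    and Gn_disc: "\<exists>N. \<forall>n\<ge>N. discrete_set v (\<phi> n ` \<Gamma>)"
    and conv: "\<forall>\<gamma>\<in>\<Gamma>. \<phi>lim \<gamma> \<in> SL2 \<and> mconv v (\<lambda>n. \<phi> n \<gamma>) (\<phi>lim \<gamma>)"
begin

lemma \<phi>_mult: "n \<ge> 1 \<Longrightarrow> a \<in> \<Gamma> \<Longrightarrow> b \<in> \<Gamma> \<Longrightarrow> \<phi> n (a ** b) = \<phi> n a ** \<phi> n b"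
  using \<phi>n_iso unfolding group_iso_def by blast

lemma \<phi>_inj: "n \<ge> 1 \<Longrightarrow> a \<in> \<Gamma> \<Longrightarrow> b \<in> \<Gamma> \<Longrightarrow> \<phi> n a = \<phi> n b \<Longrightarrow> a = b"
  using \<phi>n_iso unfolding group_iso_def bij_betw_def inj_on_def by blast

lemma \<phi>_one: "n \<ge> 1 \<Longrightarrow> \<phi> n (mat 1) = mat 1"
proof -
  assume n: "n \<ge> 1"
  have 1: "mat 1 \<in> \<Gamma>" using \<Gamma>_sub SL2_subgroup_one by blast
  then have "\<phi> n (mat 1) ** \<phi> n (mat 1) = \<phi> n (mat 1)" using \<phi>_mult[OF n 1 1] by simp
  moreover have "det (\<phi> n (mat 1)) = 1" using 1 n Gn_sub SL2_subgroup_det by blast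
  ultimately show ?thesis by (metis matrix_mul_assoc matrix_mul_rid mult_adj2(1))
qed

lemma \<phi>_mpow: "n \<ge> 1 \<Longrightarrow> a \<in> \<Gamma> \<Longrightarrow> \<phi> n (mpow a k) = mpow (\<phi> n a) k"
  by (induction k) (simp_all add: \<phi>_one \<phi>_mult mpow_closed[OF \<Gamma>_sub])

lemma \<phi>_mpow_iter:
  "n \<ge> 1 \<Longrightarrow> a \<in> \<Gamma> \<Longrightarrow> \<phi> n (((\<lambda>h. mpow h m) ^^ k) a) = ((\<lambda>h. mpow h m) ^^ k) (\<phi> n a)"
  by (induction k) (simp_all add: \<phi>_mpow mpow_closed_iter[OF \<Gamma>_sub])

lemma det_\<phi>lim: "a \<in> \<Gamma> \<Longrightarrow> det (\<phi>lim a) = 1"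
  using conv by (simp add: SL2_def)

text \<open>The index 0 is exempt because \<open>\<phi> 0\<close> need not be a
  homomorphism.\<close>

lemma mconv_cong_eventually:
  assumes "\<And>n. n \<ge> 1 \<Longrightarrow> s n = t n" "mconv v s L"
  shows "mconv v t L"
proof (rule mconv_if_eventually)
  fix e :: real assume "e > 0"
  have "\<forall>\<^sub>F n in sequentially. n \<ge> (1::nat)" by (rule eventually_ge_at_top)
  with mconv_eventually[OF assms(2) \<open>e > 0\<close>] show "\<forall>\<^sub>F n in sequentially. mle e (t n - L)"
    by eventually_elim (simp add: assms(1))
qed

lemma \<phi>lim_mult:
  assumes "a \<in> \<Gamma>" "b \<in> \<Gamma>"
  shows "\<phi>lim (a ** b) = \<phi>lim a ** \<phi>lim b"
proof (rule mconv_unique)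
  show "mconv v (\<lambda>n. \<phi> n (a ** b)) (\<phi>lim (a ** b))"
    using conv assms SL2_subgroup_mult[OF \<Gamma>_sub] by blast
  have "mconv v (\<lambda>n. \<phi> n a ** \<phi> n b) (\<phi>lim a ** \<phi>lim b)"
    using conv assms by (intro mconv_mult) auto
  then show "mconv v (\<lambda>n. \<phi> n (a ** b)) (\<phi>lim a ** \<phi>lim b)"
    by (rule mconv_cong_eventually[rotated]) (simp add: \<phi>_mult assms)
qed

lemma \<phi>lim_one: "\<phi>lim (mat 1) = mat 1"
proof -
  have 1: "mat 1 \<in> \<Gamma>" using \<Gamma>_sub SL2_subgroup_one by blast
  then have "\<phi>lim (mat 1) ** \<phi>lim (mat 1) = \<phi>lim (mat 1)" using \<phi>lim_mult[OF 1 1] by simp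
  then show ?thesis using det_\<phi>lim[OF 1] by (metis matrix_mul_assoc matrix_mul_rid mult_adj2(1))
qed

lemma \<phi>lim_adj2: "a \<in> \<Gamma> \<Longrightarrow> \<phi>lim (adj2 a) = adj2 (\<phi>lim a)"
  by (metis SL2_subgroup_adj2 SL2_subgroup_det \<Gamma>_sub \<phi>lim_mult \<phi>lim_one adj2_unique det_\<phi>lim
      mult_adj2(1))

text \<open>A closed ultrametric ball is also open, so the approximants enter it with the same
  radius \<open>e\<close>.\<close>

lemma eventually_close:
  assumes "a \<in> \<Gamma>" "e > 0" "mle e (\<phi>lim a - mat 1)"
  shows "\<forall>\<^sub>F n in sequentially. mle e (\<phi> n a - mat 1)"
proof -
  have "\<forall>\<^sub>F n in sequentially. mle e (\<phi> n a - \<phi>lim a)" using conv assms by (intro mconv_eventually) auto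
  then show ?thesis by eventually_elim (use mle_add[OF _ assms(3)] in fastforce)
qed

lemma eventually_discrete: "\<forall>\<^sub>F n in sequentially. n \<ge> 1 \<and> discrete_set v (\<phi> n ` \<Gamma>)"
proof -
  obtain N where "\<forall>n\<ge>N. discrete_set v (\<phi> n ` \<Gamma>)" using Gn_disc by blast
  then show ?thesis unfolding eventually_sequentially by (intro exI[of _ "max 1 N"]) simp
qed

text \<open>For one large \<open>n\<close> the images of \<open>a\<close>, \<open>b\<close> and
  \<open>ab\<close> lie close to \<open>1\<close> in a discrete group, hence are unipotent, and the
  images of \<open>a\<close> and \<open>b\<close> commute. Injectivity of \<open>\<phi> n\<close>
  brings the commutation back.\<close>

lemma char_p_near_one:
  assumes "CHAR('k) > 0" "a \<in> \<Gamma>" "b \<in> \<Gamma>"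
    "mle (1/2) (\<phi>lim a - mat 1)" "mle (1/2) (\<phi>lim b - mat 1)"
  shows "a ** b = b ** a" "det (a - mat 1) = 0"
proof -
  define p where "p = CHAR('k)"
  have p: "prime p" "of_nat p = (0::'k)"
    unfolding p_def using assms(1) prime_CHAR_semidom by auto
  have "vabs v (of_nat p) \<le> 1/2" using p by simp
  note tors = torsion_near_one[OF _ _ _ _ this]
  have "\<forall>\<^sub>F n in sequentially. (n \<ge> 1 \<and> discrete_set v (\<phi> n ` \<Gamma>))
      \<and> mle (1/2) (\<phi> n a - mat 1) \<and> mle (1/2) (\<phi> n b - mat 1)"
    using assms by (intro eventually_conj eventually_discrete eventually_close) auto
  then obtain n where n: "n \<ge> 1" "discrete_set v (\<phi> n ` \<Gamma>)"
      "mle (1/2) (\<phi> n a - mat 1)" "mle (1/2) (\<phi> n b - mat 1)"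
    using eventually_happens trivial_limit_sequentially by blast
  have sub: "SL2_subgroup (\<phi> n ` \<Gamma>)" using Gn_sub n by blast
  have ab: "a ** b \<in> \<Gamma>" using assms SL2_subgroup_mult[OF \<Gamma>_sub] by blast
  have mab: "mle (1/2) (\<phi> n (a ** b) - mat 1)"
    using mle_mult_minus_one[OF _ n(3,4)] assms n by (simp add: \<phi>_mult)
  have unip: "\<exists>k. ((\<lambda>h. mpow h p) ^^ k) (\<phi> n c) = mat 1" "det (\<phi> n c - mat 1) = 0"
    if "c \<in> \<Gamma>" "mle (1/2) (\<phi> n c - mat 1)" for c
  proof -
    show "\<exists>k. ((\<lambda>h. mpow h p) ^^ k) (\<phi> n c) = mat 1" using tors[OF n(2) sub _ that(2)] that by blast
    then show "det (\<phi> n c - mat 1) = 0" using det_minus_one_of_torsion[OF p] by blast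
  qed
  have "\<phi> n a ** \<phi> n b = \<phi> n b ** \<phi> n a"
  proof (rule unipotents_commute)
    show "det (\<phi> n a ** \<phi> n b - mat 1) = 0" using unip(2)[OF ab mab] assms n by (simp add: \<phi>_mult)
  qed (use unip assms n sub SL2_subgroup_det in blast)+
  then have "\<phi> n (a ** b) = \<phi> n (b ** a)" using assms n by (simp add: \<phi>_mult)
  then show "a ** b = b ** a" using \<phi>_inj n assms SL2_subgroup_mult[OF \<Gamma>_sub] by blast
  \<comment> \<open>Unipotence is not preserved by an abstract isomorphism, but p-power torsion is,
    and over K it implies unipotence again.\<close>
  obtain k where "((\<lambda>h. mpow h p) ^^ k) (\<phi> n a) = mat 1" using unip(1) assms n by blast
  then have "\<phi> n (((\<lambda>h. mpow h p) ^^ k) a) = \<phi> n (mat 1)" using assms n by (simp add: \<phi>_mpow_iter \<phi>_one)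
  then have "((\<lambda>h. mpow h p) ^^ k) a = mat 1"
    using \<phi>_inj n assms mpow_closed_iter[OF \<Gamma>_sub] SL2_subgroup_one[OF \<Gamma>_sub] by blast
  then show "det (a - mat 1) = 0" using det_minus_one_of_torsion[OF p] by blast
qed

lemma \<phi>lim_near_one_trivial:
  assumes noeig: "\<And>u. u \<noteq> 0 \<Longrightarrow> \<exists>g\<in>\<Gamma>. \<not> par (g *v u) u"
  obtains d where "d > 0" "\<And>c. c \<in> \<Gamma> \<Longrightarrow> mle d (\<phi>lim c - mat 1) \<Longrightarrow> c = mat 1"
proof (cases "CHAR('k) = 0")
  case True
  then obtain d where d: "d > 0"
    "\<And>H g. discrete_set v H \<Longrightarrow> SL2_subgroup H \<Longrightarrow> g \<in> H \<Longrightarrow> mle d (g - mat 1) \<Longrightarrow> g = mat 1"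
    using char_zero_near_one by metis
  show ?thesis
  proof (rule that[OF d(1)])
    fix c assume c: "c \<in> \<Gamma>" "mle d (\<phi>lim c - mat 1)"
    have "\<forall>\<^sub>F n in sequentially. (n \<ge> 1 \<and> discrete_set v (\<phi> n ` \<Gamma>)) \<and> mle d (\<phi> n c - mat 1)"
      using c d by (intro eventually_conj eventually_discrete eventually_close) auto
    then obtain n where n: "n \<ge> 1" "discrete_set v (\<phi> n ` \<Gamma>)" "mle d (\<phi> n c - mat 1)"
      using eventually_happens trivial_limit_sequentially by blast
    have "\<phi> n c = mat 1" by (rule d(2)[OF n(2) _ _ n(3)]) (use Gn_sub n c in auto)
    then have "\<phi> n c = \<phi> n (mat 1)" using n by (simp add: \<phi>_one)
    then show "c = mat 1" using \<phi>_inj n c SL2_subgroup_one[OF \<Gamma>_sub] by blast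
  qed
next
  case False
  then have char: "CHAR('k) > 0" by simp
  \<comment> \<open>\<open>S\<close>, hence the bound \<open>C\<close>, is fixed before
    \<open>c\<close>, so that the radius \<open>d\<close> does not depend on
    \<open>c\<close>.\<close>
  obtain S where S: "finite S" "S \<subseteq> \<Gamma>" "\<forall>u. u \<noteq> 0 \<longrightarrow> (\<exists>g\<in>S. \<not> par (g *v u) u)"
    using finite_subset_without_eigenvector[of \<Gamma>, OF noeig] by metis
  obtain C where C: "C \<ge> 1" "\<forall>A\<in>\<phi>lim ` S. mle C A" using ex_mle_finite[of "\<phi>lim ` S"] S(1) by blast
  \<comment> \<open>Conjugation by an element of norm at most \<open>C\<close> enlarges the distance
    to \<open>1\<close> by at most C^2; the result must stay within 1/2, as
    \<open>char_p_near_one\<close> requires.\<close>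
  define d where "d = 1 / (2 * C * C)"
  have d: "d > 0" "C * d * C = 1/2" using C(1) by (auto simp: d_def field_simps)
  have "2 * C * C \<ge> 2 * 1 * 1" using C(1) by (intro mult_mono) auto
  then have d2: "d \<le> 1/2" using C(1) by (simp add: d_def field_simps)
  show ?thesis
  proof (rule that[OF d(1)])
    fix c assume c: "c \<in> \<Gamma>" "mle d (\<phi>lim c - mat 1)"
    have c2: "mle (1/2) (\<phi>lim c - mat 1)" using mle_mono[OF c(2) d2] .
    show "c = mat 1"
    proof (rule ccontr)
      assume ne: "c \<noteq> mat 1"
      have dc: "det (c - mat 1) = 0" using char_p_near_one(2)[OF char c(1) c(1) c2 c2] .
      have detc: "det c = 1" using SL2_subgroup_det[OF \<Gamma>_sub c(1)] .
      obtain u where "u \<noteq> 0" "(c - mat 1) *v u = 0" using det_zero_kernel[OF dc] .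
      then have u: "u \<noteq> 0" "c *v u = u" by (simp_all add: matrix_vector_mult_diff_rdistrib)
      have "par (h *v u) u" if h: "h \<in> S" for h
      proof -
        have hG: "h \<in> \<Gamma>" using S h by blast
        have deth: "det h = 1" using SL2_subgroup_det[OF \<Gamma>_sub hG] .
        define b where "b = h ** c ** adj2 h"
        have bG: "b \<in> \<Gamma>"
          unfolding b_def by (intro SL2_subgroup_mult[OF \<Gamma>_sub] SL2_subgroup_adj2[OF \<Gamma>_sub] hG c(1))
        have "\<phi>lim b = \<phi>lim h ** \<phi>lim c ** adj2 (\<phi>lim h)"
          unfolding b_def using hG c(1)
          by (simp add: \<phi>lim_mult \<phi>lim_adj2 SL2_subgroup_mult[OF \<Gamma>_sub] SL2_subgroup_adj2[OF \<Gamma>_sub])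
        then have "\<phi>lim b - mat 1 = \<phi>lim h ** (\<phi>lim c - mat 1) ** adj2 (\<phi>lim h)"
          using mult_adj2(1)[OF det_\<phi>lim[OF hG]]
          by (simp add: conj_minus_one)
        moreover have "mle (C * d * C) (\<phi>lim h ** (\<phi>lim c - mat 1) ** adj2 (\<phi>lim h))"
          using C(2) h c(2) by (intro mle_mult mle_adj2) auto
        ultimately have "mle (1/2) (\<phi>lim b - mat 1)" using d(2) by simp
        then have "c ** b = b ** c" using char_p_near_one(1)[OF char c(1) bG c2] by blast
        then show ?thesis
          using commuting_unipotent_conjugate_fixes_line[OF detc dc ne deth _ u(2,1)] unfolding b_def by blast
      qed
      then show False using S(3) u(1) by blast
    qed
  qed
qed

end

section \<open>Rays in the tree and lines\<close>

context nonarch_field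
begin

text \<open>The value group consists of the powers of 2, so no value lies strictly between two
  consecutive ones.\<close>

lemma vabs_less_half_power:
  assumes "vabs v x < (1/2) ^ n"
  shows "vabs v x \<le> (1/2) ^ Suc n"
proof -
  obtain p where p: "p \<noteq> 0" "vabs v p = 1/2" using ex_vabs_half by blast
  have "vabs v (x / p ^ n) < 1"
    using assms by (simp add: vabs_divide vabs_power p(2) power_divide field_simps)
  then have "vabs v (x / p ^ n) \<le> 1/2" by (rule vabs_less_1_imp_le_half)
  then show ?thesis by (simp add: vabs_divide vabs_power p(2) power_divide field_simps)
qed

text \<open>The radii \<open>a\<close> and \<open>b\<close> record a rescaling of the basis vectors.\<close>

definition boxlat :: "'k^2 \<Rightarrow> 'k^2 \<Rightarrow> real \<Rightarrow> real \<Rightarrow> ('k^2) set" where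
  "boxlat u w a b = {x *s u + y *s w | x y. vabs v x \<le> a \<and> vabs v y \<le> b}"

text \<open>The boxes shrink in the direction of \<open>w\<close> only, so the ray runs to the end
  given by the line of \<open>u\<close>; the choice of \<open>w\<close> does not affect that
  end.\<close>

definition stdray :: "'k^2 \<Rightarrow> 'k^2 \<Rightarrow> nat \<Rightarrow> ('k^2) set set" where
  "stdray u w i = lattice_class (boxlat u w 1 ((1/2) ^ i))"

lemma boxlatI: "vabs v x \<le> a \<Longrightarrow> vabs v y \<le> b \<Longrightarrow> x *s u + y *s w \<in> boxlat u w a b"
  unfolding boxlat_def by blast

lemma boxlatI':
  "z = x *s u + y *s w \<Longrightarrow> vabs v x \<le> a \<Longrightarrow> vabs v y \<le> b \<Longrightarrow> z \<in> boxlat u w a b"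
  unfolding boxlat_def by blast

lemma boxlat_image:
  assumes "\<And>x y. f (x *s u + y *s w) = x *s u' + y *s w'"
  shows "f ` boxlat u w a b = boxlat u' w' a b"
proof (intro equalityI subsetI)
  fix z assume "z \<in> f ` boxlat u w a b"
  then obtain x y where "z = f (x *s u + y *s w)" "vabs v x \<le> a" "vabs v y \<le> b"
    unfolding boxlat_def by blast
  then show "z \<in> boxlat u' w' a b" using assms by (intro boxlatI'[of z x _ y]) auto
next
  fix z assume "z \<in> boxlat u' w' a b"
  then obtain x y where "z = x *s u' + y *s w'" "vabs v x \<le> a" "vabs v y \<le> b"
    unfolding boxlat_def by blast
  then show "z \<in> f ` boxlat u w a b"
    using assms[of x y] by (intro image_eqI[of _ _ "x *s u + y *s w"] boxlatI) auto
qed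

lemma boxlat_iff:
  assumes "\<not> par u w"
  shows "x *s u + y *s w \<in> boxlat u w a b \<longleftrightarrow> vabs v x \<le> a \<and> vabs v y \<le> b"
  unfolding boxlat_def using vec2_combination_unique[OF assms] by blast

lemma boxlat_left_iff:
  "\<not> par u w \<Longrightarrow> 0 \<le> b \<Longrightarrow> x *s u \<in> boxlat u w a b \<longleftrightarrow> vabs v x \<le> a"
  using boxlat_iff[of u w x 0 a b] by simp

lemma boxlat_right_iff:
  "\<not> par u w \<Longrightarrow> 0 \<le> a \<Longrightarrow> y *s w \<in> boxlat u w a b \<longleftrightarrow> vabs v y \<le> b"
  using boxlat_iff[of u w 0 y a b] by simp

lemma boxlat_commute: "boxlat u w a b = boxlat w u b a"
  unfolding boxlat_def by (auto; metis add.commute)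

lemma boxlat_mono: "a \<le> a' \<Longrightarrow> b \<le> b' \<Longrightarrow> boxlat u w a b \<subseteq> boxlat u w a' b'"
  unfolding boxlat_def by force

lemma boxlat_scale:
  assumes "c \<noteq> 0"
  shows "(\<lambda>z. c *s z) ` boxlat u w a b = boxlat u w (vabs v c * a) (vabs v c * b)"
proof (intro equalityI subsetI)
  fix z assume "z \<in> (\<lambda>z. c *s z) ` boxlat u w a b"
  then obtain x y where "z = c *s (x *s u + y *s w)" "vabs v x \<le> a" "vabs v y \<le> b"
    unfolding boxlat_def by blast
  moreover from this have "z = (c * x) *s u + (c * y) *s w"
    by (simp add: vector_add_ldistrib vector_smult_assoc)
  ultimately show "z \<in> boxlat u w (vabs v c * a) (vabs v c * b)"
    by (simp add: boxlatI vabs_mult mult_left_mono)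
next
  fix z assume "z \<in> boxlat u w (vabs v c * a) (vabs v c * b)"
  then obtain x y where z: "z = x *s u + y *s w" "vabs v x \<le> vabs v c * a" "vabs v y \<le> vabs v c * b"
    unfolding boxlat_def by blast
  then have "z = c *s ((x / c) *s u + (y / c) *s w)"
    using assms by (simp add: vector_add_ldistrib vector_smult_assoc)
  moreover have "(x / c) *s u + (y / c) *s w \<in> boxlat u w a b"
    using z assms by (intro boxlatI) (simp_all add: vabs_divide divide_le_eq mult.commute)
  ultimately show "z \<in> (\<lambda>z. c *s z) ` boxlat u w a b" by blast
qed

lemma boxlat_scale_vec: "(\<lambda>z. c *s z) ` boxlat u w a b = boxlat (c *s u) (c *s w) a b"
  by (rule boxlat_image) (simp add: vec2_eq_iff algebra_simps)

lemma boxlat_mult: "(\<lambda>z. g *v z) ` boxlat u w a b = boxlat (g *v u) (g *v w) a b"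
  for g :: "'k^2^2"
  by (rule boxlat_image) (simp add: vec2_eq_iff mat2_vec_nth algebra_simps)

lemma boxlat_scale_right:
  assumes "c \<noteq> 0"
  shows "boxlat u (c *s w) a b = boxlat u w a (vabs v c * b)"
proof (intro equalityI subsetI)
  fix z assume "z \<in> boxlat u (c *s w) a b"
  then obtain x y where "z = x *s u + (y * c) *s w" "vabs v x \<le> a" "vabs v y \<le> b"
    unfolding boxlat_def by (auto simp: vector_smult_assoc)
  then show "z \<in> boxlat u w a (vabs v c * b)"
    by (intro boxlatI'[of z x _ "y * c"]) (simp_all add: vabs_mult mult_right_mono mult.commute[of "vabs v c"])
next
  fix z assume "z \<in> boxlat u w a (vabs v c * b)"
  then obtain x y where z: "z = x *s u + y *s w" "vabs v x \<le> a" "vabs v y \<le> vabs v c * b"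
    unfolding boxlat_def by blast
  then have "z = x *s u + (y / c) *s (c *s w)" using assms by (simp add: vector_smult_assoc)
  then show "z \<in> boxlat u (c *s w) a b"
    using z assms by (intro boxlatI'[of z x u "y / c"]) (simp_all add: vabs_divide divide_le_eq mult.commute)
qed

lemma boxlat_shear_subset:
  assumes "vabs v c * b \<le> a"
  shows "boxlat u (c *s u + w) a b \<subseteq> boxlat u w a b"
proof
  fix z assume "z \<in> boxlat u (c *s u + w) a b"
  then obtain x y where z: "z = x *s u + y *s (c *s u + w)" "vabs v x \<le> a" "vabs v y \<le> b"
    unfolding boxlat_def by blast
  then have "z = (x + c * y) *s u + y *s w"
    by (simp add: vec2_eq_iff algebra_simps)
  moreover have "vabs v (c * y) \<le> a"
    using mult_left_mono[OF z(3), of "vabs v c"] assms by (simp add: vabs_mult)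
  ultimately show "z \<in> boxlat u w a b" using z(2,3) by (intro boxlatI'[of z "x + c * y" u y w]) (auto intro: vabs_add_le)
qed

text \<open>Within the stated bound, adding a multiple of \<open>u\<close> to \<open>w\<close>
  changes the basis but not the lattice; the inverse shear by \<open>- c\<close> gives the other
  inclusion.\<close>

lemma boxlat_shear:
  assumes "vabs v c * b \<le> a"
  shows "boxlat u (c *s u + w) a b = boxlat u w a b"
proof
  show "boxlat u (c *s u + w) a b \<subseteq> boxlat u w a b" using boxlat_shear_subset[OF assms] .
  have "boxlat u ((- c) *s u + (c *s u + w)) a b \<subseteq> boxlat u (c *s u + w) a b"
    using boxlat_shear_subset[of "- c" b a u "c *s u + w"] assms by simp
  moreover have "(- c) *s u + (c *s u + w) = w" by (simp add: vec2_eq_iff)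
  ultimately show "boxlat u w a b \<subseteq> boxlat u (c *s u + w) a b" by simp
qed

lemma boxlat_shear_left:
  assumes "vabs v c * a \<le> b"
  shows "boxlat (u + c *s w) w a b = boxlat u w a b"
  using boxlat_shear[OF assms, of w u] by (simp add: boxlat_commute add.commute)

section \<open>Lattices and their homothety classes\<close>

lemma lattice_class_self: "L \<in> lattice_class L"
  unfolding lattice_class_def by (auto intro!: exI[of _ 1])

lemma lattice_class_scale:
  assumes "c \<noteq> 0"
  shows "lattice_class ((\<lambda>z. c *s z) ` L) = lattice_class L"
proof -
  have 1: "(\<lambda>z. d *s z) ` (\<lambda>z. c *s z) ` L = (\<lambda>z. (d * c) *s z) ` L" for d
    by (simp add: image_image vector_smult_assoc)
  show ?thesis
  proof (intro equalityI subsetI)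
    fix M assume "M \<in> lattice_class ((\<lambda>z. c *s z) ` L)"
    then show "M \<in> lattice_class L"
      unfolding lattice_class_def 1 using assms by (auto intro: exI[of _ "_ * c"])
  next
    fix M assume "M \<in> lattice_class L"
    then obtain d where "d \<noteq> 0" "M = (\<lambda>z. d *s z) ` L" unfolding lattice_class_def by blast
    then show "M \<in> lattice_class ((\<lambda>z. c *s z) ` L)"
      unfolding lattice_class_def 1 using assms by (auto intro!: exI[of _ "d / c"])
  qed
qed

lemma lattice_class_boxlat_scale:
  "c \<noteq> 0 \<Longrightarrow> lattice_class (boxlat u w (vabs v c * a) (vabs v c * b)) = lattice_class (boxlat u w a b)"
  by (simp flip: boxlat_scale add: lattice_class_scale)

lemma lattice_boxlat:
  assumes "\<not> par u w"
  shows "lattice v (boxlat u w 1 ((1/2) ^ n))"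
proof -
  obtain p where p: "p \<noteq> 0" "vabs v p = 1/2" using ex_vabs_half by blast
  define q where "q = p ^ n"
  have q: "q \<noteq> 0" "vabs v q = (1/2) ^ n" using p(1) by (simp_all add: q_def vabs_power p(2))
  define B :: "'k^2^2" where "B = vector [vector [u$1, q * w$1], vector [u$2, q * w$2]]"
  have "det B = q * (u$1 * w$2 - u$2 * w$1)" by (simp add: B_def det_2 algebra_simps)
  then have "det B \<noteq> 0" using assms q by (simp add: par_def)
  have Bv: "B *v a = a$1 *s u + a$2 *s (q *s w)" for a
    by (simp add: B_def vec2_eq_iff mat2_vec_nth algebra_simps)
  have "boxlat u w 1 ((1/2) ^ n) = boxlat u (q *s w) 1 1"
    using boxlat_scale_right[OF q(1), of u w 1 1] q by simp
  also have "\<dots> = {B *v a | a. \<forall>i. a $ i \<in> OK v}"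
  proof (intro equalityI subsetI)
    fix z assume "z \<in> boxlat u (q *s w) 1 1"
    then obtain x y where z: "z = x *s u + y *s (q *s w)" "vabs v x \<le> 1" "vabs v y \<le> 1"
      unfolding boxlat_def by blast
    then show "z \<in> {B *v a | a. \<forall>i. a $ i \<in> OK v}"
      by (intro CollectI exI[of _ "vector [x, y]"]) (simp add: Bv forall_2 OK_iff)
  next
    fix z assume "z \<in> {B *v a | a. \<forall>i. a $ i \<in> OK v}"
    then show "z \<in> boxlat u (q *s w) 1 1" unfolding Bv OK_iff by (auto intro: boxlatI')
  qed
  finally show ?thesis unfolding lattice_def using \<open>det B \<noteq> 0\<close> by blast
qed

lemma lattice_eq_boxlat:
  assumes "lattice v L"
  obtains u w where "\<not> par u w" "L = boxlat u w 1 1"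
proof -
  obtain B :: "'k^2^2" where B: "det B \<noteq> 0" "L = {B *v a | a. \<forall>i. a $ i \<in> OK v}"
    using assms unfolding lattice_def by blast
  define u w where "u = (vector [B$1$1, B$2$1] :: 'k^2)" and "w = (vector [B$1$2, B$2$2] :: 'k^2)"
  have np: "\<not> par u w" using B(1) by (simp add: u_def w_def par_def det_2 mult.commute)
  have Bv: "B *v a = a$1 *s u + a$2 *s w" for a
    by (simp add: u_def w_def vec2_eq_iff mat2_vec_nth algebra_simps)
  have "L = boxlat u w 1 1"
  proof (intro equalityI subsetI)
    fix z assume "z \<in> boxlat u w 1 1"
    then obtain x y where z: "z = x *s u + y *s w" "vabs v x \<le> 1" "vabs v y \<le> 1"
      unfolding boxlat_def by blast
    then show "z \<in> L" unfolding B(2)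
      by (intro CollectI exI[of _ "vector [x, y]"]) (simp add: Bv forall_2 OK_iff)
  next
    fix z assume "z \<in> L"
    then show "z \<in> boxlat u w 1 1" unfolding B(2) Bv OK_iff by (auto intro: boxlatI')
  qed
  with np show ?thesis by (rule that)
qed

lemma lattice_closed:
  assumes "lattice v L" "z \<in> L" "z' \<in> L" "vabs v a \<le> 1" "vabs v b \<le> 1"
  shows "a *s z + b *s z' \<in> L"
proof -
  obtain u w where L: "L = boxlat u w 1 1" using lattice_eq_boxlat[OF assms(1)] by metis
  obtain x y where z: "z = x *s u + y *s w" "vabs v x \<le> 1" "vabs v y \<le> 1"
    using assms(2) unfolding L boxlat_def by blast
  obtain x' y' where z': "z' = x' *s u + y' *s w" "vabs v x' \<le> 1" "vabs v y' \<le> 1"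
    using assms(3) unfolding L boxlat_def by blast
  have e: "a *s z + b *s z' = (a * x + b * x') *s u + (a * y + b * y') *s w"
    unfolding z(1) z'(1) by (simp add: vec2_eq_iff algebra_simps)
  have prod: "vabs v (s * t) \<le> 1" if "vabs v s \<le> 1" "vabs v t \<le> 1" for s t
    using vabs_mult_le[OF that] by simp
  show ?thesis unfolding L
    by (rule boxlatI'[OF e]) (intro vabs_add_le prod assms z z')+
qed

lemma lattice_scale:
  assumes "lattice v L" "c \<noteq> 0"
  shows "lattice v ((\<lambda>z. c *s z) ` L)"
proof -
  obtain u w where L: "\<not> par u w" "L = boxlat u w 1 1" using lattice_eq_boxlat[OF assms(1)] .
  have "\<not> par (c *s u) (c *s w)" using L(1) assms(2) by (simp add: par_def)
  from lattice_boxlat[OF this, of 0] show ?thesis by (simp add: L(2) boxlat_scale_vec)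
qed

lemma BT_vertex_member:
  assumes "x \<in> BT_vertices v" "L \<in> x"
  shows "lattice v L" "x = lattice_class L"
proof -
  obtain M where M: "lattice v M" "x = lattice_class M" using assms(1) unfolding BT_vertices_def by blast
  then obtain c where c: "c \<noteq> 0" "L = (\<lambda>z. c *s z) ` M" using assms(2) unfolding lattice_class_def by blast
  show "lattice v L" using lattice_scale[OF M(1) c(1)] c(2) by simp
  show "x = lattice_class L" using lattice_class_scale[OF c(1)] c(2) M(2) by simp
qed

section \<open>Standard rays and their ends\<close>

lemma stdray_vertex: "\<not> par u w \<Longrightarrow> stdray u w n \<in> BT_vertices v"
  unfolding BT_vertices_def stdray_def using lattice_boxlat by blast

lemma lattice_class_eqD:
  assumes "lattice_class L = lattice_class M"
  obtains c where "c \<noteq> 0" "M = (\<lambda>z. c *s z) ` L"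
proof -
  have "M \<in> lattice_class L" unfolding assms by (rule lattice_class_self)
  then show ?thesis unfolding lattice_class_def using that by blast
qed

lemma stdray_adj:
  assumes np: "\<not> par u w"
  shows "BT_adj v (stdray u w n) (stdray u w (Suc n))"
proof -
  obtain p where p: "p \<noteq> 0" "v p = 1" using ex_uniformizer by blast
  then have p2: "vabs v p = 1/2" by (rule vabs_val_one)
  let ?L = "boxlat u w 1 ((1/2) ^ n)" and ?L' = "boxlat u w 1 ((1/2) ^ Suc n)"
  have pL: "(\<lambda>z. p *s z) ` ?L = boxlat u w (1/2) ((1/2) ^ Suc n)"
    using boxlat_scale[OF p(1), of u w 1 "(1/2) ^ n"] by (simp add: p2)
  have "boxlat u w (1/2) ((1/2) ^ Suc n) \<subseteq> ?L'" by (rule boxlat_mono) auto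
  moreover have "1 *s u \<in> ?L' \<and> 1 *s u \<notin> boxlat u w (1/2) ((1/2) ^ Suc n)"
    by (subst (1 2) boxlat_left_iff[OF np]) simp_all
  ultimately have 1: "(\<lambda>z. p *s z) ` ?L \<subset> ?L'" unfolding pL by blast
  have "?L' \<subseteq> ?L" by (rule boxlat_mono) auto
  moreover have "(p ^ n) *s w \<in> ?L \<and> (p ^ n) *s w \<notin> ?L'"
    by (subst (1 2) boxlat_right_iff[OF np]) (simp_all add: vabs_power p2)
  ultimately have 2: "?L' \<subset> ?L" by blast
  show ?thesis unfolding BT_adj_def using stdray_vertex[OF np] 1 2 p lattice_class_self
    unfolding stdray_def by blast
qed

text \<open>If a homothety by \<open>c\<close> matches the two boxes, the \<open>u\<close> direction
  gives |c| at most 1 and the \<open>w\<close> direction then compares the radii. One inequality is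
  enough to exclude backtracking.\<close>

lemma stdray_inj:
  assumes np: "\<not> par u w" and eq: "stdray u w i = stdray u w j"
  shows "j \<le> i"
proof -
  obtain c where c: "c \<noteq> 0" "boxlat u w 1 ((1/2) ^ i) = (\<lambda>z. c *s z) ` boxlat u w 1 ((1/2) ^ j)"
    using lattice_class_eqD[OF eq[symmetric, unfolded stdray_def]] .
  then have e: "boxlat u w 1 ((1/2) ^ i) = boxlat u w (vabs v c) (vabs v c * (1/2) ^ j)"
    using boxlat_scale[OF c(1), of u w 1 "(1/2) ^ j"] by simp
  have "c *s u \<in> boxlat u w 1 ((1/2) ^ i)" unfolding e by (subst boxlat_left_iff[OF np]) auto
  then have "vabs v c \<le> 1" by (subst (asm) boxlat_left_iff[OF np]) auto
  obtain p where p: "p \<noteq> 0" "vabs v p = 1/2" using ex_vabs_half by blast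
  have "(p ^ i) *s w \<in> boxlat u w 1 ((1/2) ^ i)"
    by (subst boxlat_right_iff[OF np]) (simp_all add: vabs_power p(2))
  then have "(1/2) ^ i \<le> vabs v c * (1/2) ^ j"
    unfolding e by (subst (asm) boxlat_right_iff[OF np]) (simp_all add: vabs_power p(2))
  also have "\<dots> \<le> 1 * (1/2) ^ j" using \<open>vabs v c \<le> 1\<close> by (intro mult_right_mono) auto
  finally have "(1/2::real) ^ i \<le> (1/2) ^ j" by simp
  then show ?thesis by (subst (asm) power_decreasing_iff) auto
qed

lemma stdray_ray:
  assumes "\<not> par u w"
  shows "BT_ray v (stdray u w)"
proof -
  have "stdray u w i \<noteq> stdray u w (Suc (Suc i))" for i
    using stdray_inj[OF assms, of i "Suc (Suc i)"] by auto
  then show ?thesis unfolding BT_ray_def using stdray_adj[OF assms] by blast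
qed

lemma BT_act_lattice_class: "BT_act g (lattice_class L) = lattice_class ((\<lambda>z. g *v z) ` L)"
  for g :: "'k^2^2"
proof -
  have "(\<lambda>z. g *v z) ` (\<lambda>z. c *s z) ` L = (\<lambda>z. c *s z) ` (\<lambda>z. g *v z) ` L" for c
    by (simp add: image_image vector_scalar_commute)
  then show ?thesis unfolding BT_act_def lattice_class_def by blast
qed

lemma BT_act_stdray: "BT_act g (stdray u w i) = stdray (g *v u) (g *v w) i"
  by (simp add: stdray_def BT_act_lattice_class boxlat_mult)

text \<open>After scaling, \<open>w'\<close> is a multiple of \<open>w\<close> plus a multiple of
  \<open>u\<close>. Far out on the ray the shear by the \<open>u\<close> part no longer changes the
  lattice, and the factor of \<open>w\<close> shifts the index by its valuation.\<close>

lemma stdray_same_end_if_par: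
  assumes np: "\<not> par u w" "\<not> par u' w'" and par: "par u u'"
  shows "same_end (stdray u w) (stdray u' w')"
proof -
  have nz: "u \<noteq> 0" "u' \<noteq> 0" using np not_par_nonzero by blast+
  obtain l where l: "u' = l *s u" using par_imp_multiple[OF par nz(1)] .
  have l0: "l \<noteq> 0" using l nz by auto
  obtain a b where ab: "w' = a *s u + b *s w" using vec2_decompose[OF np(1)] .
  have b0: "b \<noteq> 0" using np(2) by (auto simp: ab l par_def)
  define e where "e = v (b / l)"
  have e: "vabs v (b / l) = 2 powr (- real_of_int e)" using b0 l0 by (simp add: e_def vabs_eq_powr)
  obtain m0 where m0: "vabs v (a / l) < 2 ^ m0" using real_arch_pow[of 2] by auto
  \<comment> \<open>Large enough for the shear to be absorbed, and for m + e to be a natural number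
    although \<open>e\<close> may be negative.\<close>
  define m where "m = max m0 (nat (- e))"
  define k where "k = nat (int m + e)"
  have k: "int k = int m + e" unfolding k_def m_def by auto
  have "stdray u w (i + k) = stdray u' w' (i + m)" for i
  proof -
    have "boxlat u' w' 1 ((1/2) ^ (i + m))
        = boxlat (l *s u) (l *s ((a / l) *s u + (b / l) *s w)) 1 ((1/2) ^ (i + m))"
      using l0 by (simp add: l ab vector_add_ldistrib vector_smult_assoc)
    then have "stdray u' w' (i + m) = lattice_class (boxlat u ((a / l) *s u + (b / l) *s w) 1 ((1/2) ^ (i + m)))"
      unfolding stdray_def by (simp only: boxlat_scale_vec[symmetric] lattice_class_scale[OF l0])
    also have "boxlat u ((a / l) *s u + (b / l) *s w) 1 ((1/2) ^ (i + m)) = boxlat u ((b / l) *s w) 1 ((1/2) ^ (i + m))"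
    proof (rule boxlat_shear)
      have "vabs v (a / l) \<le> 2 ^ (i + m)"
        using m0 power_increasing[of m0 "i + m" "2::real"] unfolding m_def by linarith
      then show "vabs v (a / l) * (1/2) ^ (i + m) \<le> 1" by (simp add: power_divide)
    qed
    also have "\<dots> = boxlat u w 1 (vabs v (b / l) * (1/2) ^ (i + m))"
      using b0 l0 by (intro boxlat_scale_right) simp
    also have "vabs v (b / l) * (1/2) ^ (i + m) = (1/2) ^ (i + k)"
    proof -
      have h: "(1/2::real) ^ n = 2 powr (- real n)" for n
        by (simp add: powr_minus powr_realpow power_one_over inverse_eq_divide)
      have "real k = real m + real_of_int e" using k by linarith
      then show ?thesis unfolding h e by (simp add: algebra_simps flip: powr_add)
    qed
    finally show ?thesis by (simp add: stdray_def)
  qed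
  then show ?thesis unfolding same_end_def by blast
qed

text \<open>If the lines differ, each of \<open>u\<close>, \<open>u'\<close> has a nonzero
  transversal coordinate in the other basis. Far out, equality of the classes squeezes the product
  of these two coordinates below every power of 1/2.\<close>

lemma par_if_stdray_same_end:
  assumes np: "\<not> par u w" "\<not> par u' w'" and se: "same_end (stdray u w) (stdray u' w')"
  shows "par u u'"
proof (rule ccontr)
  assume nup: "\<not> par u u'"
  obtain k m where km: "\<And>i. stdray u w (i + k) = stdray u' w' (i + m)"
    using se unfolding same_end_def by blast
  obtain a b where ab: "u' = a *s u + b *s w" using vec2_decompose[OF np(1)] .
  have b0: "b \<noteq> 0" using nup by (auto simp: ab)
  obtain a' b' where ab': "u = a' *s u' + b' *s w'" using vec2_decompose[OF np(2)] .
  have b0': "b' \<noteq> 0" using nup by (auto simp: ab' par_def)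
  have "vabs v b * vabs v b' \<le> (1/2) ^ i" for i
  proof -
    obtain c where c: "c \<noteq> 0"
      "boxlat u' w' 1 ((1/2) ^ (i + m)) = (\<lambda>z. c *s z) ` boxlat u w 1 ((1/2) ^ (i + k))"
      using lattice_class_eqD[OF km[unfolded stdray_def]] .
    then have e: "boxlat u' w' 1 ((1/2) ^ (i + m)) = boxlat u w (vabs v c) (vabs v c * (1/2) ^ (i + k))"
      using boxlat_scale[OF c(1), of u w 1 "(1/2) ^ (i + k)"] by simp
    have "u' \<in> boxlat u' w' 1 ((1/2) ^ (i + m))" by (rule boxlatI'[of _ 1 _ 0]) auto
    then have "a *s u + b *s w \<in> boxlat u w (vabs v c) (vabs v c * (1/2) ^ (i + k))" unfolding e unfolding ab .
    then have 1: "vabs v b \<le> vabs v c * (1/2) ^ (i + k)" using boxlat_iff[OF np(1)] by blast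
    have "c *s u + 0 *s w \<in> boxlat u w (vabs v c) (vabs v c * (1/2) ^ (i + k))" by (rule boxlatI) auto
    moreover have "c *s u + 0 *s w = (c * a') *s u' + (c * b') *s w'"
      by (subst ab') (simp add: vector_add_ldistrib vector_smult_assoc)
    ultimately have "vabs v (c * b') \<le> (1/2) ^ (i + m)"
      using boxlat_iff[OF np(2)] unfolding e[symmetric] by metis
    also have "\<dots> \<le> 1" by (simp add: power_le_one)
    finally have 2: "vabs v c * vabs v b' \<le> 1" by (simp add: vabs_mult)
    have "vabs v b * vabs v b' \<le> vabs v c * (1/2) ^ (i + k) * vabs v b'"
      using 1 by (intro mult_right_mono) auto
    also have "\<dots> = (vabs v c * vabs v b') * (1/2) ^ (i + k)" by simp
    also have "\<dots> \<le> 1 * (1/2) ^ (i + k)" using 2 by (intro mult_right_mono) auto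
    also have "\<dots> \<le> (1/2) ^ i" by (simp add: power_decreasing)
    finally show ?thesis .
  qed
  moreover have "0 < vabs v b * vabs v b'" using b0 b0' by simp
  then have "\<exists>i. (1/2::real) ^ i < vabs v b * vabs v b'" by (rule real_arch_pow_inv) simp
  ultimately show False using not_less by blast
qed

text \<open>For \<open>n > 0\<close> the second alternative is \<open>stdray u w (n - 1)\<close>; for \<open>n = 0\<close> it is \<open>stdray w u 1\<close>.\<close>

lemma stdray_neighbour:
  assumes np: "\<not> par u w" and adj: "BT_adj v (stdray u w n) y"
  shows "(\<exists>c. vabs v c \<le> (1/2) ^ n \<and> y = stdray (u + c *s w) w (Suc n))
    \<or> y = lattice_class (boxlat u w (1/2) ((1/2) ^ n))"
proof -
  let ?L = "boxlat u w 1 ((1/2) ^ n)"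
  obtain L1 L' p where L1: "L1 \<in> stdray u w n" "L' \<in> y" "p \<noteq> 0" "v p = 1"
      "(\<lambda>z. p *s z) ` L1 \<subset> L'" "L' \<subset> L1" and y: "y \<in> BT_vertices v"
    using adj unfolding BT_adj_def by blast
  have p2: "vabs v p = 1/2" using vabs_val_one L1 by blast
  obtain c where c: "c \<noteq> 0" "?L = (\<lambda>z. c *s z) ` L1"
    using lattice_class_eqD BT_vertex_member(2)[OF stdray_vertex[OF np] L1(1)]
    unfolding stdray_def by metis
  \<comment> \<open>The representative of \<open>y\<close> lying between \<open>p\<close> times
    \<open>?L\<close> and \<open>?L\<close>. Such an \<open>M\<close> amounts to a line in the
    residue plane of \<open>?L\<close>, and the two alternatives tell which line it is.\<close>
  define M where "M = (\<lambda>z. c *s z) ` L'"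
  have cmono: "(\<lambda>z. c *s z) ` A \<subset> (\<lambda>z. c *s z) ` B" if "A \<subset> B" for A B :: "('k^2) set"
    using that c(1) by (intro image_strict_mono) (auto simp: inj_on_def vec2_eq_iff)
  have M_L: "M \<subset> ?L" unfolding M_def c(2) using L1(6) by (rule cmono)
  have "(\<lambda>z. p *s z) ` ?L = (\<lambda>z. c *s z) ` (\<lambda>z. p *s z) ` L1"
    unfolding c(2) by (simp add: image_image vector_smult_assoc mult.commute)
  then have pL_M: "(\<lambda>z. p *s z) ` ?L \<subset> M"
    unfolding M_def using cmono[OF L1(5)] by simp
  have pL: "(\<lambda>z. p *s z) ` ?L = boxlat u w (1/2) ((1/2) ^ Suc n)"
    using boxlat_scale[OF L1(3), of u w 1 "(1/2) ^ n"] by (simp add: p2)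
  have latM: "lattice v M" unfolding M_def using lattice_scale BT_vertex_member(1)[OF y L1(2)] c(1) by blast
  have yM: "y = lattice_class M"
    unfolding M_def using lattice_class_scale[OF c(1)] BT_vertex_member(2)[OF y L1(2)] by simp
  have M_sub: "s - t \<in> M" if "s \<in> M" "t \<in> M" for s t
    using lattice_closed[OF latM that, of 1 "-1"] by (simp add: vec2_eq_iff)
  have M_add: "s + t \<in> M" if "s \<in> M" "t \<in> M" for s t
    using lattice_closed[OF latM that, of 1 1] by simp
  have M_scale: "a *s s \<in> M" if "s \<in> M" "vabs v a \<le> 1" for s a
    using lattice_closed[OF latM that(1,1), of a 0] that by (simp add: vec2_eq_iff)
  have M_scale': "b *s s \<in> M" if "a *s s \<in> M" "vabs v b \<le> vabs v a" "a \<noteq> 0" for s a b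
    using M_scale[OF that(1), of "b / a"] that by (simp add: vabs_divide vector_smult_assoc divide_le_eq)
  \<comment> \<open>Replaces a dimension count: \<open>M\<close> is proper, so it cannot contain
    both generators of \<open>?L\<close>.\<close>
  have notboth: "\<not> (1 *s u \<in> M \<and> (\<forall>b. vabs v b \<le> (1/2) ^ n \<longrightarrow> b *s w \<in> M))"
  proof
    assume A: "1 *s u \<in> M \<and> (\<forall>b. vabs v b \<le> (1/2) ^ n \<longrightarrow> b *s w \<in> M)"
    have "?L \<subseteq> M"
    proof
      fix z assume "z \<in> ?L"
      then obtain x y where "z = x *s u + y *s w" "vabs v x \<le> 1" "vabs v y \<le> (1/2) ^ n"
        unfolding boxlat_def by blast
      moreover have "x *s u \<in> M" using M_scale[of u x] A \<open>vabs v x \<le> 1\<close> by simp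
      ultimately show "z \<in> M" using A M_add by blast
    qed
    then show False using M_L by blast
  qed
  \<comment> \<open>A generator of the residue line. It has a unit coefficient at \<open>u\<close>
    in the first alternative, and is congruent to a multiple of \<open>w\<close> in the
    second.\<close>
  obtain z where z: "z \<in> M" "z \<notin> boxlat u w (1/2) ((1/2) ^ Suc n)" using pL_M unfolding pL by blast
  obtain a b where ab: "z = a *s u + b *s w" "vabs v a \<le> 1" "vabs v b \<le> (1/2) ^ n"
    using z(1) M_L unfolding boxlat_def by blast
  show ?thesis
  proof (cases "vabs v a = 1")
    case True
    define d where "d = b / a"
    have a0: "a \<noteq> 0" using True by auto
    have d: "vabs v d \<le> (1/2) ^ n" using ab True by (simp add: d_def vabs_divide)
    have ud: "u + d *s w \<in> M"
    proof -
      have "(1 / a) *s z \<in> M" using z(1) True by (intro M_scale) (simp_all add: vabs_divide)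
      moreover have "(1 / a) *s z = u + d *s w"
        using a0 by (simp add: ab d_def vec2_eq_iff field_simps)
      ultimately show ?thesis by simp
    qed
    have "M = boxlat (u + d *s w) w 1 ((1/2) ^ Suc n)"
    proof (intro equalityI subsetI)
      fix t assume t: "t \<in> M"
      then obtain x y where xy: "t = x *s u + y *s w" "vabs v x \<le> 1" "vabs v y \<le> (1/2) ^ n"
        using M_L unfolding boxlat_def by blast
      define y' where "y' = y - x * d"
      have t': "t = x *s (u + d *s w) + y' *s w"
        by (simp add: xy y'_def vec2_eq_iff algebra_simps)
      have "vabs v (x * d) \<le> 1 * (1/2) ^ n" using xy d by (intro vabs_mult_le) auto
      then have y'le: "vabs v y' \<le> (1/2) ^ n" unfolding y'_def using xy by (intro vabs_diff_le) auto
      have "vabs v y' \<noteq> (1/2) ^ n"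
      proof
        assume eq: "vabs v y' = (1/2) ^ n"
        then have "y' \<noteq> 0" by auto
        have "t - x *s (u + d *s w) \<in> M" using M_sub[OF t M_scale[OF ud xy(2)]] .
        then have "y' *s w \<in> M" using t' by simp
        then have 1: "\<forall>b. vabs v b \<le> (1/2) ^ n \<longrightarrow> b *s w \<in> M" using M_scale' eq \<open>y' \<noteq> 0\<close> by simp
        then have "(u + d *s w) - d *s w \<in> M" using M_sub[OF ud] d by blast
        then show False using notboth 1 by simp
      qed
      then have "vabs v y' \<le> (1/2) ^ Suc n" using y'le by (intro vabs_less_half_power) simp
      then show "t \<in> boxlat (u + d *s w) w 1 ((1/2) ^ Suc n)" unfolding t' using xy by (intro boxlatI)
    next
      fix t assume "t \<in> boxlat (u + d *s w) w 1 ((1/2) ^ Suc n)"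
      then obtain x y where xy: "t = x *s (u + d *s w) + y *s w" "vabs v x \<le> 1" "vabs v y \<le> (1/2) ^ Suc n"
        unfolding boxlat_def by blast
      have "0 *s u + y *s w \<in> boxlat u w (1/2) ((1/2) ^ Suc n)" using xy by (intro boxlatI) auto
      then have "y *s w \<in> M" using pL_M unfolding pL by auto
      then show "t \<in> M" unfolding xy(1) using M_add M_scale[OF ud xy(2)] by blast
    qed
    then show ?thesis using yM d unfolding stdray_def by blast
  next
    case False
    then have a2: "vabs v a \<le> 1/2" using ab(2) by (intro vabs_less_1_imp_le_half) simp
    have "vabs v b = (1/2) ^ n"
    proof (rule ccontr)
      assume "vabs v b \<noteq> (1/2) ^ n"
      then have "vabs v b \<le> (1/2) ^ Suc n" using ab(3) by (intro vabs_less_half_power) simp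
      then show False using z(2) a2 unfolding ab(1) by (simp add: boxlatI)
    qed
    then have b0: "b \<noteq> 0" by auto
    have half: "x *s u \<in> M" if "vabs v x \<le> 1/2" for x
    proof -
      have "x *s u + 0 *s w \<in> boxlat u w (1/2) ((1/2) ^ Suc n)" using that by (intro boxlatI) auto
      then show ?thesis using pL_M unfolding pL by auto
    qed
    have "z - a *s u \<in> M" using M_sub[OF z(1) half[OF a2]] .
    then have "b *s w \<in> M" by (simp add: ab)
    then have w: "y *s w \<in> M" if "vabs v y \<le> (1/2) ^ n" for y
      using M_scale' that b0 \<open>vabs v b = (1/2) ^ n\<close> by simp
    have "M = boxlat u w (1/2) ((1/2) ^ n)"
    proof (intro equalityI subsetI)
      fix t assume t: "t \<in> M"
      then obtain x y where xy: "t = x *s u + y *s w" "vabs v x \<le> 1" "vabs v y \<le> (1/2) ^ n"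
        using M_L unfolding boxlat_def by blast
      have "vabs v x \<noteq> 1"
      proof
        assume x1: "vabs v x = 1"
        have "t - y *s w \<in> M" using M_sub[OF t w[OF xy(3)]] .
        then have "x *s u \<in> M" by (simp add: xy)
        moreover have "x \<noteq> 0" "vabs v 1 \<le> vabs v x" using x1 by auto
        ultimately have "1 *s u \<in> M" using M_scale' by blast
        then show False using notboth w by blast
      qed
      then have "vabs v x \<le> 1/2" using xy(2) by (intro vabs_less_1_imp_le_half) simp
      then show "t \<in> boxlat u w (1/2) ((1/2) ^ n)" unfolding xy(1) using xy(3) by (intro boxlatI)
    next
      fix t assume "t \<in> boxlat u w (1/2) ((1/2) ^ n)"
      then show "t \<in> M" unfolding boxlat_def using M_add half w by blast
    qed
    then show ?thesis using yM by blast
  qed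
qed

lemma stdray_shear:
  "vabs v c \<le> (1/2) ^ n \<Longrightarrow> stdray (u + c *s w) w n = stdray u w n"
  unfolding stdray_def using boxlat_shear_left[of c 1 "(1/2) ^ n" u w] by simp

text \<open>Once the first edge is standard, every further step either backtracks or shears
  \<open>u\<close> by a multiple of \<open>w\<close> of size at most (1/2)^n. By completeness the
  accumulated shears converge, and the limit gives a basis for the whole ray.\<close>

lemma BT_ray_eq_stdray:
  assumes ray: "BT_ray v r"
  obtains u w where "\<not> par u w" "r = stdray u w"
proof -
  have adj: "\<And>i. BT_adj v (r i) (r (Suc i))" and nb: "\<And>i. r i \<noteq> r (Suc (Suc i))"
    using ray unfolding BT_ray_def by auto
  have "r 0 \<in> BT_vertices v" using adj unfolding BT_adj_def by blast
  then obtain u0 w0 where 0: "\<not> par u0 w0" "r 0 = stdray u0 w0 0"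
    unfolding BT_vertices_def stdray_def using lattice_eq_boxlat by (auto; metis)
  \<comment> \<open>Adapts the basis to the first edge: in the second alternative for the neighbour
    the two basis vectors change places.\<close>
  obtain u w where np: "\<not> par u w" and r0: "r 0 = stdray u w 0" and r1: "r 1 = stdray u w 1"
  proof -
    have "(\<exists>c. vabs v c \<le> 1 \<and> r 1 = stdray (u0 + c *s w0) w0 1) \<or> r 1 = lattice_class (boxlat u0 w0 (1/2) 1)"
      using stdray_neighbour[OF 0(1), of 0 "r 1"] adj[of 0] 0(2) by simp
    then show ?thesis
    proof
      assume "\<exists>c. vabs v c \<le> 1 \<and> r 1 = stdray (u0 + c *s w0) w0 1"
      then obtain c where c: "vabs v c \<le> 1" "r 1 = stdray (u0 + c *s w0) w0 1" by blast
      show ?thesis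
      proof (rule that[OF _ _ c(2)])
        show "\<not> par (u0 + c *s w0) w0" using 0(1) by (simp add: par_def algebra_simps)
        show "r 0 = stdray (u0 + c *s w0) w0 0" using 0(2) stdray_shear[of c 0] c by simp
      qed
    next
      assume r: "r 1 = lattice_class (boxlat u0 w0 (1/2) 1)"
      show ?thesis
      proof (rule that[of w0 u0])
        show "\<not> par w0 u0" using 0(1) par_sym by blast
        show "r 0 = stdray w0 u0 0" using 0(2) by (simp add: stdray_def boxlat_commute)
        show "r 1 = stdray w0 u0 1" using r by (simp add: stdray_def boxlat_commute)
      qed
    qed
  qed
  have np': "\<not> par (u + c *s w) w" for c using np by (simp add: par_def algebra_simps)
  \<comment> \<open>Two consecutive vertices are carried along, because backtracking compares the
    next vertex with the one before the current one.\<close>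
  define P where "P n s \<longleftrightarrow> r n = stdray (u + s *s w) w n \<and> r (Suc n) = stdray (u + s *s w) w (Suc n)" for n s
  have "\<exists>s. \<forall>n. P n (s n) \<and> vabs v (s (Suc n) - s n) \<le> (1/2) ^ Suc n"
  proof (rule dependent_nat_choice)
    show "\<exists>s. P 0 s" unfolding P_def using r0 r1 by (intro exI[of _ 0]) simp
  next
    fix s n assume P: "P n s"
    then have "BT_adj v (stdray (u + s *s w) w (Suc n)) (r (Suc (Suc n)))" unfolding P_def using adj by metis
    from stdray_neighbour[OF np' this] show "\<exists>t. P (Suc n) t \<and> vabs v (t - s) \<le> (1/2) ^ Suc n"
    proof
      assume "\<exists>c. vabs v c \<le> (1/2) ^ Suc n \<and> r (Suc (Suc n)) = stdray (u + s *s w + c *s w) w (Suc (Suc n))"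
      then obtain c where c: "vabs v c \<le> (1/2) ^ Suc n"
        "r (Suc (Suc n)) = stdray (u + s *s w + c *s w) w (Suc (Suc n))" by blast
      have e: "u + s *s w + c *s w = u + (s + c) *s w" by (simp add: vec2_eq_iff algebra_simps)
      have "r (Suc n) = stdray (u + (s + c) *s w) w (Suc n)"
        using P stdray_shear[OF c(1), of "u + s *s w" w] unfolding P_def e by simp
      then show ?thesis using c unfolding P_def e by (intro exI[of _ "s + c"]) simp
    next
      assume y: "r (Suc (Suc n)) = lattice_class (boxlat (u + s *s w) w (1/2) ((1/2) ^ Suc n))"
      obtain p where p: "p \<noteq> 0" "vabs v p = 1/2" using ex_vabs_half by blast
      \<comment> \<open>The box of the second alternative is a homothetic copy, by the factor
        \<open>p\<close>, of the one two steps earlier.\<close>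
      have "r (Suc (Suc n)) = r n"
        using y P lattice_class_boxlat_scale[OF p(1), of "u + s *s w" w 1 "(1/2) ^ n"]
        unfolding P_def stdray_def by (simp add: p(2))
      then show ?thesis using nb by metis
    qed
  qed
  then obtain s where s: "\<And>n. P n (s n)" "\<And>n. vabs v (s (Suc n) - s n) \<le> (1/2) ^ Suc n" by blast
  have "vabs v (s (Suc n) - s n) \<le> (1/2) ^ n" for n
    using s(2)[of n] zero_le_power[of "1/2::real" n] unfolding power_Suc by linarith
  then obtain l where l: "\<And>n. vabs v (s n - l) \<le> (1/2) ^ n" using complete_geometric by blast
  have "r n = stdray (u + l *s w) w n" for n
  proof -
    \<comment> \<open>Replacing \<open>s n\<close> by the limit is a shear of size at most (1/2)^n,
      which leaves vertex \<open>n\<close> unchanged.\<close>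
    have "u + s n *s w = u + l *s w + (s n - l) *s w" by (simp add: vec2_eq_iff algebra_simps)
    then show ?thesis using s(1)[of n] stdray_shear[OF l[of n], of "u + l *s w" w] unfolding P_def by simp
  qed
  then have "r = stdray (u + l *s w) w" by blast
  with np' show ?thesis by (rule that)
qed

section \<open>Stabilisers of ends as stabilisers of lines\<close>

lemma same_end_stdray_iff:
  "\<not> par u w \<Longrightarrow> \<not> par u' w' \<Longrightarrow> same_end (stdray u w) (stdray u' w') \<longleftrightarrow> par u u'"
  using stdray_same_end_if_par par_if_stdray_same_end by blast

lemma same_end_act_iff:
  assumes "\<not> par u w" "\<not> par u' w'" "det g = 1"
  shows "same_end (\<lambda>i. BT_act g (stdray u w i)) (stdray u' w') \<longleftrightarrow> par (g *v u) u'"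
proof -
  have "(\<lambda>i. BT_act g (stdray u w i)) = stdray (g *v u) (g *v w)"
    by (rule ext) (rule BT_act_stdray)
  moreover have "\<not> par (g *v u) (g *v w)" using assms par_mult_iff by blast
  ultimately show ?thesis using same_end_stdray_iff[OF _ assms(2)] by simp
qed

lemma ex_not_par: "u \<noteq> 0 \<Longrightarrow> \<exists>w. \<not> par u (w :: 'k^2)"
  by (intro exI[of _ "if u$1 = 0 then vector [1, 0] else vector [0, 1]"])
     (auto simp: par_def vec2_nonzero_iff)

lemma stab_end_iff:
  assumes "SL2_subgroup G"
  shows "stab_end v G \<longleftrightarrow> (\<exists>u. u \<noteq> 0 \<and> (\<forall>g\<in>G. par (g *v u) u))"
proof
  assume "stab_end v G"
  then obtain r where r: "BT_ray v r" "\<forall>g\<in>G. same_end (\<lambda>i. BT_act g (r i)) r"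
    unfolding stab_end_def by blast
  obtain u w where uw: "\<not> par u w" "r = stdray u w" using BT_ray_eq_stdray[OF r(1)] .
  have "\<forall>g\<in>G. par (g *v u) u"
    using r(2) unfolding uw(2) by (simp add: same_end_act_iff[OF uw(1) uw(1)] SL2_subgroup_det[OF assms])
  then show "\<exists>u. u \<noteq> 0 \<and> (\<forall>g\<in>G. par (g *v u) u)" using not_par_nonzero uw(1) by blast
next
  assume "\<exists>u. u \<noteq> 0 \<and> (\<forall>g\<in>G. par (g *v u) u)"
  then obtain u where u: "u \<noteq> 0" "\<forall>g\<in>G. par (g *v u) u" by blast
  obtain w where w: "\<not> par u w" using ex_not_par[OF u(1)] by blast
  have "\<forall>g\<in>G. same_end (\<lambda>i. BT_act g (stdray u w i)) (stdray u w)"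
    using u(2) by (simp add: same_end_act_iff[OF w w] SL2_subgroup_det[OF assms])
  then show "stab_end v G" unfolding stab_end_def using stdray_ray[OF w] by blast
qed

lemma stab_end_pair_iff:
  assumes "SL2_subgroup G"
  shows "stab_end_pair v G \<longleftrightarrow> (\<exists>u w. \<not> par u w \<and>
    (\<forall>g\<in>G. (par (g *v u) u \<and> par (g *v w) w) \<or> (par (g *v u) w \<and> par (g *v w) u)))"
proof
  assume "stab_end_pair v G"
  then obtain r1 r2 where r: "BT_ray v r1" "BT_ray v r2" "\<not> same_end r1 r2"
    "\<forall>g\<in>G. (same_end (\<lambda>i. BT_act g (r1 i)) r1 \<and> same_end (\<lambda>i. BT_act g (r2 i)) r2)
          \<or> (same_end (\<lambda>i. BT_act g (r1 i)) r2 \<and> same_end (\<lambda>i. BT_act g (r2 i)) r1)"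
    unfolding stab_end_pair_def by blast
  obtain u1 w1 where 1: "\<not> par u1 w1" "r1 = stdray u1 w1" using BT_ray_eq_stdray[OF r(1)] .
  obtain u2 w2 where 2: "\<not> par u2 w2" "r2 = stdray u2 w2" using BT_ray_eq_stdray[OF r(2)] .
  have "\<not> par u1 u2" using r(3) same_end_stdray_iff 1 2 by blast
  moreover have "(par (g *v u1) u1 \<and> par (g *v u2) u2) \<or> (par (g *v u1) u2 \<and> par (g *v u2) u1)"
    if g: "g \<in> G" for g
  proof -
    have d: "det g = 1" using SL2_subgroup_det[OF assms g] .
    show ?thesis using r(4)[rule_format, OF g] unfolding 1(2) 2(2)
      same_end_act_iff[OF 1(1) 1(1) d] same_end_act_iff[OF 1(1) 2(1) d]
      same_end_act_iff[OF 2(1) 1(1) d] same_end_act_iff[OF 2(1) 2(1) d] .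
  qed
  ultimately show "\<exists>u w. \<not> par u w \<and>
    (\<forall>g\<in>G. (par (g *v u) u \<and> par (g *v w) w) \<or> (par (g *v u) w \<and> par (g *v w) u))" by blast
next
  assume "\<exists>u w. \<not> par u w \<and>
    (\<forall>g\<in>G. (par (g *v u) u \<and> par (g *v w) w) \<or> (par (g *v u) w \<and> par (g *v w) u))"
  then obtain u w where uw: "\<not> par u w"
    "\<forall>g\<in>G. (par (g *v u) u \<and> par (g *v w) w) \<or> (par (g *v u) w \<and> par (g *v w) u)" by blast
  have wu: "\<not> par w u" using uw(1) par_sym by blast
  have "(same_end (\<lambda>i. BT_act g (stdray u w i)) (stdray u w) \<and> same_end (\<lambda>i. BT_act g (stdray w u i)) (stdray w u))
      \<or> (same_end (\<lambda>i. BT_act g (stdray u w i)) (stdray w u) \<and> same_end (\<lambda>i. BT_act g (stdray w u i)) (stdray u w))"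
    if g: "g \<in> G" for g
  proof -
    have d: "det g = 1" using SL2_subgroup_det[OF assms g] .
    show ?thesis using uw(2)[rule_format, OF g] unfolding
      same_end_act_iff[OF uw(1) uw(1) d] same_end_act_iff[OF uw(1) wu d]
      same_end_act_iff[OF wu uw(1) d] same_end_act_iff[OF wu wu d] .
  qed
  moreover have "\<not> same_end (stdray u w) (stdray w u)" using same_end_stdray_iff[OF uw(1) wu] uw(1) by blast
  ultimately show "stab_end_pair v G" unfolding stab_end_pair_def
    using stdray_ray[OF uw(1)] stdray_ray[OF wu] by blast
qed

end

section \<open>Metabelian, bounded and elementary groups\<close>

lemma det_zero_if_kernel:
  fixes A :: "'a::field^2^2"
  assumes "A *v u = 0" "u \<noteq> 0"
  shows "det A = 0"
proof -
  have e: "A$1$1 * u$1 + A$1$2 * u$2 = 0" "A$2$1 * u$1 + A$2$2 * u$2 = 0"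
    using assms(1) by (simp_all add: mat2_simps)
  have "det A * u$1 = 0" "det A * u$2 = 0" unfolding det_2 using e by algebra+
  then show ?thesis using assms(2) by (auto simp: vec2_nonzero_iff)
qed

lemma mult_minus_one_vec: "(A - mat 1) *v u = A *v u - u"
  for A :: "'a::field^2^2"
  by (simp add: vec2_eq_iff mat2_vec_nth mat2_mat_nth algebra_simps)

section \<open>Groups whose commutators commute\<close>

definition mcomm :: "'a::field^2^2 \<Rightarrow> 'a^2^2 \<Rightarrow> 'a^2^2" where
  "mcomm a b = a ** b ** adj2 a ** adj2 b"

text \<open>Commutativity of the derived group, tested on its generators; in this form it is a law
  in words.\<close>

definition metabelian :: "('a::field^2^2) set \<Rightarrow> bool" where
  "metabelian G \<longleftrightarrow> (\<forall>a\<in>G. \<forall>b\<in>G. \<forall>c\<in>G. \<forall>d\<in>G. mcomm a b ** mcomm c d = mcomm c d ** mcomm a b)"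

lemma det_mcomm: "det a = 1 \<Longrightarrow> det b = 1 \<Longrightarrow> det (mcomm a b) = 1"
  by (simp add: mcomm_def det_mul)

lemma mcomm_closed: "SL2_subgroup G \<Longrightarrow> a \<in> G \<Longrightarrow> b \<in> G \<Longrightarrow> mcomm a b \<in> G"
  unfolding mcomm_def by (intro SL2_subgroup_mult SL2_subgroup_adj2)

lemma adj2_cancel: "det c = 1 \<Longrightarrow> X ** adj2 c ** c = X" "det c = 1 \<Longrightarrow> X ** c ** adj2 c = X"
  for c :: "'a::field^2^2"
  by (simp_all add: mult_adj2 flip: matrix_mul_assoc)

lemma mcomm_conj:
  assumes "det c = 1"
  shows "c ** mcomm a b ** adj2 c = mcomm (c ** a ** adj2 c) (c ** b ** adj2 c)"
  by (simp add: mcomm_def adj2_mult matrix_mul_assoc adj2_cancel[OF assms])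

lemma adj2_mult_vec:
  assumes "det a = 1"
  shows "adj2 a *v (a *v u) = u" "a *v (adj2 a *v u) = u"
  using assms by (simp_all add: matrix_vector_mul_assoc mult_adj2)

lemma par_comp:
  fixes a b :: "'a::field^2^2"
  assumes "par (b *v x) y" "par (a *v y) z" "det a = 1" "y \<noteq> 0"
  shows "par ((a ** b) *v x) z"
proof -
  have "par (a *v (b *v x)) (a *v y)" using assms(1) par_mult_iff[OF assms(3)] by blast
  moreover have "a *v y \<noteq> 0" using mult_vec_nonzero assms(3,4) by blast
  ultimately show ?thesis using par_trans assms(2) by (metis matrix_vector_mul_assoc)
qed

lemma par_adj2:
  fixes a :: "'a::field^2^2"
  assumes "par (a *v x) y" "det a = 1"
  shows "par (adj2 a *v y) x"
  using par_mult_iff[of "adj2 a" "a *v x" y] assms by (simp add: adj2_mult_vec par_sym)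

text \<open>Eigenvalues on the invariant line cancel in a commutator, so commutators fix
  \<open>u\<close>. Determinant 1 makes them and their products unipotent, and
  \<open>unipotents_commute\<close> applies.\<close>

lemma metabelian_if_line:
  fixes G :: "('a::field^2^2) set"
  assumes G: "SL2_subgroup G" and u: "u \<noteq> 0" "\<And>g. g \<in> G \<Longrightarrow> par (g *v u) u"
  shows "metabelian G"
proof -
  have fixed: "mcomm a b *v u = u" if ab: "a \<in> G" "b \<in> G" for a b
  proof -
    have d: "det a = 1" "det b = 1" using SL2_subgroup_det[OF G] ab by blast+
    obtain l m where l: "a *v u = l *s u" and m: "b *v u = m *s u"
      using u ab by (metis par_imp_multiple par_sym)
    have l0: "l \<noteq> 0" "m \<noteq> 0"
      using l m mult_vec_nonzero[OF d(1) u(1)] mult_vec_nonzero[OF d(2) u(1)] by auto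
    have "l *s (adj2 a *v u) = u" "m *s (adj2 b *v u) = u"
      using adj2_mult_vec(1)[OF d(1), of u] adj2_mult_vec(1)[OF d(2), of u]
      by (simp_all add: l m vector_scalar_commute)
    then have "adj2 a *v u = (1 / l) *s u" "adj2 b *v u = (1 / m) *s u"
      using l0 by (metis divide_inverse mult_1 left_inverse vector_smult_assoc vector_smult_lid)+
    then show ?thesis
      using l0 by (simp add: mcomm_def l m vector_scalar_commute vector_smult_assoc flip: matrix_vector_mul_assoc)
  qed
  have unip: "det (m - mat 1) = 0" if "m *v u = u" for m
    using det_zero_if_kernel[of "m - mat 1" u] that u(1) by (simp add: mult_minus_one_vec)
  have comm: "m ** n = n ** m" if "m *v u = u" "n *v u = u" "det m = 1" "det n = 1" for m n
  proof (rule unipotents_commute)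
    have "(m ** n) *v u = u" using that by (simp flip: matrix_vector_mul_assoc)
    then show "det (m ** n - mat 1) = 0" by (rule unip)
  qed (use that unip in auto)
  show ?thesis unfolding metabelian_def
    by (intro ballI comm fixed det_mcomm SL2_subgroup_det[OF G])
qed

text \<open>A commutator swaps the two lines an even number of times, so it is diagonal in the basis
  \<open>u\<close>, \<open>w\<close>; diagonal matrices commute.\<close>

lemma metabelian_if_line_pair:
  fixes G :: "('a::field^2^2) set"
  assumes G: "SL2_subgroup G" and np: "\<not> par u w"
    and perm: "\<And>g. g \<in> G \<Longrightarrow> (par (g *v u) u \<and> par (g *v w) w) \<or> (par (g *v u) w \<and> par (g *v w) u)"
  shows "metabelian G"
proof -
  have nz: "u \<noteq> 0" "w \<noteq> 0" using not_par_nonzero[OF np] by auto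
  define D where "D g \<longleftrightarrow> det g = 1 \<and> par (g *v u) u \<and> par (g *v w) w" for g
  define S where "S g \<longleftrightarrow> det g = 1 \<and> par (g *v u) w \<and> par (g *v w) u" for g
  have DS: "D g \<or> S g" if "g \<in> G" for g
    using perm[OF that] SL2_subgroup_det[OF G that] unfolding D_def S_def by blast
  have adj: "D g \<Longrightarrow> D (adj2 g)" "S g \<Longrightarrow> S (adj2 g)" for g
    unfolding D_def S_def using par_adj2 by auto
  have mult: "D g \<Longrightarrow> D h \<Longrightarrow> D (g ** h)" "D g \<Longrightarrow> S h \<Longrightarrow> S (g ** h)"
    "S g \<Longrightarrow> D h \<Longrightarrow> S (g ** h)" "S g \<Longrightarrow> S h \<Longrightarrow> D (g ** h)" for g h
    unfolding D_def S_def using nz par_comp by (auto simp: det_mul)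
  have D: "D (mcomm a b)" if "a \<in> G" "b \<in> G" for a b
    using DS[OF that(1)] DS[OF that(2)] unfolding mcomm_def using adj mult by metis
  have "m ** n = n ** m" if "D m" "D n" for m n
  proof (rule mat2_eq_on_basis[OF np])
    have "(m ** n) *v x = (n ** m) *v x" if x: "par (m *v x) x" "par (n *v x) x" "x \<noteq> 0" for x
    proof -
      obtain k where "m *v x = k *s x" using par_imp_multiple[OF par_sym[OF x(1)] x(3)] .
      moreover obtain l where "n *v x = l *s x" using par_imp_multiple[OF par_sym[OF x(2)] x(3)] .
      ultimately show ?thesis by (simp add: vector_scalar_commute vector_smult_assoc mult.commute flip: matrix_vector_mul_assoc)
    qed
    then show "(m ** n) *v u = (n ** m) *v u" "(m ** n) *v w = (n ** m) *v w"
      using that nz unfolding D_def by blast+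
  qed
  then show ?thesis unfolding metabelian_def using D by blast
qed

lemma scalar_if_all_par:
  fixes A :: "'a::field^2^2"
  assumes "\<And>u. par (A *v u) u"
  shows "\<exists>m. A = mat m"
proof -
  have "A$2$1 = 0" using assms[of "vector [1, 0]"] by (simp add: par_def mat2_vec_nth)
  moreover have "A$1$2 = 0" using assms[of "vector [0, 1]"] by (simp add: par_def mat2_vec_nth)
  moreover have "A$1$1 = A$2$2"
    using assms[of "vector [1, 1]"] calculation by (simp add: par_def mat2_vec_nth)
  ultimately show ?thesis by (intro exI[of _ "A$1$1"]) (simp add: mat2_eq_iff mat2_mat_nth)
qed

lemma mat_add_mult_vec: "(mat x + mat y ** g) *v z = x *s z + y *s (g *v z)"
  for g :: "'a::field^2^2"
  by (simp add: vec2_eq_iff mat2_vec_nth mat2_mult_nth mat2_mat_nth algebra_simps)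

text \<open>\<open>u\<close> is a cyclic vector for \<open>g\<close>, so a matrix commuting with
  \<open>g\<close> is determined by its value at \<open>u\<close>.\<close>

lemma centralizer_of_nonscalar:
  fixes g h :: "'a::field^2^2"
  assumes "\<not> par (g *v u) u" "h ** g = g ** h"
  shows "\<exists>x y. h = mat x + mat y ** g"
proof -
  have np: "\<not> par u (g *v u)" using assms(1) par_sym by blast
  obtain x y where xy: "h *v u = x *s u + y *s (g *v u)" using vec2_decompose[OF np] .
  have "h = mat x + mat y ** g"
  proof (rule mat2_eq_on_basis[OF np])
    show "h *v u = (mat x + mat y ** g) *v u" by (simp add: xy mat_add_mult_vec)
    have "h *v (g *v u) = g *v (h *v u)" using assms(2) by (simp add: matrix_vector_mul_assoc)
    also have "\<dots> = (mat x + mat y ** g) *v (g *v u)"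
      by (simp add: xy mat_add_mult_vec matrix_vector_right_distrib vector_scalar_commute)
    finally show "h *v (g *v u) = (mat x + mat y ** g) *v (g *v u)" .
  qed
  then show ?thesis by blast
qed

text \<open>A nonscalar commutator works, since its conjugates are commutators and commute with it.
  If all commutators are scalar, any nonscalar \<open>g\<close> works: its conjugates are scalar
  multiples of it.\<close>

lemma ex_normalized_subalgebra:
  fixes G :: "('a::field^2^2) set"
  assumes G: "SL2_subgroup G" and meta: "metabelian G"
    and noline: "\<And>u. u \<noteq> 0 \<Longrightarrow> \<exists>g\<in>G. \<not> par (g *v u) u"
  obtains g u where "g \<in> G" "\<not> par (g *v u) u"
    "\<And>c. c \<in> G \<Longrightarrow> \<exists>x y. c ** g ** adj2 c = mat x + mat y ** g"
proof (cases "\<exists>a\<in>G. \<exists>b\<in>G. \<exists>u. \<not> par (mcomm a b *v u) u")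
  case True
  then obtain a b u where ab: "a \<in> G" "b \<in> G" "\<not> par (mcomm a b *v u) u" by blast
  show ?thesis
  proof (rule that[OF mcomm_closed[OF G ab(1,2)] ab(3)])
    fix c assume c: "c \<in> G"
    have "c ** mcomm a b ** adj2 c = mcomm (c ** a ** adj2 c) (c ** b ** adj2 c)"
      using mcomm_conj SL2_subgroup_det[OF G c] by blast
    moreover have "c ** a ** adj2 c \<in> G" "c ** b ** adj2 c \<in> G"
      using ab c by (auto intro!: SL2_subgroup_mult[OF G] SL2_subgroup_adj2[OF G])
    ultimately have "(c ** mcomm a b ** adj2 c) ** mcomm a b = mcomm a b ** (c ** mcomm a b ** adj2 c)"
      using meta ab(1,2) unfolding metabelian_def by simp
    then show "\<exists>x y. c ** mcomm a b ** adj2 c = mat x + mat y ** mcomm a b"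
      by (rule centralizer_of_nonscalar[OF ab(3)])
  qed
next
  case False
  have "vector [1, 0] \<noteq> (0 :: 'a^2)" by (simp add: vec2_nonzero_iff)
  then obtain g where g: "g \<in> G" "\<not> par (g *v vector [1, 0]) (vector [1, 0])" using noline by blast
  show ?thesis
  proof (rule that[OF g])
    fix c assume c: "c \<in> G"
    obtain m where m: "mcomm c g = mat m" using scalar_if_all_par[of "mcomm c g"] False c g(1) by blast
    have "c ** g ** adj2 c = mcomm c g ** g"
      unfolding mcomm_def by (rule adj2_cancel(1)[OF SL2_subgroup_det[OF G g(1)], symmetric])
    also have "\<dots> = mat 0 + mat m ** g" by (simp add: m mat2_simps)
    finally show "\<exists>x y. c ** g ** adj2 c = mat x + mat y ** g" by blast
  qed
qed

text \<open>If the generator of the normalized subalgebra has an eigenvector, the group permutes its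
  (at most two) eigenlines.\<close>

lemma line_pair_if_eigenvector:
  fixes G :: "('a::field^2^2) set"
  assumes G: "SL2_subgroup G"
    and noline: "\<And>u. u \<noteq> 0 \<Longrightarrow> \<exists>g\<in>G. \<not> par (g *v u) u"
    and g: "g \<in> G" "\<not> par (g *v z) z"
    and norm: "\<And>c. c \<in> G \<Longrightarrow> \<exists>x y. c ** g ** adj2 c = mat x + mat y ** g"
    and u: "u \<noteq> 0" "par (g *v u) u"
  shows "\<exists>u w. \<not> par u w \<and>
    (\<forall>g\<in>G. (par (g *v u) u \<and> par (g *v w) w) \<or> (par (g *v u) w \<and> par (g *v w) u))"
proof -
  \<comment> \<open>\<open>c\<close> permutes the eigenlines of \<open>g\<close>, because the
    conjugate of \<open>g\<close> by \<open>c\<close> is a polynomial in \<open>g\<close> that is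
    not constant.\<close>
  have step: "par (g *v (c *v s)) (c *v s)" if c: "c \<in> G" and s: "s \<noteq> 0" "par (g *v s) s" for c s
  proof -
    have d: "det c = 1" using SL2_subgroup_det[OF G c] .
    obtain x y where xy: "c ** g ** adj2 c = mat x + mat y ** g" using norm[OF c] by blast
    have act: "c *v (g *v t) = x *s (c *v t) + y *s (g *v (c *v t))" for t
    proof -
      have "c *v (g *v t) = (c ** g ** adj2 c) *v (c *v t)"
        by (simp add: adj2_mult_vec[OF d] flip: matrix_vector_mul_assoc)
      then show ?thesis by (simp add: xy mat_add_mult_vec)
    qed
    have "y \<noteq> 0"
    proof
      assume "y = 0"
      then have "c *v (g *v z) = c *v (x *s z)" by (simp add: act vector_scalar_commute)
      then have "g *v z = x *s z" by (metis adj2_mult_vec(1)[OF d])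
      then show False using g(2) by simp
    qed
    obtain l where l: "g *v s = l *s s" using s by (metis par_imp_multiple par_sym)
    have "y *s (g *v (c *v s)) = (l - x) *s (c *v s)"
      using act[of s] by (simp add: l vector_scalar_commute vec2_eq_iff algebra_simps)
    then have "g *v (c *v s) = ((l - x) / y) *s (c *v s)"
      using \<open>y \<noteq> 0\<close> by (simp add: vec2_eq_iff field_simps)
    then show ?thesis by simp
  qed
  obtain c0 where c0: "c0 \<in> G" "\<not> par (c0 *v u) u" using noline[OF u(1)] by blast
  \<comment> \<open>The second eigenline is the image of the first under an element that moves it.
    There is no third one, since \<open>g\<close> is not scalar.\<close>
  define w where "w = c0 *v u"
  have w: "w \<noteq> 0" "par (g *v w) w" "\<not> par u w"
    using step[OF c0(1) u] c0(2) not_par_nonzero par_sym unfolding w_def by blast+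
  have "(par (c *v u) u \<and> par (c *v w) w) \<or> (par (c *v u) w \<and> par (c *v w) u)" if c: "c \<in> G" for c
  proof -
    have d: "det c = 1" using SL2_subgroup_det[OF G c] .
    have nz: "c *v u \<noteq> 0" "c *v w \<noteq> 0" using mult_vec_nonzero[OF d] u(1) w(1) by blast+
    have or: "par s u \<or> par s w" if "par (g *v s) s" for s
      using three_eigenlines_scalar[OF w(3) _ _ u(2) w(2) that, of z] g(2) par_sym by blast
    have ncw: "\<not> par (c *v u) (c *v w)" using par_mult_iff[OF d] w(3) by blast
    have "\<not> (par (c *v u) s \<and> par (c *v w) s)" if "s \<noteq> 0" for s
      using ncw par_trans[of "c *v u" s "c *v w"] par_sym that by blast
    then show ?thesis using or[OF step[OF c u]] or[OF step[OF c w(1,2)]] u(1) w(1) by blast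
  qed
  with w(3) show ?thesis by blast
qed

context nonarch_field
begin

text \<open>A larger trace would give \<open>h\<close> an eigenvector, which is one of
  \<open>g\<close> too unless \<open>h\<close> is scalar; but a scalar of determinant 1 has trace of
  size at most 1.\<close>

lemma trace_small_if_no_eigenvector:
  assumes noeig: "\<And>u. u \<noteq> 0 \<Longrightarrow> \<not> par (g *v u) u"
    and h: "det h = 1" "h = mat x + mat y ** g"
  shows "vabs v (h$1$1 + h$2$2) \<le> 1"
proof (rule ccontr)
  assume "\<not> ?thesis"
  then have big: "vabs v (h$1$1 + h$2$2) > 1" by simp
  obtain l where l: "l * l - (h$1$1 + h$2$2) * l + 1 = 0" using ex_root_of_large_trace[OF big] by blast
  have "det (h - mat l) = l * l - (h$1$1 + h$2$2) * l + det h"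
    by (simp add: det_2 mat2_mat_nth algebra_simps)
  then have "det (h - mat l) = 0" using l h(1) by simp
  then obtain u where u: "u \<noteq> 0" "(h - mat l) *v u = 0" by (rule det_zero_kernel)
  have "x *s u + y *s (g *v u) - l *s u = 0"
  proof -
    have "(h - mat l) *v u = h *v u - l *s u"
      by (simp add: vec2_eq_iff mat2_vec_nth mat2_mat_nth algebra_simps)
    then show ?thesis using u(2) h(2) by (simp add: mat_add_mult_vec)
  qed
  then have e: "y *s (g *v u) = (l - x) *s u" by (simp add: vec2_eq_iff algebra_simps)
  have "y = 0"
  proof (rule ccontr)
    assume "y \<noteq> 0"
    then have "g *v u = ((l - x) / y) *s u" using e by (simp add: vec2_eq_iff field_simps)
    then show False using noeig[OF u(1)] by simp
  qed
  then have hx: "h = mat x" using h(2) by (simp add: mat2_simps)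
  then have "x * x = 1" using h(1) by (simp add: det_2 mat2_mat_nth)
  then have "vabs v x * vabs v x = 1" by (metis vabs_mult vabs_one)
  then have "vabs v x = 1" by (metis abs_of_nonneg real_sqrt_abs2 real_sqrt_one vabs_nonneg)
  then have "vabs v (h$1$1 + h$2$2) \<le> 1" unfolding hx mat2_mat_nth by (intro vabs_add_le) simp_all
  then show False using big by simp
qed

text \<open>K[g] is a quadratic field, and conjugation by an element of \<open>G\<close> induces the
  identity or the nontrivial automorphism of it. So the centraliser of \<open>g\<close> has index at
  most 2 in \<open>G\<close>, and the traces bound it.\<close>

lemma bounded_if_no_eigenvector:
  assumes G: "SL2_subgroup G" and g: "g \<in> G"
    and noeig: "\<And>u. u \<noteq> 0 \<Longrightarrow> \<not> par (g *v u) u"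
    and norm: "\<And>c. c \<in> G \<Longrightarrow> \<exists>x y. c ** g ** adj2 c = mat x + mat y ** g"
  shows "\<exists>C. \<forall>c\<in>G. mle C c"
proof -
  define t where "t = g$1$1 + g$2$2"
  have detg: "det g = 1" using SL2_subgroup_det[OF G g] .
  have dg: "g$1$1 * g$2$2 - g$1$2 * g$2$1 = 1" using detg by (simp add: det_2)
  \<comment> \<open>The determinant is the norm of the field K[g], so it vanishes only at 0.\<close>
  have inj: "x = 0 \<and> y = 0" if d: "det (mat x + mat y ** g) = 0" for x y
  proof -
    obtain u where u: "u \<noteq> 0" "(mat x + mat y ** g) *v u = 0" using det_zero_kernel[OF d] .
    then have e: "x *s u + y *s (g *v u) = 0" by (simp add: mat_add_mult_vec)
    have "y = 0"
    proof (rule ccontr)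
      assume "y \<noteq> 0"
      then have "g *v u = (- x / y) *s u"
        using e by (simp add: vec2_eq_iff field_simps add_eq_0_iff)
      then show False using noeig[OF u(1)] par_scale(1) by metis
    qed
    then show ?thesis using e u(1) by simp
  qed
  \<comment> \<open>Otherwise 1 or -1 would be an eigenvalue of \<open>g\<close>.\<close>
  have tne: "t * t - 4 \<noteq> 0"
  proof
    assume "t * t - 4 = 0"
    then have "(t - 2) * (t + 2) = 0" by (simp add: algebra_simps)
    then consider "t = 2" | "t = - 2" by (auto simp: eq_neg_iff_add_eq_0)
    then show False
    proof cases
      case 1
      have "det (mat (-1) + mat 1 ** g) = 2 - t"
        using dg by (simp add: mat2_simps t_def algebra_simps)
      then show False using inj[of "-1" 1] 1 by simp
    next
      case 2
      have "det (mat 1 + mat 1 ** g) = 2 + t"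
        using dg by (simp add: mat2_simps t_def algebra_simps)
      then show False using inj[of 1 1] 2 by simp
    qed
  qed
  obtain C where C: "C \<ge> 1" "mle C g" using ex_mle by blast
  have C0: "C \<ge> 0" using C by simp
  define R where "R = C * C / vabs v (t * t - 4)"
  have R0: "R \<ge> 0" unfolding R_def using C0 by simp
  have tC: "vabs v t \<le> C" unfolding t_def using C(2) by (intro vabs_add_le mle_nth)
  have two: "vabs v 2 \<le> 1" using vabs_of_nat_le_1[of 2] by simp
  have CC: "1 \<le> C * C" "C \<le> C * C" using C(1) mult_mono[of 1 C 1 C] mult_left_mono[of 1 C C] by auto
  have comm_bound: "mle (R * C) h" if h: "h \<in> G" "h ** g = g ** h" for h
  proof -
    have "\<not> par (g *v vector [1, 0]) (vector [1, 0])" by (rule noeig) (simp add: vec2_nonzero_iff)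
    then obtain x y where xy: "h = mat x + mat y ** g" using centralizer_of_nonscalar h(2) by blast
    \<comment> \<open>The traces of h and hg are linear in the coordinates \<open>x\<close>,
      \<open>y\<close> of \<open>h\<close>, with determinant t^2 - 4. Cramer's rule then bounds the
      coordinates by \<open>R\<close>.\<close>
    define T1 T2 where "T1 = h$1$1 + h$2$2" and "T2 = (h ** g)$1$1 + (h ** g)$2$2"
    have "vabs v T1 \<le> 1" unfolding T1_def
      using trace_small_if_no_eigenvector[OF noeig SL2_subgroup_det[OF G h(1)] xy] .
    \<comment> \<open>By Cayley-Hamilton g^2 = tg - 1, so hg lies in K[g] as well and its trace is
      integral.\<close>
    have "h ** g = mat (- y) + mat (x + y * t) ** g"
      unfolding xy t_def using dg by (simp add: mat2_simps) algebra
    moreover have "det (h ** g) = 1" using SL2_subgroup_det[OF G SL2_subgroup_mult[OF G h(1) g]] .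
    ultimately have "vabs v T2 \<le> 1" unfolding T2_def using trace_small_if_no_eigenvector[OF noeig] by blast
    have T1: "T1 = x + x + y * t" unfolding T1_def xy t_def by (simp add: mat2_mult_nth mat2_mat_nth algebra_simps)
    have T2: "T2 = x * t + y * (t * t - 2)"
      unfolding T2_def xy t_def using dg by (simp add: mat2_mult_nth mat2_mat_nth) algebra
    have "y * (t * t - 4) = 2 * T2 - t * T1" "x * (t * t - 4) = (t * t - 2) * T1 - t * T2"
      unfolding T1 T2 by (simp_all add: algebra_simps)
    moreover have "vabs v (2 * T2 - t * T1) \<le> C * C"
    proof (rule vabs_diff_le)
      show "vabs v (2 * T2) \<le> C * C" using vabs_mult_le[OF two \<open>vabs v T2 \<le> 1\<close>] CC by simp
      show "vabs v (t * T1) \<le> C * C" using vabs_mult_le[OF tC \<open>vabs v T1 \<le> 1\<close>] C0 CC by simp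
    qed
    moreover have "vabs v ((t * t - 2) * T1 - t * T2) \<le> C * C"
    proof (rule vabs_diff_le)
      have "vabs v (t * t - 2) \<le> C * C"
        using vabs_mult_le[OF tC tC C0] two CC by (intro vabs_diff_le) auto
      then show "vabs v ((t * t - 2) * T1) \<le> C * C" using vabs_mult_le[OF _ \<open>vabs v T1 \<le> 1\<close>] CC by fastforce
      show "vabs v (t * T2) \<le> C * C" using vabs_mult_le[OF tC \<open>vabs v T2 \<le> 1\<close>] C0 CC by simp
    qed
    ultimately have "vabs v y * vabs v (t * t - 4) \<le> C * C" "vabs v x * vabs v (t * t - 4) \<le> C * C"
      by (metis vabs_mult)+
    then have "vabs v x \<le> R" "vabs v y \<le> R" unfolding R_def using tne by (simp_all add: le_divide_eq)
    then have "mle (R * C) (mat x)" "mle (R * C) (mat y ** g)"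
    proof -
      have "R * 1 \<le> R * C" using C(1) R0 by (intro mult_left_mono) auto
      then show "mle (R * C) (mat x)" using \<open>vabs v x \<le> R\<close> R0 C0 unfolding mle_def forall_2 mat2_mat_nth by simp
      have "mle R (mat y)" using \<open>vabs v y \<le> R\<close> R0 unfolding mle_def forall_2 mat2_mat_nth by simp
      then show "mle (R * C) (mat y ** g)" using mle_mult C(2) by blast
    qed
    then show ?thesis unfolding xy by (rule mle_add)
  qed
  \<comment> \<open>A conjugate of \<open>g\<close> inside K[g] has the same trace and determinant,
    which leaves \<open>g\<close> and its Galois conjugate.\<close>
  have conj: "c ** g ** adj2 c = mat t - g" if c: "c \<in> G" "c ** g \<noteq> g ** c" for c
  proof -
    have detc: "det c = 1" using SL2_subgroup_det[OF G c(1)] .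
    obtain x y where xy: "c ** g ** adj2 c = mat x + mat y ** g" using norm[OF c(1)] by blast
    define a where "a = c ** g ** adj2 c"
    have da: "det a = 1" unfolding a_def by (simp add: det_mul detc detg)
    have ac: "a ** c = c ** g" unfolding a_def by (rule adj2_cancel(1)[OF detc])
    have tra: "a$1$1 + a$2$2 = t"
    proof -
      have "a$1$1 + a$2$2 = (adj2 c ** (c ** g))$1$1 + (adj2 c ** (c ** g))$2$2"
        unfolding a_def by (simp add: mat2_mult_nth algebra_simps)
      then show ?thesis unfolding matrix_mul_assoc mult_adj2(2)[OF detc] t_def by simp
    qed
    have axy: "a$1$1 = x + y * g$1$1" "a$1$2 = y * g$1$2" "a$2$1 = y * g$2$1" "a$2$2 = x + y * g$2$2"
      unfolding a_def xy by (simp_all add: mat2_mult_nth mat2_mat_nth)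
    have e1: "x + x + y * t = t" using tra unfolding axy t_def by (simp add: algebra_simps)
    have "x * x + x * y * t + y * y = 1" using da dg unfolding det_2 axy t_def by algebra
    moreover have "x * t = x * (x + x + y * t)" using e1 by simp
    ultimately have e2: "x * (t - x) = 1 - y * y" by (simp add: algebra_simps)
    have "t - x - x = y * t" using e1 by (simp add: algebra_simps)
    then have "(t - x - x) * (t - x - x) = y * t * (y * t)" by simp
    \<comment> \<open>Eliminates \<open>y\<close> between the trace and determinant equations; by
      \<open>e2\<close> the right-hand side is 0.\<close>
    then have "(t * t - 4) * (x * (t - x)) = t * t * (x * (t - x) - (1 - y * y))"
      by (simp add: algebra_simps)
    then have "x * (t - x) = 0" using e2 tne by simp
    then have x: "x = 0 \<or> x = t" by auto
    have "y * y = 1" using e2 \<open>x * (t - x) = 0\<close> by simp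
    then have "(y - 1) * (y + 1) = 0" by (simp add: algebra_simps)
    then have y: "y = 1 \<or> y = -1" by (auto simp: eq_neg_iff_add_eq_0)
    have "\<not> (x = 0 \<and> y = 1)"
    proof
      assume "x = 0 \<and> y = 1"
      then have "a = g" by (simp add: mat2_eq_iff axy)
      then show False using ac c(2) by simp
    qed
    moreover have "y = -1" if "x = t" "t \<noteq> 0"
    proof -
      have "(y + 1) * t = 0" using e1 that(1) by (simp add: algebra_simps)
      then show ?thesis using that(2) by (simp add: eq_neg_iff_add_eq_0)
    qed
    moreover have "y = 1" if "x = 0" "t \<noteq> 0" using e1 that by simp
    ultimately have "x = t \<and> y = -1" using x y by blast
    then show ?thesis unfolding xy by (simp add: mat2_eq_iff mat2_mult_nth mat2_mat_nth)
  qed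
  show ?thesis
  proof (cases "\<exists>c\<in>G. c ** g \<noteq> g ** c")
    case False
    then show ?thesis using comm_bound by blast
  next
    case True
    then obtain c where c: "c \<in> G" "c ** g \<noteq> g ** c" by blast
    have detc: "det c = 1" using SL2_subgroup_det[OF G c(1)] .
    obtain D where D: "D \<ge> 1" "mle D c" using ex_mle by blast
    \<comment> \<open>All elements not commuting with \<open>g\<close> lie in the coset of
      \<open>c\<close>, so one factor \<open>D\<close> for the norm of \<open>c\<close> is
      enough.\<close>
    have "mle (max (R * C) (D * (R * C))) d" if d: "d \<in> G" for d
    proof (cases "d ** g = g ** d")
      case True
      then show ?thesis using comm_bound[OF d] by (rule_tac mle_mono) auto
    next
      case False
      have detd: "det d = 1" using SL2_subgroup_det[OF G d] .
      have "c ** g ** adj2 c = d ** g ** adj2 d" using conj[OF c] conj[OF d False] by simp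
      then have "adj2 c ** (c ** g ** adj2 c) ** d = adj2 c ** (d ** g ** adj2 d) ** d" by simp
      then have "(adj2 c ** d) ** g = g ** (adj2 c ** d)"
        by (simp add: matrix_mul_assoc adj2_cancel[OF detd] adj2_cancel[OF detc] mult_adj2[OF detc])
      moreover have "adj2 c ** d \<in> G" using c d by (intro SL2_subgroup_mult[OF G] SL2_subgroup_adj2[OF G])
      ultimately have "mle (R * C) (adj2 c ** d)" using comm_bound by blast
      then have "mle (D * (R * C)) (c ** (adj2 c ** d))" using D(2) mle_mult by blast
      then have "mle (D * (R * C)) d" by (simp add: matrix_mul_assoc mult_adj2(1)[OF detc])
      then show ?thesis by (rule mle_mono) simp
    qed
    then show ?thesis by blast
  qed
qed

text \<open>Determinant 1 forces the homothety factor of \<open>g\<close> on the lattice to be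
  integral, so \<open>g\<close> is an integral matrix in a basis of the lattice; changing back to
  the standard basis costs a constant.\<close>

lemma stab_vertex_imp_bounded:
  assumes G: "SL2_subgroup G" and st: "stab_vertex v G"
  shows "\<exists>C. \<forall>g\<in>G. mle C g"
proof -
  obtain L where L: "lattice v L" "\<And>g. g \<in> G \<Longrightarrow> BT_act g (lattice_class L) = lattice_class L"
    using st unfolding stab_vertex_def BT_vertices_def by blast
  obtain u w where np: "\<not> par u w" and Luw: "L = boxlat u w 1 1" using lattice_eq_boxlat[OF L(1)] .
  define B :: "'k^2^2" where "B = vector [vector [u$1, w$1], vector [u$2, w$2]]"
  have detB: "det B = u$1 * w$2 - u$2 * w$1" by (simp add: B_def det_2 mult.commute)
  then have B0: "det B \<noteq> 0" using np by (simp add: par_def)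
  obtain r where r: "r \<ge> 1" "mle r B" using ex_mle by blast
  have "mle (r * 1 * r / vabs v (det B)) g" if g: "g \<in> G" for g
  proof -
    have detg: "det g = 1" using SL2_subgroup_det[OF G g] .
    obtain c where c: "c \<noteq> 0" "(\<lambda>z. g *v z) ` L = (\<lambda>z. c *s z) ` L"
      using lattice_class_eqD L(2)[OF g] unfolding BT_act_lattice_class by metis
    then have eq: "boxlat (g *v u) (g *v w) 1 1 = boxlat u w (vabs v c) (vabs v c)"
      using boxlat_scale[OF c(1), of u w 1 1] by (simp add: Luw boxlat_mult)
    have "c *s u \<in> boxlat (g *v u) (g *v w) 1 1" unfolding eq by (rule boxlatI'[of _ c _ 0]) auto
    then obtain x y where xy: "c *s u = x *s (g *v u) + y *s (g *v w)" "vabs v x \<le> 1" "vabs v y \<le> 1"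
      unfolding boxlat_def by blast
    have "c *s w \<in> boxlat (g *v u) (g *v w) 1 1" unfolding eq by (rule boxlatI'[of _ 0 _ c]) auto
    then obtain x' y' where xy': "c *s w = x' *s (g *v u) + y' *s (g *v w)" "vabs v x' \<le> 1" "vabs v y' \<le> 1"
      unfolding boxlat_def by blast
    \<comment> \<open>Compares the areas spanned by the two bases of the same lattice.\<close>
    have "c * c * (u$1 * w$2 - u$2 * w$1) = (c *s u)$1 * (c *s w)$2 - (c *s u)$2 * (c *s w)$1"
      by (simp add: algebra_simps)
    also have "\<dots> = (x * y' - y * x') * det g * (u$1 * w$2 - u$2 * w$1)"
      unfolding xy(1) xy'(1) by (simp add: mat2_vec_nth det_2 algebra_simps)
    finally have "c * c = x * y' - y * x'" using np detg by (simp add: par_def)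
    moreover have "vabs v (x * y' - y * x') \<le> 1"
      using vabs_mult_le[OF xy(2) xy'(3)] vabs_mult_le[OF xy(3) xy'(2)] by (intro vabs_diff_le) auto
    ultimately have "vabs v c * vabs v c \<le> 1" by (metis vabs_mult)
    then have c1: "vabs v c \<le> 1" by (metis mult_le_one not_le_imp_less less_1_mult order_less_irrefl
          less_le_trans)
    have "g *v u \<in> boxlat u w (vabs v c) (vabs v c)" unfolding eq[symmetric] by (rule boxlatI'[of _ 1 _ 0]) auto
    then obtain a b where ab: "g *v u = a *s u + b *s w" "vabs v a \<le> vabs v c" "vabs v b \<le> vabs v c"
      unfolding boxlat_def by blast
    have "g *v w \<in> boxlat u w (vabs v c) (vabs v c)" unfolding eq[symmetric] by (rule boxlatI'[of _ 0 _ 1]) auto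
    then obtain a' b' where ab': "g *v w = a' *s u + b' *s w" "vabs v a' \<le> vabs v c" "vabs v b' \<le> vabs v c"
      unfolding boxlat_def by blast
    define A :: "'k^2^2" where "A = vector [vector [a, a'], vector [b, b']]"
    have A1: "mle 1 A" unfolding mle_def forall_2 A_def using ab ab' c1 by auto
    have gB: "g ** B = B ** A"
      using ab(1) ab'(1) by (simp add: mat2_eq_iff vec2_eq_iff mat2_mult_nth mat2_vec_nth A_def B_def mult.commute)
    have "mle (r * 1 * r) (B ** A ** adj2 B)" using r(2) A1 by (intro mle_mult mle_adj2)
    moreover have "(B ** A ** adj2 B)$i$j = g$i$j * det B" for i j
    proof -
      have "B ** adj2 B = mat (det B)" by (simp add: mat2_eq_iff mat2_mult_nth mat2_mat_nth det_2 algebra_simps)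
      then have "B ** A ** adj2 B = g ** mat (det B)" by (metis gB matrix_mul_assoc)
      then show ?thesis using exhaust_2[of i] exhaust_2[of j] by (auto simp: mat2_mult_nth mat2_mat_nth)
    qed
    ultimately show ?thesis unfolding mle_def using B0 by (simp add: vabs_mult le_divide_eq)
  qed
  then show ?thesis by blast
qed

text \<open>A bounded set of matrices is covered by finitely many small balls, and two group
  elements in one ball have a quotient so close to \<open>1\<close> that it is trivial.\<close>

lemma finite_if_bounded_discrete:
  assumes G: "SL2_subgroup G" and disc: "discrete_set v G" and bd: "\<And>g. g \<in> G \<Longrightarrow> mle C g"
  shows "finite G"
proof -
  obtain e where e: "e > 0" "\<And>h. h \<in> G \<Longrightarrow> mle e (h - mat 1) \<Longrightarrow> h = mat 1"
    using discrete_near_one[OF disc G] by blast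
  define C' where "C' = max C 1"
  have C': "C' > 0" "C \<le> C'" by (auto simp: C'_def)
  \<comment> \<open>Passing from g - h to the quotient multiplies by the inverse of
    \<open>h\<close>, of norm at most \<open>C'\<close>.\<close>
  define d where "d = e / C'"
  have d: "d > 0" "d * C' = e" using e(1) C' by (auto simp: d_def)
  obtain F where F: "finite F" "\<forall>x. vabs v x \<le> C \<longrightarrow> (\<exists>f\<in>F. vabs v (x - f) < d)"
    using finite_cover_ball[OF d(1)] by blast
  then obtain k where k: "\<And>x. vabs v x \<le> C \<Longrightarrow> k x \<in> F \<and> vabs v (x - k x) < d" by metis
  define \<psi> where "\<psi> g = (k (g$1$1), k (g$1$2), k (g$2$1), k (g$2$2))" for g :: "'k^2^2"
  have "inj_on \<psi> G"
  proof (rule inj_onI)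
    fix g h assume gh: "g \<in> G" "h \<in> G" "\<psi> g = \<psi> h"
    have close: "vabs v (x - y) \<le> d" if "k x = k y" "vabs v x \<le> C" "vabs v y \<le> C" for x y
    proof -
      have "vabs v ((x - k x) - (y - k y)) < d" using k[OF that(2)] k[OF that(3)] by (blast intro: vabs_diff_less)
      then show ?thesis using that(1) by simp
    qed
    have b: "vabs v (g$i$j) \<le> C" "vabs v (h$i$j) \<le> C" for i j using bd gh mle_nth by blast+
    have "mle d (g - h)" unfolding mle_def forall_2 using gh(3) close b by (simp add: \<psi>_def)
    moreover have "mle C' (adj2 h)" using mle_adj2 mle_mono[OF bd[OF gh(2)] C'(2)] by blast
    ultimately have "mle e ((g - h) ** adj2 h)" using mle_mult d(2) by metis
    moreover have deth: "det h = 1" using SL2_subgroup_det[OF G gh(2)] .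
    have "(g - h) ** adj2 h = g ** adj2 h - h ** adj2 h"
      by (simp add: mat2_eq_iff mat2_mult_nth algebra_simps)
    ultimately have "mle e (g ** adj2 h - mat 1)" using mult_adj2(1)[OF deth] by simp
    moreover have "g ** adj2 h \<in> G" using gh by (intro SL2_subgroup_mult[OF G] SL2_subgroup_adj2[OF G])
    ultimately have "g ** adj2 h = mat 1" using e(2) by blast
    then show "g = h" using adj2_cancel(1)[OF deth, of g] by simp
  qed
  moreover have "\<psi> ` G \<subseteq> F \<times> F \<times> F \<times> F" using k bd mle_nth unfolding \<psi>_def by blast
  ultimately show ?thesis using F(1) by (meson finite_SigmaI inj_on_finite)
qed

lemma ex_largest_vabs:
  assumes "P x0" "\<And>x. P x \<Longrightarrow> x \<noteq> 0 \<and> vabs v x \<le> 1"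
  obtains x where "P x" "\<And>y. P y \<Longrightarrow> vabs v y \<le> vabs v x"
proof -
  obtain x where x: "P x" "\<And>y. P y \<Longrightarrow> nat (v x) \<le> nat (v y)"
    using ex_has_least_nat[of P x0 "\<lambda>x. nat (v x)"] assms(1) by blast
  have "v y \<ge> 0" if "P y" for y
    using assms(2)[OF that] OK_iff[of y] by (auto simp: OK_def)
  then have "v x \<le> v y" if "P y" for y using x(2)[OF that] x(1) that by (metis nat_le_eq_zle)
  then show ?thesis using x(1) assms(2) by (intro that[of x]) (simp_all add: vabs_le_iff)
qed

text \<open>The vectors whose whole orbit is integral form an invariant lattice.\<close>

lemma bounded_imp_stab_vertex:
  assumes G: "SL2_subgroup G" and bd: "\<And>g. g \<in> G \<Longrightarrow> mle C g"
  shows "stab_vertex v G"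
proof -
  define M where "M = {z. \<forall>g\<in>G. vabs v ((g *v z)$1) \<le> 1 \<and> vabs v ((g *v z)$2) \<le> 1}"
  have one: "mat 1 \<in> G" using SL2_subgroup_one[OF G] .
  have lin: "z - a *s z' \<in> M" if "z \<in> M" "z' \<in> M" "vabs v a \<le> 1" for z z' a
  proof -
    have "g *v (z - a *s z') = g *v z - a *s (g *v z')" for g :: "'k^2^2"
      by (simp add: vec2_eq_iff mat2_vec_nth algebra_simps)
    moreover have "vabs v (a * t) \<le> 1" if "vabs v t \<le> 1" for t
      using vabs_mult_le[OF \<open>vabs v a \<le> 1\<close> that] by simp
    ultimately show ?thesis using that(1,2) unfolding M_def by (simp add: vabs_diff_le)
  qed
  have unit: "vabs v (z$1) \<le> 1" "vabs v (z$2) \<le> 1" if "z \<in> M" for z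
    using that one unfolding M_def by (metis (mono_tags, lifting) matrix_vector_mul_lid mem_Collect_eq)+
  define C' where "C' = max C 1"
  \<comment> \<open>\<open>q\<close> times the standard lattice lies in \<open>M\<close>, which
    makes the two maximisations below nonvacuous; \<open>unit\<close> bounds \<open>M\<close> from
    above.\<close>
  obtain q where q: "q \<noteq> 0" "C' * vabs v q \<le> 1"
  proof -
    obtain p where p: "p \<noteq> 0" "vabs v p = 1/2" using ex_vabs_half by blast
    obtain n where "C' < 2 ^ n" using real_arch_pow[of 2 C'] by auto
    then have "C' * (1/2) ^ n \<le> 1" by (simp add: power_divide)
    then show ?thesis using p(1) by (intro that[of "p ^ n"]) (simp_all add: vabs_power p(2))
  qed
  have small: "z \<in> M" if "vabs v (z$1) \<le> vabs v q" "vabs v (z$2) \<le> vabs v q" for z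
  proof -
    have "vabs v (g$i$j * z$j) \<le> 1" if "g \<in> G" "vabs v (z$j) \<le> vabs v q" for g i j
    proof -
      have "vabs v (g$i$j) \<le> C'" using mle_nth[OF bd[OF that(1)], of i j] by (simp add: C'_def)
      moreover have "0 \<le> C'" by (simp add: C'_def)
      ultimately show ?thesis using vabs_mult_le[OF _ that(2)] q(2) by (meson order_trans)
    qed
    then show ?thesis unfolding M_def using that by (simp add: mat2_vec_nth vabs_add_le)
  qed
  \<comment> \<open>A triangular basis of \<open>M\<close>: \<open>u\<close> has the largest
    possible first coordinate, \<open>w\<close> is largest among the vectors with first coordinate
    0. The maxima exist because the valuation is discrete.\<close>
  obtain x0 where x0: "x0 \<noteq> 0 \<and> (\<exists>z\<in>M. z$1 = x0)"
    and x0max: "\<And>x. x \<noteq> 0 \<and> (\<exists>z\<in>M. z$1 = x) \<Longrightarrow> vabs v x \<le> vabs v x0"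
  proof (rule ex_largest_vabs[of "\<lambda>x. x \<noteq> 0 \<and> (\<exists>z\<in>M. z$1 = x)" q])
    show "q \<noteq> 0 \<and> (\<exists>z\<in>M. z$1 = q)" using q(1) by (auto intro!: bexI[of _ "vector [q, 0]"] small)
  qed (use unit in auto)
  obtain y1 where y1: "y1 \<noteq> 0 \<and> vector [0, y1] \<in> M"
    and y1max: "\<And>y. y \<noteq> 0 \<and> vector [0, y] \<in> M \<Longrightarrow> vabs v y \<le> vabs v y1"
  proof (rule ex_largest_vabs[of "\<lambda>y. y \<noteq> 0 \<and> vector [0, y] \<in> M" q])
    show "q \<noteq> 0 \<and> vector [0, q] \<in> M" using q(1) by (auto intro!: small)
    show "y \<noteq> 0 \<and> vabs v y \<le> 1" if "y \<noteq> 0 \<and> vector [0, y] \<in> M" for y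
      using that unit(2)[of "vector [0, y]"] by simp
  qed auto
  obtain u where u: "u \<in> M" "u$1 = x0" using x0 by blast
  define w :: "'k^2" where "w = vector [0, y1]"
  have w: "w \<in> M" "w$1 = 0" "w$2 = y1" using y1 by (auto simp: w_def)
  have np: "\<not> par u w" using x0 y1 u w by (simp add: par_def)
  have zero: "0 \<in> M" by (rule small) auto
  have "M = boxlat u w 1 1"
  proof (intro equalityI subsetI)
    fix z assume z: "z \<in> M"
    define a where "a = z$1 / x0"
    have a: "vabs v a \<le> 1"
      using x0max[of "z$1"] z x0 by (cases "z$1 = 0") (auto simp: a_def vabs_divide divide_le_eq)
    define z' where "z' = z - a *s u"
    have z': "z' \<in> M" unfolding z'_def using lin[OF z u(1) a] .
    have z'1: "z'$1 = 0" using x0 u by (simp add: z'_def a_def)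
    then have "z' = vector [0, z'$2]" by (simp add: vec2_eq_iff)
    define b where "b = z'$2 / y1"
    have b: "vabs v b \<le> 1"
      using y1max[of "z'$2"] z' \<open>z' = vector [0, z'$2]\<close> y1
      by (cases "z'$2 = 0") (auto simp: b_def vabs_divide divide_le_eq)
    have "z' = b *s w" using z'1 w y1 by (simp add: vec2_eq_iff b_def)
    then have "z = a *s u + b *s w" unfolding z'_def by (simp add: algebra_simps)
    then show "z \<in> boxlat u w 1 1" using a b by (rule boxlatI')
  next
    fix z assume "z \<in> boxlat u w 1 1"
    then obtain a b where ab: "z = a *s u + b *s w" "vabs v a \<le> 1" "vabs v b \<le> 1"
      unfolding boxlat_def by blast
    have "z = (0 - (- a) *s u) - (- b) *s w" by (simp add: ab vec2_eq_iff)
    moreover have "\<dots> \<in> M" by (intro lin zero u w) (simp_all add: ab)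
    ultimately show "z \<in> M" by (simp only:)
  qed
  then have "lattice v M" using lattice_boxlat[OF np, of 0] by simp
  moreover have "BT_act g (lattice_class M) = lattice_class M" if g: "g \<in> G" for g
  proof -
    have sub: "(\<lambda>z. h *v z) ` M \<subseteq> M" if "h \<in> G" for h
      using that SL2_subgroup_mult[OF G] unfolding M_def by (auto simp: matrix_vector_mul_assoc)
    have "M \<subseteq> (\<lambda>z. g *v z) ` M"
    proof
      fix z assume "z \<in> M"
      then have "adj2 g *v z \<in> M" using sub[OF SL2_subgroup_adj2[OF G g]] by blast
      moreover have "z = g *v (adj2 g *v z)" using adj2_mult_vec(2)[OF SL2_subgroup_det[OF G g]] by simp
      ultimately show "z \<in> (\<lambda>z. g *v z) ` M" by blast
    qed
    then have "(\<lambda>z. g *v z) ` M = M" using sub[OF g] by blast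
    then show ?thesis by (simp add: BT_act_lattice_class)
  qed
  ultimately show ?thesis unfolding stab_vertex_def BT_vertices_def by blast
qed

lemma elementary_if_metabelian:
  assumes G: "SL2_subgroup G" and meta: "metabelian G"
  shows "elementary v G"
proof (rule ccontr)
  assume ne: "\<not> elementary v G"
  have noline: "\<exists>g\<in>G. \<not> par (g *v u) u" if "u \<noteq> 0" for u
    using ne stab_end_iff[OF G] that unfolding elementary_def by blast
  obtain g z where g: "g \<in> G" "\<not> par (g *v z) z"
    and norm: "\<And>c. c \<in> G \<Longrightarrow> \<exists>x y. c ** g ** adj2 c = mat x + mat y ** g"
    using ex_normalized_subalgebra[OF G meta noline] by metis
  show False
  proof (cases "\<exists>u. u \<noteq> 0 \<and> par (g *v u) u")
    case True
    then obtain u where u: "u \<noteq> 0" "par (g *v u) u" by blast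
    have "stab_end_pair v G"
      unfolding stab_end_pair_iff[OF G] using line_pair_if_eigenvector[OF G noline g norm u] .
    then show False using ne unfolding elementary_def by blast
  next
    case False
    then obtain C where "\<forall>c\<in>G. mle C c" using bounded_if_no_eigenvector[OF G g(1) _ norm] by metis
    then have "stab_vertex v G" using bounded_imp_stab_vertex[OF G] by blast
    then show False using ne unfolding elementary_def by blast
  qed
qed

lemma elementary_if_finite:
  assumes "SL2_subgroup G" "finite G"
  shows "elementary v G"
  unfolding elementary_def using bounded_imp_stab_vertex[OF assms(1)] ex_mle_finite[OF assms(2)] by blast

end

section \<open>The limit group\<close>

context algebraic_limit
begin

lemma \<phi>lim_inj_on:
  assumes d: "d > 0" "\<And>c. c \<in> \<Gamma> \<Longrightarrow> mle d (\<phi>lim c - mat 1) \<Longrightarrow> c = mat 1"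
  shows "inj_on \<phi>lim \<Gamma>"
proof (rule inj_onI)
  fix a b assume ab: "a \<in> \<Gamma>" "b \<in> \<Gamma>" "\<phi>lim a = \<phi>lim b"
  have c: "a ** adj2 b \<in> \<Gamma>" using ab by (intro SL2_subgroup_mult[OF \<Gamma>_sub] SL2_subgroup_adj2[OF \<Gamma>_sub])
  have "\<phi>lim (a ** adj2 b) = mat 1"
    using ab SL2_subgroup_adj2[OF \<Gamma>_sub] mult_adj2(1)[OF det_\<phi>lim[OF ab(2)]]
    by (simp add: \<phi>lim_mult \<phi>lim_adj2)
  then have "mle d (\<phi>lim (a ** adj2 b) - mat 1)" using d(1) by (simp add: mle_def)
  then have "a ** adj2 b = mat 1" using d(2)[OF c] by blast
  then show "a = b" using adj2_cancel(1)[OF SL2_subgroup_det[OF \<Gamma>_sub ab(2)], of a] by simp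
qed

lemma limit_subgroup: "SL2_subgroup (\<phi>lim ` \<Gamma>)"
  unfolding SL2_subgroup_def
proof (intro conjI ballI)
  show "\<phi>lim ` \<Gamma> \<subseteq> SL2" using conv by blast
  show "mat 1 \<in> \<phi>lim ` \<Gamma>" using \<phi>lim_one SL2_subgroup_one[OF \<Gamma>_sub] by (metis imageI)
next
  fix x y assume "x \<in> \<phi>lim ` \<Gamma>" "y \<in> \<phi>lim ` \<Gamma>"
  then show "x ** y \<in> \<phi>lim ` \<Gamma>"
    using SL2_subgroup_mult[OF \<Gamma>_sub] by (auto simp flip: \<phi>lim_mult)
next
  fix x assume "x \<in> \<phi>lim ` \<Gamma>"
  then obtain a where a: "a \<in> \<Gamma>" "x = \<phi>lim a" by blast
  then have "x ** \<phi>lim (adj2 a) = mat 1" using mult_adj2(1)[OF det_\<phi>lim] by (simp add: \<phi>lim_adj2)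
  then show "\<exists>y\<in>\<phi>lim ` \<Gamma>. x ** y = mat 1" using SL2_subgroup_adj2[OF \<Gamma>_sub a(1)] by blast
qed

lemma limit_discrete:
  assumes d: "d > 0" "\<And>c. c \<in> \<Gamma> \<Longrightarrow> mle d (\<phi>lim c - mat 1) \<Longrightarrow> c = mat 1"
  shows "discrete_set v (\<phi>lim ` \<Gamma>)"
  unfolding discrete_set_def
proof
  fix g assume "g \<in> \<phi>lim ` \<Gamma>"
  then obtain a where a: "a \<in> \<Gamma>" "g = \<phi>lim a" by blast
  obtain C where C: "C \<ge> 1" "mle C g" using ex_mle by blast
  \<comment> \<open>Multiplying by \<open>adj2 g\<close>, of norm at most \<open>C\<close>, turns
    distance \<open>d / C\<close> from \<open>g\<close> into distance \<open>d\<close> from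
    \<open>1\<close>.\<close>
  have "h = g" if h: "h \<in> \<phi>lim ` \<Gamma>" and close: "\<forall>i j. vdist v (h$i$j) (g$i$j) < d / C" for h
  proof -
    obtain b where b: "b \<in> \<Gamma>" "h = \<phi>lim b" using h by blast
    have detg: "det g = 1" using a det_\<phi>lim by simp
    have "mle (d / C) (h - g)" using close unfolding mle_def vdist_def by (simp add: less_imp_le)
    then have "mle (d / C * C) ((h - g) ** adj2 g)" using C(2) mle_adj2 mle_mult by blast
    moreover have "(h - g) ** adj2 g = h ** adj2 g - g ** adj2 g"
      by (simp add: mat2_eq_iff mat2_mult_nth algebra_simps)
    ultimately have "mle d (h ** adj2 g - mat 1)" using mult_adj2(1)[OF detg] C(1) by simp
    moreover have "h ** adj2 g = \<phi>lim (b ** adj2 a)"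
      using a b SL2_subgroup_adj2[OF \<Gamma>_sub] by (simp add: \<phi>lim_mult \<phi>lim_adj2)
    moreover have "b ** adj2 a \<in> \<Gamma>"
      using a b by (intro SL2_subgroup_mult[OF \<Gamma>_sub] SL2_subgroup_adj2[OF \<Gamma>_sub])
    ultimately have "b ** adj2 a = mat 1" using d(2) by simp
    then have "b = a" using adj2_cancel(1)[OF SL2_subgroup_det[OF \<Gamma>_sub a(1)], of b] by simp
    then show ?thesis using a b by simp
  qed
  moreover have "d / C > 0" using d(1) C(1) by simp
  ultimately show "\<exists>e>0. \<forall>h\<in>\<phi>lim ` \<Gamma>. (\<forall>i j. vdist v (h$i$j) (g$i$j) < e) \<longrightarrow> h = g" by blast
qed

text \<open>The relation is one between words, so it is reflected by an injective homomorphism;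
  invariance of a line would not be.\<close>

lemma metabelian_if_limit_metabelian:
  assumes inj: "inj_on \<phi>lim \<Gamma>" and meta: "metabelian (\<phi>lim ` \<Gamma>)"
  shows "metabelian \<Gamma>"
  unfolding metabelian_def
proof (intro ballI)
  have mc: "\<phi>lim (mcomm a b) = mcomm (\<phi>lim a) (\<phi>lim b)" if "a \<in> \<Gamma>" "b \<in> \<Gamma>" for a b
    unfolding mcomm_def using that
    by (simp add: \<phi>lim_mult \<phi>lim_adj2 SL2_subgroup_mult[OF \<Gamma>_sub] SL2_subgroup_adj2[OF \<Gamma>_sub])
  fix a b c d assume abcd: "a \<in> \<Gamma>" "b \<in> \<Gamma>" "c \<in> \<Gamma>" "d \<in> \<Gamma>"
  have in\<Gamma>: "mcomm a b \<in> \<Gamma>" "mcomm c d \<in> \<Gamma>" using abcd mcomm_closed[OF \<Gamma>_sub] by blast+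
  have "mcomm (\<phi>lim a) (\<phi>lim b) ** mcomm (\<phi>lim c) (\<phi>lim d)
      = mcomm (\<phi>lim c) (\<phi>lim d) ** mcomm (\<phi>lim a) (\<phi>lim b)"
    using meta abcd unfolding metabelian_def by simp
  then have "\<phi>lim (mcomm a b ** mcomm c d) = \<phi>lim (mcomm c d ** mcomm a b)"
    using abcd in\<Gamma> by (simp add: \<phi>lim_mult mc)
  then show "mcomm a b ** mcomm c d = mcomm c d ** mcomm a b"
    using inj_onD[OF inj] SL2_subgroup_mult[OF \<Gamma>_sub] in\<Gamma> by blast
qed

text \<open>Ends yield a relation to pull back to \<Gamma>. A fixed vertex yields none; there
  finiteness is pulled back instead.\<close>

lemma elementary_if_limit_elementary:
  assumes inj: "inj_on \<phi>lim \<Gamma>" and disc: "discrete_set v (\<phi>lim ` \<Gamma>)"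
    and elem: "elementary v (\<phi>lim ` \<Gamma>)"
  shows "elementary v \<Gamma>"
proof -
  let ?G = "\<phi>lim ` \<Gamma>"
  have G: "SL2_subgroup ?G" by (rule limit_subgroup)
  consider "stab_vertex v ?G" | "stab_end v ?G" | "stab_end_pair v ?G"
    using elem unfolding elementary_def by blast
  then show ?thesis
  proof cases
    case 1
    then obtain C where "\<forall>g\<in>?G. mle C g" using stab_vertex_imp_bounded[OF G] by blast
    then have "finite ?G" using finite_if_bounded_discrete[OF G disc] by blast
    then have "finite \<Gamma>" using inj finite_imageD by blast
    then show ?thesis using elementary_if_finite[OF \<Gamma>_sub] by blast
  next
    case 2
    then obtain u where "u \<noteq> 0" "\<forall>g\<in>?G. par (g *v u) u" unfolding stab_end_iff[OF G] by blast
    then have "metabelian ?G" using metabelian_if_line[OF G] by blast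
    then show ?thesis using metabelian_if_limit_metabelian[OF inj] elementary_if_metabelian[OF \<Gamma>_sub] by blast
  next
    case 3
    then obtain u w where "\<not> par u w"
      "\<forall>g\<in>?G. (par (g *v u) u \<and> par (g *v w) w) \<or> (par (g *v u) w \<and> par (g *v w) u)"
      unfolding stab_end_pair_iff[OF G] by blast
    then have "metabelian ?G" using metabelian_if_line_pair[OF G] by blast
    then show ?thesis using metabelian_if_limit_metabelian[OF inj] elementary_if_metabelian[OF \<Gamma>_sub] by blast
  qed
qed

end

theorem theorem1p5:
  fixes v :: "'k::field \<Rightarrow> int"
    and \<Gamma> :: "('k^2^2) set"
    and \<phi> :: "nat \<Rightarrow> 'k^2^2 \<Rightarrow> 'k^2^2"
    and \<phi>lim :: "'k^2^2 \<Rightarrow> 'k^2^2"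
    and G :: "('k^2^2) set"
  assumes K: "nonarch_local_field v"
    and \<Gamma>_sub: "SL2_subgroup \<Gamma>"
    and \<Gamma>_disc: "discrete_set v \<Gamma>"
    and \<Gamma>_nonel: "\<not> elementary v \<Gamma>"
    and Gn_sub: "\<forall>n\<ge>1. SL2_subgroup (\<phi> n ` \<Gamma>)"
    and \<phi>n_iso: "\<forall>n\<ge>1. group_iso (\<phi> n) \<Gamma> (\<phi> n ` \<Gamma>)"
    and Gn_disc: "\<exists>N. \<forall>n\<ge>N. discrete_set v (\<phi> n ` \<Gamma>)"
    and conv: "\<forall>\<gamma>\<in>\<Gamma>. \<phi>lim \<gamma> \<in> SL2 \<and> mconv v (\<lambda>n. \<phi> n \<gamma>) (\<phi>lim \<gamma>)"
    and G_def: "G = \<phi>lim ` \<Gamma>"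
  shows "SL2_subgroup G \<and> discrete_set v G \<and> \<not> elementary v G \<and> group_iso \<phi>lim \<Gamma> G"
proof -
  interpret algebraic_limit v \<Gamma> \<phi> \<phi>lim
    by unfold_locales (use assms in auto)
  have "\<exists>g\<in>\<Gamma>. \<not> par (g *v u) u" if "u \<noteq> 0" for u
    using \<Gamma>_nonel stab_end_iff[OF \<Gamma>_sub] that unfolding elementary_def by blast
  then obtain d where d: "d > 0" "\<And>c. c \<in> \<Gamma> \<Longrightarrow> mle d (\<phi>lim c - mat 1) \<Longrightarrow> c = mat 1"
    using \<phi>lim_near_one_trivial by metis
  have inj: "inj_on \<phi>lim \<Gamma>" using \<phi>lim_inj_on[OF d] .
  have disc: "discrete_set v G" unfolding G_def using limit_discrete[OF d] .
  have "\<not> elementary v G"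
    using elementary_if_limit_elementary[OF inj] disc \<Gamma>_nonel unfolding G_def by blast
  moreover have "group_iso \<phi>lim \<Gamma> G"
    unfolding group_iso_def bij_betw_def G_def using inj \<phi>lim_mult by blast
  ultimately show ?thesis using limit_subgroup disc unfolding G_def by blast
qed

end
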